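(* It is NP-hard to decide whether the feasible region $$\{x \in \mathbb{R}^n : x^{\mathsf T} x \le 1,\ x \in \Pi_p(b^1,\dots,b^n) + \{c\}\}$$ of the mixed integer trust region problem is nonempty, where the input consists of $p \in \{0,1,\dots,n\}$, linearly independent vectors $b^1,\dots,b^n \in \mathbb{Q}^n$, and $c \in \mathbb{Q}^n$. This holds even if $p = n$.
   Context: For linearly independent $b^1,\dots,b^n$ and $p \in \{0,\dots,n\}$, the mixed integer lattice is $$\Pi_p(b^1,\dots,b^n) := \Big\{\sum_{i=1}^n \mu_i b^i : \mu_i \in \mathbb{Z}\ \forall i=1,\dots,p,\ \mu_i \in \mathbb{R}\ \forall i=p+1,\dots,n\Big\}.$$ The mixed integer trust region problem (MITR) is: minimize $x^{\mathsf T} H x + h^{\mathsf T} x$ subject to $x^{\mathsf T} x \le 1$ and $x \in \Pi_p(b^1,\dots,b^n)+\{c\}$, with $H \in \mathbb{Q}^{n\times n}$ symmetric and $h \in \mathbb{Q}^n$. *)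

theory Defs
  imports Jordan_Normal_Form.VS_Connect "HOL-Computational_Algebra.Polynomial"
begin

section \<open>Turing machines\<close>

text \<open>
  Nondeterministic machines with finitely many two-way infinite tapes. States and tape symbols are
  natural numbers; the tape symbol 0 is the blank, and the input bits \<open>False\<close> and \<open>True\<close> are
  written as 1 and 2. A transition \<open>(q, rs, q', as)\<close> applies in state \<open>q\<close> if the symbols under the
  heads are \<open>rs\<close>; it changes the state to \<open>q'\<close> and performs the write-and-move action \<open>as ! j\<close>
  on tape \<open>j\<close>. Finiteness of the set of transitions makes the sets of states and tape symbols
  that are actually used finite.
\<close>

datatype move = Move_Left | Stay | Move_Right

type_synonym transition = "nat \<times> nat list \<times> nat \<times> (nat \<times> move) list"

record tm =
  num_tapes :: nat
  start_state :: nat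
  accept_state :: nat
  transitions :: "transition set"

definition wf_tm :: "tm \<Rightarrow> bool" where
  "wf_tm M \<longleftrightarrow> num_tapes M \<ge> 1 \<and> finite (transitions M) \<and>
     (\<forall>(q, rs, q', as) \<in> transitions M.
        q \<noteq> accept_state M \<and> length rs = num_tapes M \<and> length as = num_tapes M)"

definition deterministic :: "tm \<Rightarrow> bool" where
  "deterministic M \<longleftrightarrow>
     (\<forall>q rs q1 as1 q2 as2. (q, rs, q1, as1) \<in> transitions M \<longrightarrow> (q, rs, q2, as2) \<in> transitions M \<longrightarrow>
        q1 = q2 \<and> as1 = as2)"

text \<open>A tape consists of the head position and the contents of the cells.\<close>

type_synonym tape = "int \<times> (int \<Rightarrow> nat)"
type_synonym tm_config = "nat \<times> tape list"

fun head_symbol :: "tape \<Rightarrow> nat" where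
  "head_symbol (h, t) = t h"

fun move_offset :: "move \<Rightarrow> int" where
  "move_offset Move_Left = - 1"
| "move_offset Stay = 0"
| "move_offset Move_Right = 1"

fun tape_action :: "nat \<times> move \<Rightarrow> tape \<Rightarrow> tape" where
  "tape_action (a, d) (h, t) = (h + move_offset d, t(h := a))"

inductive tm_step :: "tm \<Rightarrow> tm_config \<Rightarrow> tm_config \<Rightarrow> bool" for M where
  "(q, map head_symbol ts, q', as) \<in> transitions M \<Longrightarrow>
     tm_step M (q, ts) (q', map2 tape_action as ts)"

definition halted :: "tm \<Rightarrow> tm_config \<Rightarrow> bool" where
  "halted M C \<longleftrightarrow> (\<nexists>C'. tm_step M C C')"

definition word_cells :: "bool list \<Rightarrow> int \<Rightarrow> nat" where
  "word_cells w i =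
     (if 0 \<le> i \<and> i < int (length w) then (if w ! nat i then 2 else 1) else 0)"

definition init_config :: "tm \<Rightarrow> bool list \<Rightarrow> tm_config" where
  "init_config M w =
     (start_state M, (0, word_cells w) # replicate (num_tapes M - 1) (0, word_cells []))"


section \<open>NP-hardness\<close>

text \<open>
  Time bounds are polynomials with natural number coefficients in the input length. A nondeterministic
  machine runs in polynomial time if all its computations obey the bound.
\<close>

definition NP :: "bool list set set" where
  "NP = {L. \<exists>M b. wf_tm M \<and>
     (\<forall>w. (\<forall>t C. (tm_step M ^^ t) (init_config M w) C \<longrightarrow> t \<le> poly b (length w)) \<and>
          (w \<in> L \<longleftrightarrow> (\<exists>t C. (tm_step M ^^ t) (init_config M w) C \<and> fst C = accept_state M)))}"

text \<open>
  The last tape is the output tape. When the machine halts it must contain the output word, starting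
  at cell 0, and be blank everywhere else.
\<close>

definition polytime_computable :: "(bool list \<Rightarrow> bool list) \<Rightarrow> bool" where
  "polytime_computable f \<longleftrightarrow> (\<exists>M b. wf_tm M \<and> deterministic M \<and>
     (\<forall>w. \<exists>t C. t \<le> poly b (length w) \<and> (tm_step M ^^ t) (init_config M w) C \<and> halted M C \<and>
          snd (last (snd C)) = word_cells (f w)))"

text \<open>
  A decision problem is given by an encoding of objects as binary words, the set of its instances,
  and the set of its yes-instances. Hardness is with respect to polynomial-time many-one reductions.
  Every word must be mapped to (the code of) an instance, so that a conclusion of hardness does not
  rely on ill-formed inputs.
\<close>

definition NP_hard :: "('a \<Rightarrow> bool list) \<Rightarrow> 'a set \<Rightarrow> 'a set \<Rightarrow> bool" where
  "NP_hard enc insts yes \<longleftrightarrow>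
     (\<forall>L \<in> NP. \<exists>g. (\<forall>w. g w \<in> insts \<and> (w \<in> L \<longleftrightarrow> g w \<in> yes)) \<and>
        polytime_computable (\<lambda>w. enc (g w)))"


section \<open>Binary encodings\<close>

text \<open>Binary expansion, least significant bit first; the expansion of 0 is empty.\<close>

fun nat_bits :: "nat \<Rightarrow> bool list" where
  "nat_bits n = (if n = 0 then [] else odd n # nat_bits (n div 2))"

declare nat_bits.simps [simp del]

text \<open>Every list element is announced by \<open>True\<close>, and \<open>False\<close> marks the end of the list.\<close>

definition enc_list :: "('a \<Rightarrow> bool list) \<Rightarrow> 'a list \<Rightarrow> bool list" where
  "enc_list e xs = concat (map (\<lambda>x. True # e x) xs) @ [False]"

definition enc_nat :: "nat \<Rightarrow> bool list" where
  "enc_nat n = enc_list (\<lambda>b. [b]) (nat_bits n)"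

definition enc_int :: "int \<Rightarrow> bool list" where
  "enc_int k = (k < 0) # enc_nat (nat \<bar>k\<bar>)"

text \<open>Numerator and (positive) denominator in lowest terms.\<close>

definition enc_rat :: "rat \<Rightarrow> bool list" where
  "enc_rat r = enc_int (fst (quotient_of r)) @ enc_int (snd (quotient_of r))"

definition enc_vec :: "rat vec \<Rightarrow> bool list" where
  "enc_vec v = enc_list enc_rat (list_of_vec v)"


section \<open>The mixed integer trust region problem\<close>

text \<open>Indices are shifted: \<open>b ! 0, \<dots>, b ! (n - 1)\<close> stand for $b^1, \dots, b^n$.\<close>

definition mixed_integer_lattice :: "nat \<Rightarrow> nat \<Rightarrow> real vec list \<Rightarrow> real vec set" where
  "mixed_integer_lattice n p b =
     {finsum_vec TYPE(real) n (\<lambda>i. \<mu> i \<cdot>\<^sub>v b ! i) {0..<n} | \<mu> :: nat \<Rightarrow> real. \<forall>i<p. \<mu> i \<in> \<int>}"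

definition feasible_region :: "nat \<Rightarrow> nat \<Rightarrow> real vec list \<Rightarrow> real vec \<Rightarrow> real vec set" where
  "feasible_region n p b c =
     {x \<in> carrier_vec n. x \<bullet> x \<le> 1 \<and> x \<in> {y + c | y. y \<in> mixed_integer_lattice n p b}}"

text \<open>
  Linear independence of a family, given as a list. The library notion is about sets of vectors,
  so repetitions have to be excluded separately.
\<close>

definition lin_indep_family :: "nat \<Rightarrow> real vec list \<Rightarrow> bool" where
  "lin_indep_family n b \<longleftrightarrow> set b \<subseteq> carrier_vec n \<and> distinct b \<and>
     \<not> module.lin_dep class_ring (module_vec TYPE(real) n) (set b)"

text \<open>
  An input \<open>(p, b, c)\<close> consists of rational data; the dimension is that of \<open>c\<close>.
\<close>

type_synonym mitr_input = "nat \<times> rat vec list \<times> rat vec"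

abbreviation real_vec :: "rat vec \<Rightarrow> real vec" where
  "real_vec \<equiv> map_vec of_rat"

definition mitr_instances :: "mitr_input set" where
  "mitr_instances = {(p, b, c). length b = dim_vec c \<and> p \<le> dim_vec c \<and>
     lin_indep_family (dim_vec c) (map real_vec b)}"

definition mitr_nonempty :: "mitr_input set" where
  "mitr_nonempty =
     {(p, b, c). feasible_region (dim_vec c) p (map real_vec b) (real_vec c) \<noteq> {}}"

fun enc_mitr :: "mitr_input \<Rightarrow> bool list" where
  "enc_mitr (p, b, c) = enc_nat p @ enc_list enc_vec b @ enc_vec c"


subsection \<open>The encoding is injective\<close>

definition prefix_code :: "('a \<Rightarrow> bool list) \<Rightarrow> bool" where
  "prefix_code e \<longleftrightarrow> (\<forall>x y u v. e x @ u = e y @ v \<longrightarrow> x = y \<and> u = v)"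

lemma prefix_codeD: "prefix_code e \<Longrightarrow> e x @ u = e y @ v \<Longrightarrow> x = y \<and> u = v"
  unfolding prefix_code_def by blast

lemma prefix_code_list:
  assumes "prefix_code e"
  shows "prefix_code (enc_list e)"
proof -
  have "xs = ys \<and> u = v" if "enc_list e xs @ u = enc_list e ys @ v" for xs ys u v
    using that
  proof (induction xs arbitrary: ys)
    case Nil
    then show ?case by (cases ys) (auto simp: enc_list_def)
  next
    case (Cons x xs)
    then obtain y ys' where ys: "ys = y # ys'"
      by (cases ys) (auto simp: enc_list_def)
    with Cons.prems have "e x @ enc_list e xs @ u = e y @ enc_list e ys' @ v"
      by (simp add: enc_list_def)
    with prefix_codeD[OF assms] have "x = y" "enc_list e xs @ u = enc_list e ys' @ v"
      by blast+
    with Cons.IH ys show ?case by blast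
  qed
  then show ?thesis unfolding prefix_code_def by blast
qed

lemma prefix_code_comp: "prefix_code e \<Longrightarrow> inj f \<Longrightarrow> prefix_code (\<lambda>x. e (f x))"
  unfolding prefix_code_def inj_def by blast

lemma inj_nat_bits: "inj nat_bits"
proof (rule injI)
  show "m = n" if "nat_bits m = nat_bits n" for m n
    using that
  proof (induction m arbitrary: n rule: less_induct)
    case (less m)
    show ?case
    proof (cases "m = 0 \<or> n = 0")
      case True
      with less.prems show ?thesis
        by (auto simp: nat_bits.simps[of m] nat_bits.simps[of n] split: if_splits)
    next
      case False
      with less.prems have "odd m = odd n" "nat_bits (m div 2) = nat_bits (n div 2)"
        by (auto simp: nat_bits.simps[of m] nat_bits.simps[of n])
      with less.IH[of "m div 2" "n div 2"] False have "odd m = odd n" "m div 2 = n div 2"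
        by auto
      then show ?thesis by (metis bit_eq_rec)
    qed
  qed
qed

lemma prefix_code_nat: "prefix_code enc_nat"
proof -
  have "prefix_code (\<lambda>b. [b])" by (simp add: prefix_code_def)
  from prefix_code_comp[OF prefix_code_list[OF this] inj_nat_bits] show ?thesis
    by (simp add: enc_nat_def[abs_def])
qed

lemma prefix_code_int: "prefix_code enc_int"
  unfolding prefix_code_def
proof (intro allI impI)
  fix x y u v
  assume "enc_int x @ u = enc_int y @ v"
  then have "(x < 0) = (y < 0)" "enc_nat (nat \<bar>x\<bar>) @ u = enc_nat (nat \<bar>y\<bar>) @ v"
    by (auto simp: enc_int_def)
  with prefix_codeD[OF prefix_code_nat] show "x = y \<and> u = v"
    by (smt (verit) nat_0_le)
qed

lemma prefix_code_rat: "prefix_code enc_rat"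
  unfolding prefix_code_def
proof (intro allI impI)
  fix x y u v
  assume "enc_rat x @ u = enc_rat y @ v"
  then have "fst (quotient_of x) = fst (quotient_of y) \<and> snd (quotient_of x) = snd (quotient_of y)
      \<and> u = v"
    unfolding enc_rat_def append_assoc using prefix_codeD[OF prefix_code_int] by blast
  then show "x = y \<and> u = v"
    by (metis prod.expand quotient_of_inject)
qed

lemma prefix_code_vec: "prefix_code enc_vec"
proof -
  have "inj (list_of_vec :: rat vec \<Rightarrow> rat list)"
    by (metis injI vec_list)
  from prefix_code_comp[OF prefix_code_list[OF prefix_code_rat] this] show ?thesis
    by (simp add: enc_vec_def[abs_def])
qed

lemma inj_enc_mitr: "inj enc_mitr"
proof (rule injI)
  fix x y :: mitr_input
  assume eq: "enc_mitr x = enc_mitr y"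
  obtain p b c p' b' c' where x: "x = (p, b, c)" and y: "y = (p', b', c')"
    by (metis prod_cases3)
  from eq have "enc_nat p @ enc_list enc_vec b @ enc_vec c @ [] =
      enc_nat p' @ enc_list enc_vec b' @ enc_vec c' @ []"
    by (simp add: x y)
  then show "x = y"
    using prefix_codeD[OF prefix_code_nat] prefix_codeD[OF prefix_code_list[OF prefix_code_vec]]
      prefix_codeD[OF prefix_code_vec] by (metis x y)
qed

end

(*
  It suffices to treat p = n, which only restricts the instances.  The reduction starts directly
  from an arbitrary language in NP.  As in the Cook-Levin theorem, the runs of a nondeterministic
  machine (padded with idle steps in the accepting state) correspond to tilings of a T x W
  rectangle; its cells are numbered row by row, so that the neighbours of cell m are m + 1 and m + W.

  A tiling becomes a point of a full-rank lattice as follows.  Every cell has one integer variable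
  per tile and three constraints: exactly one tile is chosen, and the colours match horizontally
  and vertically.  A constraint is a linear equation modulo a large q, and the multiple of q is a
  further variable.  The coordinate of a tile variable z is (2 z - 1) / 2^e, which has least square
  1 / 4^e; each exponent e = 1, ..., L is used three times, so that these least squares add up to
  1 - 1 / 4^L.  Hence a lattice point lies in the unit ball iff all tile variables are 0 or 1 and
  all constraint coordinates, which are integers, vanish.  Up to sign, the entries of the instance
  are small integers and negative powers of two whose exponents are at most L, so that a machine
  with unary counters can write them down.
*)
theory Submission
  imports Defs
begin

section \<open>A while language for Turing machine tapes\<close>

text \<open>The weights have to be rational, so the squared radius 1 cannot simply be split evenly
  among any number of tile variables. The series \<open>3/4 + 3/16 + ...\<close> approaches 1 from
  below, hence the triples of exponents. Its gap \<open>1/4^L\<close> is smaller than every penalty: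
  a tile variable outside {0, 1} exceeds its least square by at least eight times that square, and a
  nonzero integer coordinate costs at least 1. As n independent vectors fill dimension n, every
  constraint coordinate needs a basis vector of its own; this is the role of the multiples of
  \<open>q\<close>, and \<open>q\<close> exceeds every absolute value that a constraint can take at
  0/1 points, so working modulo \<open>q\<close> loses nothing. No constraint expresses acceptance:
  runs of the original machine have fewer than T steps, so the padded machine has a run of exactly T
  steps iff some run accepts. T has the form \<open>(n + c)^d\<close>, since nested loops over unary
  rulers compute such powers with a fixed number of tapes. The transition is chosen once per row;
  the horizontal colours carry it to all cells.\<close>

datatype com =
    Skip
  | Mv nat move
  | Put nat nat
  | Seq com com (infixr ";;" 60)
  | Cond nat nat com com
  | Loop nat nat com

type_synonym store = "nat \<Rightarrow> tape"

abbreviation sym :: "store \<Rightarrow> nat \<Rightarrow> nat" where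
  "sym \<sigma> j \<equiv> head_symbol (\<sigma> j)"

text \<open>The bound \<open>V\<close> limits the iterations in each single execution of a loop. It
  makes the running time a function of the program text and \<open>V\<close> alone, see
  \<open>cost\<close>. It belongs to the analysis only; the compiled machine does not know
  it.\<close>

primrec exec :: "nat \<Rightarrow> com \<Rightarrow> store \<Rightarrow> store \<Rightarrow> bool" where
  "exec V Skip \<sigma> \<sigma>' \<longleftrightarrow> \<sigma>' = \<sigma>"
| "exec V (Mv j d) \<sigma> \<sigma>' \<longleftrightarrow> \<sigma>' = \<sigma>(j := (fst (\<sigma> j) + move_offset d, snd (\<sigma> j)))"
| "exec V (Put j s) \<sigma> \<sigma>' \<longleftrightarrow> \<sigma>' = \<sigma>(j := (fst (\<sigma> j), (snd (\<sigma> j))(fst (\<sigma> j) := s)))"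
| "exec V (Seq c1 c2) \<sigma> \<sigma>' \<longleftrightarrow> (\<exists>\<sigma>1. exec V c1 \<sigma> \<sigma>1 \<and> exec V c2 \<sigma>1 \<sigma>')"
| "exec V (Cond j s c1 c2) \<sigma> \<sigma>' \<longleftrightarrow> (if sym \<sigma> j = s then exec V c1 \<sigma> \<sigma>' else exec V c2 \<sigma> \<sigma>')"
| "exec V (Loop j s c) \<sigma> \<sigma>' \<longleftrightarrow>
     (\<exists>r f. r \<le> V \<and> f 0 = \<sigma> \<and> f r = \<sigma>' \<and> sym \<sigma>' j = s \<and>
        (\<forall>i<r. sym (f i) j \<noteq> s \<and> exec V c (f i) (f (Suc i))))"

primrec com_ok :: "nat \<Rightarrow> nat \<Rightarrow> com \<Rightarrow> bool" where
  "com_ok k A Skip \<longleftrightarrow> True"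
| "com_ok k A (Mv j d) \<longleftrightarrow> j < k"
| "com_ok k A (Put j s) \<longleftrightarrow> j < k \<and> s < A"
| "com_ok k A (Seq c1 c2) \<longleftrightarrow> com_ok k A c1 \<and> com_ok k A c2"
| "com_ok k A (Cond j s c1 c2) \<longleftrightarrow> j < k \<and> com_ok k A c1 \<and> com_ok k A c2"
| "com_ok k A (Loop j s c) \<longleftrightarrow> j < k \<and> com_ok k A c"

text \<open>The number of states; the number itself serves as exit state. The two extra states of
  \<open>Cond\<close> are the test and the jump past the second branch, those of \<open>Loop\<close>
  the test and the jump back.\<close>

primrec com_size :: "com \<Rightarrow> nat" where
  "com_size Skip = 0"
| "com_size (Mv j d) = 1"
| "com_size (Put j s) = 1"
| "com_size (Seq c1 c2) = com_size c1 + com_size c2"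
| "com_size (Cond j s c1 c2) = com_size c1 + com_size c2 + 2"
| "com_size (Loop j s c) = com_size c + 2"

section \<open>Compilation of programs into numbered instructions\<close>

type_synonym instr = "nat \<times> nat \<times> nat \<times> move"

text \<open>In state \<open>q\<close>, reading \<open>rd j\<close> on tape \<open>j\<close>, an instruction gives the new state, the only tape
  that is acted on, and the action.\<close>

primrec instr :: "com \<Rightarrow> nat \<Rightarrow> (nat \<Rightarrow> nat) \<Rightarrow> instr" where
  "instr Skip q rd = (0, 0, rd 0, Stay)"
| "instr (Mv j d) q rd = (1, j, rd j, d)"
| "instr (Put j s) q rd = (1, j, s, Stay)"
| "instr (Seq c1 c2) q rd =
     (if q < com_size c1 then instr c1 q rd
      else apfst ((+) (com_size c1)) (instr c2 (q - com_size c1) rd))"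
| "instr (Cond j s c1 c2) q rd =
     (if q = 0 then (if rd j = s then 1 else com_size c1 + 2, 0, rd 0, Stay)
      else if q \<le> com_size c1 then apfst Suc (instr c1 (q - 1) rd)
      else if q = Suc (com_size c1) then (com_size c1 + com_size c2 + 2, 0, rd 0, Stay)
      else apfst ((+) (com_size c1 + 2)) (instr c2 (q - (com_size c1 + 2)) rd))"
| "instr (Loop j s c) q rd =
     (if q = 0 then (if rd j = s then com_size c + 2 else 1, 0, rd 0, Stay)
      else if q \<le> com_size c then apfst Suc (instr c (q - 1) rd)
      else (0, 0, rd 0, Stay))"

definition instr_step :: "com \<Rightarrow> nat \<times> store \<Rightarrow> nat \<times> store \<Rightarrow> bool" where
  "instr_step c C C' \<longleftrightarrow> fst C < com_size c \<and>
     (case instr c (fst C) (sym (snd C)) of (q', j, s, d) \<Rightarrow>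
        C' = (q', (snd C)(j := tape_action (s, d) (snd C j))))"

lemma relpowp_map:
  assumes "\<And>x y. R x y \<Longrightarrow> S (h x) (h y)" "(R ^^ t) x y"
  shows "(S ^^ t) (h x) (h y)"
  using assms(2) by (induction t arbitrary: y) (auto intro: assms(1))

lemma relpowp_trans: "(R ^^ s) x y \<Longrightarrow> (R ^^ t) y z \<Longrightarrow> (R ^^ (s + t)) x z"
  by (auto simp: relpowp_add)

lemma relpowp_1I: "(R :: 'a \<Rightarrow> 'a \<Rightarrow> bool) x y \<Longrightarrow> (R ^^ 1) x y"
  by auto

lemma tape_action_same: "tape_action (head_symbol T, d) T = (fst T + move_offset d, snd T)"
  by (cases T) auto

lemma store_upd_Stay: "\<sigma>(j := tape_action (sym \<sigma> j, Stay) (\<sigma> j)) = \<sigma>"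
  by (auto simp: tape_action_same)

text \<open>The states of a part reappear in the compound program shifted by a constant. This lemma
  and the next four supply the maps with which \<open>relpowp_map\<close> transports whole runs of a
  part.\<close>

lemma instr_step_Seq1: "instr_step c1 C C' \<Longrightarrow> instr_step (Seq c1 c2) C C'"
  by (auto simp: instr_step_def split: prod.splits)

lemma instr_step_Seq2:
  "instr_step c2 C C' \<Longrightarrow> instr_step (Seq c1 c2) (apfst ((+) (com_size c1)) C) (apfst ((+)
      (com_size c1)) C')"
  by (cases C; cases C') (auto simp: instr_step_def split: prod.splits)

lemma instr_step_Cond1:
  "instr_step c1 C C' \<Longrightarrow> instr_step (Cond j s c1 c2) (apfst Suc C) (apfst Suc C')"
  by (cases C; cases C') (auto simp: instr_step_def split: prod.splits)

lemma instr_step_Cond2: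
  "instr_step c2 C C' \<Longrightarrow> instr_step (Cond j s c1 c2) (apfst ((+) (com_size c1 + 2)) C) (apfst ((+)
      (com_size c1 + 2)) C')"
  by (cases C; cases C') (auto simp: instr_step_def split: prod.splits)

lemma instr_step_Loop:
  "instr_step c C C' \<Longrightarrow> instr_step (Loop j s c) (apfst Suc C) (apfst Suc C')"
  by (cases C; cases C') (auto simp: instr_step_def split: prod.splits)

primrec cost :: "com \<Rightarrow> nat \<Rightarrow> nat" where
  "cost Skip V = 0"
| "cost (Mv j d) V = 1"
| "cost (Put j s) V = 1"
| "cost (Seq c1 c2) V = cost c1 V + cost c2 V"
| "cost (Cond j s c1 c2) V = cost c1 V + cost c2 V + 2"
| "cost (Loop j s c) V = V * (cost c V + 2) + 1"

lemma exec_imp_steps: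
  "exec V c \<sigma> \<sigma>' \<Longrightarrow> \<exists>t\<le>cost c V. (instr_step c ^^ t) (0, \<sigma>) (com_size c, \<sigma>')"
proof (induction c arbitrary: \<sigma> \<sigma>')
  case Skip
  then show ?case by (intro exI[of _ 0]) auto
next
  case (Mv j d)
  have "instr_step (Mv j d) (0, \<sigma>) (1, \<sigma>')"
    using Mv by (simp add: instr_step_def tape_action_same)
  then show ?case by (intro exI[of _ 1]) (auto intro: relpowp_1I simp del: One_nat_def)
next
  case (Put j s)
  have "instr_step (Put j s) (0, \<sigma>) (1, \<sigma>')"
    using Put by (cases "\<sigma> j") (simp add: instr_step_def)
  then show ?case by (intro exI[of _ 1]) (auto intro: relpowp_1I simp del: One_nat_def)
next
  case (Seq c1 c2)
  then obtain \<sigma>1 where "exec V c1 \<sigma> \<sigma>1" "exec V c2 \<sigma>1 \<sigma>'" by auto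
  with Seq.IH obtain t1 t2 where t: "t1 \<le> cost c1 V" "t2 \<le> cost c2 V"
    and s1: "(instr_step c1 ^^ t1) (0, \<sigma>) (com_size c1, \<sigma>1)"
    and s2: "(instr_step c2 ^^ t2) (0, \<sigma>1) (com_size c2, \<sigma>')" by metis
  have "(instr_step (Seq c1 c2) ^^ t1) (0, \<sigma>) (com_size c1, \<sigma>1)"
    using relpowp_map[where h = "\<lambda>x. x", OF instr_step_Seq1 s1] by simp
  moreover have "(instr_step (Seq c1 c2) ^^ t2) (com_size c1, \<sigma>1) (com_size (Seq c1 c2), \<sigma>')"
    using relpowp_map[of "instr_step c2" "instr_step (Seq c1 c2)" "apfst ((+) (com_size c1))",
        OF instr_step_Seq2 s2] by simp
  ultimately have "(instr_step (Seq c1 c2) ^^ (t1 + t2)) (0, \<sigma>) (com_size (Seq c1 c2), \<sigma>')"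
    by (rule relpowp_trans)
  then show ?case using t by (intro exI[of _ "t1 + t2"]) simp
next
  case (Cond j s c1 c2)
  let ?c = "Cond j s c1 c2"
  show ?case
  proof (cases "sym \<sigma> j = s")
    case True
    with Cond.prems have "exec V c1 \<sigma> \<sigma>'" by simp
    with Cond.IH obtain t where t: "t \<le> cost c1 V"
      and s: "(instr_step c1 ^^ t) (0, \<sigma>) (com_size c1, \<sigma>')" by metis
    have 1: "(instr_step ?c ^^ 1) (0, \<sigma>) (1, \<sigma>)"
      using True by (intro relpowp_1I) (simp add: instr_step_def store_upd_Stay)
    have 2: "(instr_step ?c ^^ t) (1, \<sigma>) (Suc (com_size c1), \<sigma>')"
      using relpowp_map[of "instr_step c1" "instr_step ?c" "apfst Suc", OF instr_step_Cond1 s]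
          by simp
    have 3: "(instr_step ?c ^^ 1) (Suc (com_size c1), \<sigma>') (com_size ?c, \<sigma>')"
      by (intro relpowp_1I) (simp add: instr_step_def store_upd_Stay)
    show ?thesis using relpowp_trans[OF relpowp_trans[OF 1 2] 3] t
      by (intro exI[of _ "1 + t + 1"]) simp
  next
    case False
    with Cond.prems have "exec V c2 \<sigma> \<sigma>'" by simp
    with Cond.IH obtain t where t: "t \<le> cost c2 V"
      and s: "(instr_step c2 ^^ t) (0, \<sigma>) (com_size c2, \<sigma>')" by metis
    have 1: "(instr_step ?c ^^ 1) (0, \<sigma>) (com_size c1 + 2, \<sigma>)"
      using False by (intro relpowp_1I) (simp add: instr_step_def store_upd_Stay)
    have 2: "(instr_step ?c ^^ t) (com_size c1 + 2, \<sigma>) (com_size ?c, \<sigma>')"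
      using relpowp_map[of "instr_step c2" "instr_step ?c" "apfst ((+) (com_size c1 + 2))",
          OF instr_step_Cond2 s] by (simp add: ac_simps)
    show ?thesis using relpowp_trans[OF 1 2] t
      by (intro exI[of _ "1 + t"]) simp
  qed
next
  case (Loop j s c)
  let ?c = "Loop j s c"
  from Loop.prems obtain r f where r: "r \<le> V" "f 0 = \<sigma>" "f r = \<sigma>'" "sym \<sigma>' j = s"
    and f: "\<And>i. i < r \<Longrightarrow> sym (f i) j \<noteq> s \<and> exec V c (f i) (f (Suc i))" by auto
  \<comment> \<open>One round costs the body, the test and the jump back; afterwards control is at
    the test again.\<close>
  have "\<exists>t \<le> i * (cost c V + 2). (instr_step ?c ^^ t) (0, \<sigma>) (0, f i)" if "i \<le> r" for i
    using that
  proof (induction i)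
    case 0
    then show ?case using r by auto
  next
    case (Suc i)
    then obtain t where t: "t \<le> i * (cost c V + 2)"
      and s: "(instr_step ?c ^^ t) (0, \<sigma>) (0, f i)" by auto
    from f[of i] Suc.prems Loop.IH obtain t' where t': "t' \<le> cost c V"
      and s': "(instr_step c ^^ t') (0, f i) (com_size c, f (Suc i))" by (metis Suc_le_lessD)
    have 1: "(instr_step ?c ^^ 1) (0, f i) (1, f i)"
      using f[of i] Suc.prems by (intro relpowp_1I) (simp add: instr_step_def store_upd_Stay)
    have 2: "(instr_step ?c ^^ t') (1, f i) (Suc (com_size c), f (Suc i))"
      using relpowp_map[of "instr_step c" "instr_step ?c" "apfst Suc", OF instr_step_Loop s']
          by simp
    have 3: "(instr_step ?c ^^ 1) (Suc (com_size c), f (Suc i)) (0, f (Suc i))"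
      by (intro relpowp_1I) (simp add: instr_step_def store_upd_Stay)
    show ?case using relpowp_trans[OF s relpowp_trans[OF relpowp_trans[OF 1 2] 3]] t t'
      by (intro exI[of _ "t + (1 + t' + 1)"]) simp
  qed
  from this[of r] r obtain t where t: "t \<le> r * (cost c V + 2)"
    and s: "(instr_step ?c ^^ t) (0, \<sigma>) (0, \<sigma>')" by auto
  have 1: "(instr_step ?c ^^ 1) (0, \<sigma>') (com_size ?c, \<sigma>')"
    using r by (intro relpowp_1I) (simp add: instr_step_def store_upd_Stay)
  have "t \<le> V * (cost c V + 2)" using t r(1) by (meson le_trans mult_le_mono1)
  then show ?case using relpowp_trans[OF s 1] by (intro exI[of _ "t + 1"]) simp
qed

lemma cost_poly: "\<exists>b. \<forall>V. cost c V = poly b V"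
proof (induction c)
  case Skip
  show ?case by (intro exI[of _ 0]) simp
next
  case (Mv j d)
  show ?case by (intro exI[of _ "[:1:]"]) simp
next
  case (Put j s)
  show ?case by (intro exI[of _ "[:1:]"]) simp
next
  case (Seq c1 c2)
  then obtain b1 b2 where "\<forall>V. cost c1 V = poly b1 V" "\<forall>V. cost c2 V = poly b2 V" by blast
  then show ?case by (intro exI[of _ "b1 + b2"]) simp
next
  case (Cond j s c1 c2)
  then obtain b1 b2 where "\<forall>V. cost c1 V = poly b1 V" "\<forall>V. cost c2 V = poly b2 V" by blast
  then show ?case by (intro exI[of _ "b1 + b2 + [:2:]"]) simp
next
  case (Loop j s c)
  then obtain b where "\<forall>V. cost c V = poly b V" by blast
  then show ?case by (intro exI[of _ "[:0, 1:] * (b + [:2:]) + [:1:]"]) simp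
qed

section \<open>From instructions to a deterministic Turing machine\<close>

lemma instr_tape:
  "com_ok k A c \<Longrightarrow> q < com_size c \<Longrightarrow> (\<And>j. j < k \<Longrightarrow> rd j < A) \<Longrightarrow> instr c q rd = (q', j, s, d) \<Longrightarrow>
     j < k \<and> s < A \<and> q' \<le> com_size c"
proof (induction c arbitrary: q q')
  case (Seq c1 c2)
  show ?case
  proof (cases "q < com_size c1")
    case True
    then show ?thesis using Seq.IH(1)[of q q'] Seq.prems by auto
  next
    case False
    then show ?thesis using Seq.IH(2)[of "q - com_size c1"] Seq.prems
      by (cases "instr c2 (q - com_size c1) rd") auto
  qed
next
  case (Cond j0 s0 c1 c2)
  consider "q = 0" | "0 < q" "q \<le> com_size c1" | "q = Suc (com_size c1)" | "q > Suc (com_size c1)"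
    by linarith
  then show ?case
  proof cases
    case 2
    then show ?thesis using Cond.IH(1)[of "q - 1"] Cond.prems
      by (cases "instr c1 (q - 1) rd") fastforce
  next
    case 4
    then show ?thesis using Cond.IH(2)[of "q - (com_size c1 + 2)"] Cond.prems
      by (cases "instr c2 (q - (com_size c1 + 2)) rd") auto
  qed (use Cond.prems in \<open>auto split: if_splits\<close>)
next
  case (Loop j0 s0 c)
  consider "q = 0" | "0 < q" "q \<le> com_size c" | "q > com_size c"
    by linarith
  then show ?case
  proof cases
    case 2
    then show ?thesis using Loop.IH(1)[of "q - 1"] Loop.prems
      by (cases "instr c (q - 1) rd") fastforce
  qed (use Loop.prems in \<open>auto split: if_splits\<close>)
qed auto

text \<open>An instruction touches one tape, a transition all of them: the other tapes write back
  what they read and stay. Only symbols below \<open>A\<close> are read, which keeps the set of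
  transitions finite.\<close>

definition tm_of :: "nat \<Rightarrow> nat \<Rightarrow> com \<Rightarrow> tm" where
  "tm_of k A c = \<lparr>num_tapes = k, start_state = 0, accept_state = com_size c,
     transitions = {(q, rs, q', as). q < com_size c \<and> set rs \<subseteq> {..<A} \<and> length rs = k \<and>
       (\<exists>j s d. instr c q ((!) rs) = (q', j, s, d) \<and>
          as = map (\<lambda>i. if i = j then (s, d) else (rs ! i, Stay)) [0..<k])}\<rparr>"

lemma mem_transitions_tm_of:
  "(q, rs, q', as) \<in> transitions (tm_of k A c) \<longleftrightarrow>
     q < com_size c \<and> set rs \<subseteq> {..<A} \<and> length rs = k \<and>
     (\<exists>j s d. instr c q ((!) rs) = (q', j, s, d) \<and>
        as = map (\<lambda>i. if i = j then (s, d) else (rs ! i, Stay)) [0..<k])"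
  by (simp add: tm_of_def)

lemma finite_transitions_tm_of: "finite (transitions (tm_of k A c))"
proof (rule finite_subset)
  let ?F = "\<lambda>(q, rs). case instr c q ((!) rs) of (q', j, s, d) \<Rightarrow>
          (q, rs, q', map (\<lambda>i. if i = j then (s, d) else (rs ! i, Stay)) [0..<k])"
  let ?D = "{..<com_size c} \<times> {rs. set rs \<subseteq> {..<A} \<and> length rs = k}"
  show "transitions (tm_of k A c) \<subseteq> ?F ` ?D"
  proof
    fix x assume x: "x \<in> transitions (tm_of k A c)"
    obtain q rs q' as where [simp]: "x = (q, rs, q', as)" by (metis prod_cases4)
    show "x \<in> ?F ` ?D"
      using x by (intro image_eqI[of _ _ "(q, rs)"]) (auto simp: mem_transitions_tm_of)
  qed
  show "finite (?F ` ?D)" by (simp add: finite_lists_length_eq)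
qed

lemma wf_tm_of: "k \<ge> 1 \<Longrightarrow> wf_tm (tm_of k A c)"
  unfolding wf_tm_def
  by (auto simp: finite_transitions_tm_of mem_transitions_tm_of) (simp_all add: tm_of_def)

lemma deterministic_tm_of: "deterministic (tm_of k A c)"
  unfolding deterministic_def by (auto simp: mem_transitions_tm_of)

text \<open>Bridges \<open>(!) rs\<close>, which is determined only below \<open>k\<close>, and the
  symbols under the heads of a store with infinitely many tapes.\<close>

lemma instr_cong:
  "com_ok k A c \<Longrightarrow> 0 < k \<Longrightarrow> (\<And>j. j < k \<Longrightarrow> rd j = rd' j) \<Longrightarrow> q < com_size c \<Longrightarrow> instr c q rd =
      instr c q rd'"
proof (induction c arbitrary: q)
qed auto

definition store_ok :: "nat \<Rightarrow> nat \<Rightarrow> store \<Rightarrow> bool" where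
  "store_ok k A \<sigma> \<longleftrightarrow> (\<forall>j<k. \<forall>i. snd (\<sigma> j) i < A)"

lemma head_symbol_snd: "head_symbol T = snd T (fst T)"
  by (cases T) auto

lemma instr_step_imp_tm_step:
  assumes ok: "com_ok k A c" "0 < k" "store_ok k A (snd C)" and st: "instr_step c C C'"
  shows "tm_step (tm_of k A c) (fst C, map (snd C) [0..<k]) (fst C', map (snd C') [0..<k])
      \<and> store_ok k A (snd C')"
proof -
  obtain q \<sigma> where C: "C = (q, \<sigma>)" by (cases C)
  obtain q' j s d where i: "instr c q (sym \<sigma>) = (q', j, s, d)" by (metis prod_cases4)
  have q: "q < com_size c" and C': "C' = (q', \<sigma>(j := tape_action (s, d) (\<sigma> j)))"
    using st i by (auto simp: instr_step_def C)
  have sy: "sym \<sigma> j < A" if "j < k" for j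
    using ok(3) that by (auto simp: store_ok_def C head_symbol_snd)
  have j: "j < k" "s < A" using instr_tape[OF ok(1) q sy i] by auto
  let ?rs = "map head_symbol (map \<sigma> [0..<k])"
  let ?as = "map (\<lambda>i. if i = j then (s, d) else (?rs ! i, Stay)) [0..<k]"
  have "instr c q ((!) ?rs) = (q', j, s, d)"
    using instr_cong[OF ok(1,2) _ q, of "(!) ?rs" "sym \<sigma>"] i by simp
  then have "(q, ?rs, q', ?as) \<in> transitions (tm_of k A c)"
    unfolding mem_transitions_tm_of using q sy by auto
  then have "tm_step (tm_of k A c) (q, map \<sigma> [0..<k]) (q', map2 tape_action ?as (map \<sigma> [0..<k]))"
    by (rule tm_step.intros)
  moreover have "map2 tape_action ?as (map \<sigma> [0..<k]) = map (snd C') [0..<k]"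
    by (rule nth_equalityI) (auto simp: C' tape_action_same)
  moreover have "store_ok k A (snd C')"
    using ok(3) j by (cases "\<sigma> j") (auto simp: store_ok_def C C')
  ultimately show ?thesis by (simp add: C C')
qed

lemma instr_steps_imp_tm_steps:
  assumes ok: "com_ok k A c" "0 < k" "store_ok k A (snd C)" and st: "(instr_step c ^^ t) C C'"
  shows "(tm_step (tm_of k A c) ^^ t) (fst C, map (snd C) [0..<k]) (fst C', map (snd C') [0..<k])
      \<and> store_ok k A (snd C')"
  using st
proof (induction t arbitrary: C')
  case 0
  then show ?case using ok by auto
next
  case (Suc t)
  then obtain D where "(instr_step c ^^ t) C D" "instr_step c D C'" by auto
  with Suc.IH[of D] instr_step_imp_tm_step[OF ok(1,2), of D C'] show ?case by auto
qed

definition blank_tape :: tape where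
  "blank_tape = (0, \<lambda>_. 0)"

definition init_store :: "bool list \<Rightarrow> store" where
  "init_store w = (\<lambda>_. blank_tape)(0 := (0, word_cells w))"

text \<open>One program serves all inputs, while the loop bound \<open>poly v (length w)\<close>
  grows with the input; composing it with the polynomial for \<open>cost\<close> bounds the time.
  \<open>3 \<le> A\<close> covers the blank and the input symbols.\<close>

theorem polytime_computable_exec:
  assumes ok: "com_ok k A c" "0 < k" "3 \<le> A"
    and ex: "\<And>w. \<exists>\<sigma>'. exec (poly v (length w)) c (init_store w) \<sigma>' \<and> snd (\<sigma>' (k - 1)) =
        word_cells (f w)"
  shows "polytime_computable f"
proof -
  obtain b where b: "\<And>V. cost c V = poly b V" using cost_poly by blast
  let ?M = "tm_of k A c"
  have "\<exists>t C. t \<le> poly (pcompose b v) (length w) \<and> (tm_step ?M ^^ t) (init_config ?M w) C \<and>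
      halted ?M C \<and> snd (last (snd C)) = word_cells (f w)" for w
  proof -
    obtain \<sigma>' where e: "exec (poly v (length w)) c (init_store w) \<sigma>'"
      and out: "snd (\<sigma>' (k - 1)) = word_cells (f w)" using ex by blast
    from exec_imp_steps[OF e] obtain t where t: "t \<le> cost c (poly v (length w))"
      and st: "(instr_step c ^^ t) (0, init_store w) (com_size c, \<sigma>')" by blast
    have "store_ok k A (snd (0::nat, init_store w))"
      using ok(3) by (auto simp: store_ok_def init_store_def blank_tape_def word_cells_def)
    from instr_steps_imp_tm_steps[OF ok(1,2) this st]
    have "(tm_step ?M ^^ t) (0, map (init_store w) [0..<k]) (com_size c, map \<sigma>' [0..<k])" by simp
    moreover have "(0, map (init_store w) [0..<k]) = init_config ?M w"
    proof -
      obtain k' where k: "k = Suc k'" using ok(2) by (cases k) auto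
      have "map (init_store w) [Suc 0..<Suc k'] = replicate k' (0, word_cells [])"
        by (rule nth_equalityI) (auto simp del: upt_Suc simp: init_store_def blank_tape_def
            word_cells_def fun_eq_iff)
      then show ?thesis
        by (simp add: init_config_def tm_of_def k upt_conv_Cons init_store_def del: upt_Suc)
    qed
    moreover have "halted ?M (com_size c, map \<sigma>' [0..<k])"
      unfolding halted_def by (auto simp: mem_transitions_tm_of elim!: tm_step.cases)
    moreover have "last (map \<sigma>' [0..<k]) = \<sigma>' (k - 1)"
      using ok(2) by (simp add: last_map)
    ultimately show ?thesis using t out b
      by (intro exI[of _ t] exI[of _ "(com_size c, map \<sigma>' [0..<k])"]) (auto simp: poly_pcompose)
  qed
  then show ?thesis
    unfolding polytime_computable_def using wf_tm_of[of k A c] deterministic_tm_of ok(2)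
    by (metis One_nat_def Suc_leI)
qed

section \<open>A calculus for programs with unary counters and an output tape\<close>

definition iters :: "nat \<Rightarrow> nat \<Rightarrow> nat \<Rightarrow> com \<Rightarrow> nat \<Rightarrow> store \<Rightarrow> store \<Rightarrow> bool" where
  "iters V j s c r \<sigma> \<sigma>' \<longleftrightarrow>
     (\<exists>f. f 0 = \<sigma> \<and> f r = \<sigma>' \<and> (\<forall>i<r. sym (f i) j \<noteq> s \<and> exec V c (f i) (f (Suc i))))"

lemma exec_LoopI: "iters V j s c r \<sigma> \<sigma>' \<Longrightarrow> r \<le> V \<Longrightarrow> sym \<sigma>' j = s \<Longrightarrow> exec V (Loop j s c) \<sigma> \<sigma>'"
  by (auto simp: iters_def)

lemma iters_0: "iters V j s c 0 \<sigma> \<sigma>"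
  by (auto simp: iters_def)

lemma iters_Suc:
  assumes "sym \<sigma> j \<noteq> s" "exec V c \<sigma> \<sigma>1" "iters V j s c r \<sigma>1 \<sigma>'"
  shows "iters V j s c (Suc r) \<sigma> \<sigma>'"
proof -
  obtain f where "f 0 = \<sigma>1" "f r = \<sigma>'" "\<forall>i<r. sym (f i) j \<noteq> s \<and> exec V c (f i) (f (Suc i))"
    using assms(3) by (auto simp: iters_def)
  then show ?thesis
    unfolding iters_def using assms(1,2)
    by (intro exI[of _ "case_nat \<sigma> f"]) (auto split: nat.split)
qed

definition out_tape :: "bool list \<Rightarrow> tape" where
  "out_tape xs = (int (length xs), word_cells xs)"

text \<open>Numbers are kept in unary. A ruler marks both ends and bounds a loop, with the head as
  loop index. A \<open>counter\<close> marks only the origin and its value is the head position, so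
  it has no upper limit.\<close>

definition ruler :: "nat \<Rightarrow> int \<Rightarrow> tape" where
  "ruler L p = (p, \<lambda>i. if i = 0 then 1 else if i = int L then 2 else 0)"

definition counter :: "int \<Rightarrow> tape" where
  "counter p = (p, \<lambda>i. if i = 0 then 1 else 0)"

lemma head_symbol_ruler: "head_symbol (ruler L p) = (if p = 0 then 1 else if p =
    int L then 2 else 0)"
  by (simp add: ruler_def)

lemma head_symbol_counter: "head_symbol (counter p) = (if p = 0 then 1 else 0)"
  by (simp add: counter_def)

lemma word_cells_snoc: "(word_cells xs)(int (length xs) := (if b then 2 else 1)) =
    word_cells (xs @ [b])"
  by (auto simp: word_cells_def fun_eq_iff nth_append)

text \<open>The second loop rewinds the ruler, so that it can be used again. During the body the
  head on tape \<open>x\<close> shows the loop index.\<close>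

definition For :: "nat \<Rightarrow> com \<Rightarrow> com" where
  "For x c = Loop x 2 (c ;; Mv x Move_Right) ;; Loop x 1 (Mv x Move_Left)"

definition seqs :: "com list \<Rightarrow> com" where
  "seqs cs = foldr Seq cs Skip"

locale program =
  fixes V out :: nat
begin

text \<open>A Hoare triple that is indifferent to the output written so far: tape \<open>out\<close>
  of both stores is overwritten, so that they describe the working tapes only, and the outputs of
  consecutive programs are concatenated.\<close>

definition tr :: "com \<Rightarrow> store \<Rightarrow> store \<Rightarrow> bool list \<Rightarrow> bool" where
  "tr c \<sigma> \<sigma>' ys \<longleftrightarrow> (\<forall>xs. exec V c (\<sigma>(out := out_tape xs)) (\<sigma>'(out := out_tape (xs @ ys))))"

lemma trD: "tr c \<sigma> \<sigma>' ys \<Longrightarrow> \<sigma>1 = \<sigma>' \<Longrightarrow> tr c \<sigma> \<sigma>1 ys"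
  by simp

lemma tr_Skip: "tr Skip \<sigma> \<sigma> []"
  by (simp add: tr_def)

lemma tr_Mv: "j \<noteq> out \<Longrightarrow> tr (Mv j d) \<sigma> (\<sigma>(j := (fst (\<sigma> j) + move_offset d, snd (\<sigma> j)))) []"
  by (auto simp: tr_def)

lemma tr_Put: "j \<noteq> out \<Longrightarrow> tr (Put j s) \<sigma> (\<sigma>(j := (fst (\<sigma> j), (snd (\<sigma> j))(fst (\<sigma> j) := s)))) []"
  by (auto simp: tr_def)

lemma tr_Seq: "tr c1 \<sigma> \<sigma>1 ys \<Longrightarrow> tr c2 \<sigma>1 \<sigma>2 zs \<Longrightarrow> tr (c1 ;; c2) \<sigma> \<sigma>2 (ys @ zs)"
  by (auto simp: tr_def simp flip: append_assoc)

lemma tr_Seq_silent: "tr c1 \<sigma> \<sigma>1 [] \<Longrightarrow> tr c2 \<sigma>1 \<sigma>2 zs \<Longrightarrow> tr (c1 ;; c2) \<sigma> \<sigma>2 zs"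
  using tr_Seq[of c1 \<sigma> \<sigma>1 "[]"] by simp

lemma tr_Cond:
  "j \<noteq> out \<Longrightarrow> tr (if sym \<sigma> j = s then c1 else c2) \<sigma> \<sigma>' ys \<Longrightarrow> tr (Cond j s c1 c2) \<sigma> \<sigma>' ys"
  by (auto simp: tr_def split: if_splits)

lemma tr_seqs:
  assumes "\<And>i. i < length cs \<Longrightarrow> tr (cs ! i) (\<sigma> i) (\<sigma> (Suc i)) (ys i)"
  shows "tr (seqs cs) (\<sigma> 0) (\<sigma> (length cs)) (concat (map ys [0..<length cs]))"
  using assms
proof (induction cs arbitrary: \<sigma> ys)
  case (Cons c cs)
  have "tr (seqs cs) (\<sigma> (Suc 0)) (\<sigma> (Suc (length cs))) (concat (map (\<lambda>i. ys (Suc i))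
      [0..<length cs]))"
    using Cons.IH[of "\<lambda>i. \<sigma> (Suc i)" "\<lambda>i. ys (Suc i)"] Cons.prems by fastforce
  moreover have "tr c (\<sigma> 0) (\<sigma> (Suc 0)) (ys 0)" using Cons.prems[of 0] by simp
  moreover have "map ys [0..<Suc (length cs)] = ys 0 # map (\<lambda>i. ys (Suc i)) [0..<length cs]"
    by (simp only: upt_conv_Cons[OF zero_less_Suc] list.map map_Suc_upt[symmetric] map_map o_def)
  ultimately show ?case
    using tr_Seq[of c "\<sigma> 0" "\<sigma> (Suc 0)" "ys 0"] by (simp add: seqs_def del: upt_Suc)
qed (simp add: seqs_def tr_Skip)

lemma tr_Loop:
  assumes "\<And>i. i < r \<Longrightarrow> sym (\<sigma> i) j \<noteq> s" "\<And>i. i < r \<Longrightarrow> tr c (\<sigma> i) (\<sigma> (Suc i)) (ys i)"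
    and "sym (\<sigma> r) j = s" "r \<le> V" "j \<noteq> out"
  shows "tr (Loop j s c) (\<sigma> 0) (\<sigma> r) (concat (map ys [0..<r]))"
  unfolding tr_def
proof
  fix xs
  \<comment> \<open>Here \<open>n\<close> counts the iterations still to come, because
    \<open>iters_Suc\<close> adds an iteration in front.\<close>
  have "iters V j s c n ((\<sigma> (r - n))(out := out_tape (xs @ concat (map ys [0..<r - n]))))
      ((\<sigma> r)(out := out_tape (xs @ concat (map ys [0..<r]))))" if "n \<le> r" for n
    using that
  proof (induction n)
    case (Suc n)
    then have r: "r - n = Suc (r - Suc n)" by simp
    have e: "exec V c ((\<sigma> (r - Suc n))(out := out_tape (xs @ concat (map ys [0..<r - Suc n]))))
      ((\<sigma> (r - n))(out := out_tape (xs @ concat (map ys [0..<r - n]))))"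
      using assms(2)[of "r - Suc n"] Suc.prems unfolding tr_def r by (simp flip: append_assoc)
    have it: "iters V j s c n ((\<sigma> (r - n))(out := out_tape (xs @ concat (map ys [0..<r - n]))))
      ((\<sigma> r)(out := out_tape (xs @ concat (map ys [0..<r]))))"
      by (rule Suc.IH) (use Suc.prems in simp)
    show ?case using assms(1)[of "r - Suc n"] assms(5) Suc.prems
      by (intro iters_Suc[OF _ e it]) auto
  qed (simp add: iters_0)
  from this[of r] show "exec V (Loop j s c) ((\<sigma> 0)(out := out_tape xs))
      ((\<sigma> r)(out := out_tape (xs @ concat (map ys [0..<r]))))"
    using assms(3,4,5) by (intro exec_LoopI[of _ _ _ _ r]) auto
qed

lemma concat_map_Nil: "concat (map (\<lambda>_. []) xs) = []"
  by (induction xs) auto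

lemma tr_Loop_silent:
  assumes "\<And>i. i < r \<Longrightarrow> sym (\<sigma> i) j \<noteq> s" "\<And>i. i < r \<Longrightarrow> tr c (\<sigma> i) (\<sigma> (Suc i)) []"
    and "sym (\<sigma> r) j = s" "r \<le> V" "j \<noteq> out"
  shows "tr (Loop j s c) (\<sigma> 0) (\<sigma> r) []"
  using tr_Loop[of r \<sigma> j s c "\<lambda>_. []"] assms by (simp add: concat_map_Nil)

lemma tr_rewind_to:
  assumes "\<sigma> j = (q + int p, t)" "t q = s" "\<And>i. q < i \<Longrightarrow> i \<le> q + int p \<Longrightarrow> t i \<noteq> s" "p \<le> V" "j \<noteq> out"
  shows "tr (Loop j s (Mv j Move_Left)) \<sigma> (\<sigma>(j := (q, t))) []"
proof -
  have "tr (Loop j s (Mv j Move_Left)) (\<sigma>(j := (q + int p - int 0, t))) (\<sigma>(j := (q +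
      int p - int p, t))) []"
  proof (rule tr_Loop_silent[where \<sigma> = "\<lambda>i. \<sigma>(j := (q + int p - int i, t))"])
    show "tr (Mv j Move_Left) (\<sigma>(j := (q + int p - int i, t))) (\<sigma>(j := (q + int p - int (Suc i),
        t))) []" for i
      using tr_Mv[OF assms(5), of Move_Left "\<sigma>(j := (q + int p - int i, t))"]
      by (rule trD) (simp add: fun_eq_iff)
  qed (use assms in auto)
  moreover have "\<sigma>(j := (q + int p - int 0, t)) = \<sigma>" using assms(1) by auto
  ultimately show ?thesis by simp
qed

lemma tr_rewind:
  assumes "\<sigma> j = (int p, t)" "t 0 = s" "\<And>i. 0 < i \<Longrightarrow> i \<le> int p \<Longrightarrow> t i \<noteq> s" "p \<le> V" "j \<noteq> out"
  shows "tr (Loop j s (Mv j Move_Left)) \<sigma> (\<sigma>(j := (0, t))) []"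
  using tr_rewind_to[of \<sigma> j 0 p] assms by simp

lemma tr_For:
  assumes body: "\<And>i. i < L \<Longrightarrow> tr c ((h i)(x := ruler L (int i))) ((h (Suc i))(x :=
      ruler L (int i))) (ys i)"
    and "0 < L" "L \<le> V" "x \<noteq> out"
  shows "tr (For x c) ((h 0)(x := ruler L 0)) ((h L)(x := ruler L 0)) (concat (map ys [0..<L]))"
proof -
  have "tr (c ;; Mv x Move_Right) ((h i)(x := ruler L (int i))) ((h (Suc i))(x :=
      ruler L (int (Suc i)))) (ys i)"
    if "i < L" for i
    using tr_Seq[OF body[OF that] tr_Mv[OF assms(4), of Move_Right]]
        by (simp add: ruler_def add.commute)
  then have "tr (Loop x 2 (c ;; Mv x Move_Right)) ((h 0)(x := ruler L (int 0))) ((h L)(x :=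
      ruler L (int L)))
      (concat (map ys [0..<L]))"
    using assms by (intro tr_Loop[where \<sigma> = "\<lambda>i. (h i)(x := ruler L (int i))"])
        (auto simp: head_symbol_ruler)
  moreover have "tr (Loop x 1 (Mv x Move_Left)) ((h L)(x := ruler L (int L))) ((h L)(x :=
      ruler L 0)) []"
    using tr_rewind[of "(h L)(x := ruler L (int L))" x L "snd (ruler L 0)" 1] assms
    by (auto simp: ruler_def)
  ultimately show ?thesis unfolding For_def using tr_Seq by fastforce
qed

lemma tr_For_silent:
  assumes "\<And>i. i < L \<Longrightarrow> tr c ((h i)(x := ruler L (int i))) ((h (Suc i))(x := ruler L (int i))) []"
    and "0 < L" "L \<le> V" "x \<noteq> out"
  shows "tr (For x c) ((h 0)(x := ruler L 0)) ((h L)(x := ruler L 0)) []"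
  using tr_For[of L c h x "\<lambda>_. []"] assms by (simp add: concat_map_Nil)

definition emit :: "bool \<Rightarrow> com" where
  "emit b = Put out (if b then 2 else 1) ;; Mv out Move_Right"

definition emits :: "bool list \<Rightarrow> com" where
  "emits bs = seqs (map emit bs)"

lemma tr_emit: "tr (emit b) \<sigma> \<sigma> [b]"
  unfolding tr_def emit_def exec.simps
  by (intro allI exI conjI, rule refl)
    (simp add: out_tape_def word_cells_snoc add.commute)

lemma tr_emits: "tr (emits bs) \<sigma> \<sigma> bs"
proof -
  have "tr (emits bs) \<sigma> \<sigma> (concat (map (\<lambda>i. [bs ! i]) [0..<length (map emit bs)]))"
    unfolding emits_def by (rule tr_seqs[where \<sigma> = "\<lambda>_. \<sigma>"]) (simp add: tr_emit)
  moreover have "concat (map (\<lambda>i. [bs ! i]) [0..<length (map emit bs)]) = bs"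
    by (simp add: concat_map_singleton map_nth)
  ultimately show ?thesis by simp
qed

text \<open>Unary arithmetic with the head of \<open>y\<close> as accumulator: sequencing adds
  displacements and \<open>For\<close> multiplies them by a ruler length, so rulers of polynomial
  length can be built from existing ones.\<close>

definition advances :: "com \<Rightarrow> nat \<Rightarrow> int \<Rightarrow> (nat \<times> nat) set \<Rightarrow> bool" where
  "advances c y a Rs \<longleftrightarrow> (\<forall>\<sigma>. (\<forall>(x, L) \<in> Rs. \<sigma> x = ruler L 0) \<longrightarrow>
     tr c \<sigma> (\<sigma>(y := (fst (\<sigma> y) + a, snd (\<sigma> y)))) [])"

lemma tr_advances:
  assumes "advances c y a Rs" "\<And>x L. (x, L) \<in> Rs \<Longrightarrow> \<sigma> x = ruler L 0" "\<sigma> y = (p, t)"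
    "\<sigma>' = \<sigma>(y := (p + a, t))"
  shows "tr c \<sigma> \<sigma>' []"
proof -
  have "tr c \<sigma> (\<sigma>(y := (fst (\<sigma> y) + a, snd (\<sigma> y)))) []"
    using assms(1,2) unfolding advances_def by blast
  then show ?thesis using assms(3,4) by simp
qed

lemma advancesI:
  assumes "\<And>\<sigma> p t. (\<And>x L. (x, L) \<in> Rs \<Longrightarrow> \<sigma> x = ruler L 0) \<Longrightarrow> \<sigma> y = (p, t) \<Longrightarrow>
    tr c \<sigma> (\<sigma>(y := (p + a, t))) []"
  shows "advances c y a Rs"
  unfolding advances_def
proof (intro allI impI)
  fix \<sigma> assume "\<forall>(x, L) \<in> Rs. \<sigma> x = ruler L 0"
  then show "tr c \<sigma> (\<sigma>(y := (fst (\<sigma> y) + a, snd (\<sigma> y)))) []"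
    by (intro assms) (auto simp: prod_eq_iff)
qed

lemma advances_Mv: "y \<noteq> out \<Longrightarrow> a = move_offset d \<Longrightarrow> advances (Mv y d) y a Rs"
  by (simp add: advances_def tr_Mv)

lemma advances_Seq:
  assumes "advances c1 y a Rs" "advances c2 y b Rs" "y \<notin> fst ` Rs" "e = a + b"
  shows "advances (c1 ;; c2) y e Rs"
proof (rule advancesI)
  fix \<sigma> p t assume R: "\<And>x L. (x, L) \<in> Rs \<Longrightarrow> \<sigma> x = ruler L 0" and y: "\<sigma> y = (p, t)"
  have "tr c1 \<sigma> (\<sigma>(y := (p + a, t))) []"
    by (rule tr_advances[OF assms(1), where p = p and t = t]) (simp_all add: R y)
  moreover have "(\<sigma>(y := (p + a, t))) x = ruler L 0" if "(x, L) \<in> Rs" for x L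
    using R[OF that] that assms(3) by force
  then have "tr c2 (\<sigma>(y := (p + a, t))) (\<sigma>(y := (p + e, t))) []"
    by (rule tr_advances[OF assms(2), where p = "p + a" and t = t]) (simp_all add: assms(4)
        fun_eq_iff)
  ultimately show "tr (c1 ;; c2) \<sigma> (\<sigma>(y := (p + e, t))) []" by (rule tr_Seq_silent)
qed

lemma advances_For:
  assumes "advances c y a Rs" "(x, L) \<in> Rs'" "Rs \<subseteq> Rs'" "x \<notin> fst ` Rs" "x \<noteq> y" "y \<notin> fst ` Rs"
    "0 < L" "L \<le> V" "x \<noteq> out" "e = int L * a"
  shows "advances (For x c) y e Rs'"
proof (rule advancesI)
  fix \<sigma> p t assume R: "\<And>x L. (x, L) \<in> Rs' \<Longrightarrow> \<sigma> x = ruler L 0" and y: "\<sigma> y = (p, t)"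
  have \<sigma>x: "\<sigma> x = ruler L 0" using R assms(2) by auto
  define h where "h i = \<sigma>(y := (p + int i * a, t))" for i :: nat
  have "tr (For x c) ((h 0)(x := ruler L 0)) ((h L)(x := ruler L 0)) []"
  proof (rule tr_For_silent)
    fix i assume "i < L"
    have "((h i)(x := ruler L (int i))) z = ruler M 0" if "(z, M) \<in> Rs" for z M
      using R[of z M] that assms(3,4,6) by (force simp: h_def)
    then show "tr c ((h i)(x := ruler L (int i))) ((h (Suc i))(x := ruler L (int i))) []"
      by (rule tr_advances[OF assms(1), where p = "p + int i * a" and t = t])
        (use assms(5) in \<open>auto simp: h_def fun_eq_iff algebra_simps\<close>)
  qed (use assms in auto)
  moreover have "(h 0)(x := ruler L 0) = \<sigma>" using \<sigma>x y by (auto simp: h_def)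
  moreover have "(h L)(x := ruler L 0) = \<sigma>(y := (p + e, t))"
    using \<sigma>x assms(5,10) by (auto simp: h_def fun_eq_iff)
  ultimately show "tr (For x c) \<sigma> (\<sigma>(y := (p + e, t))) []" by simp
qed

definition mvs :: "nat \<Rightarrow> nat \<Rightarrow> com" where
  "mvs y n = seqs (replicate n (Mv y Move_Right))"

lemma advances_mvs: "y \<noteq> out \<Longrightarrow> y \<notin> fst ` Rs \<Longrightarrow> a = int n \<Longrightarrow> advances (mvs y n) y a Rs"
proof (induction n arbitrary: a)
  case 0
  then show ?case by (simp add: mvs_def seqs_def advances_def tr_Skip)
next
  case (Suc n)
  have "mvs y (Suc n) = Mv y Move_Right ;; mvs y n" by (simp add: mvs_def seqs_def)
  with Suc show ?case
    by (auto intro!: advances_Seq[where a = 1 and b = "int n"] advances_Mv)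
qed

definition make_ruler :: "nat \<Rightarrow> com \<Rightarrow> com" where
  "make_ruler y c = Put y 1 ;; c ;; Put y 2 ;; Loop y 1 (Mv y Move_Left)"

lemma tr_make_ruler:
  assumes c: "tr c (\<sigma>(y := counter 0)) (\<sigma>'(y := counter (int L))) []"
    and "\<sigma> y = blank_tape" "0 < L" "L \<le> V" "y \<noteq> out"
  shows "tr (make_ruler y c) \<sigma> (\<sigma>'(y := ruler L 0)) []"
  unfolding make_ruler_def
proof (intro tr_Seq_silent)
  show "tr (Put y 1) \<sigma> (\<sigma>(y := counter 0)) []"
    by (rule trD[OF tr_Put]) (use assms in \<open>auto simp: counter_def blank_tape_def fun_eq_iff\<close>)
  show "tr (Put y 2) (\<sigma>'(y := counter (int L))) (\<sigma>'(y := ruler L (int L))) []"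
    by (rule trD[OF tr_Put]) (use assms in \<open>auto simp: counter_def ruler_def fun_eq_iff\<close>)
  show "tr (Loop y 1 (Mv y Move_Left)) (\<sigma>'(y := ruler L (int L))) (\<sigma>'(y := ruler L 0)) []"
    using tr_rewind[of "\<sigma>'(y := ruler L (int L))" y L "snd (ruler L 0)" 1] assms
    by (auto simp: ruler_def)
qed (rule c)

lemma tr_make_ruler_advances:
  assumes "advances c y (int L) Rs" "\<And>x M. (x, M) \<in> Rs \<Longrightarrow> \<sigma> x = ruler M 0" "y \<notin> fst ` Rs"
    "\<sigma> y = blank_tape" "0 < L" "L \<le> V" "y \<noteq> out"
  shows "tr (make_ruler y c) \<sigma> (\<sigma>(y := ruler L 0)) []"
proof (rule tr_make_ruler)
  have "(\<sigma>(y := counter 0)) x = ruler M 0" if "(x, M) \<in> Rs" for x M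
    using that assms(2)[OF that] assms(3) by force
  then show "tr c (\<sigma>(y := counter 0)) (\<sigma>(y := counter (int L))) []"
    by (rule tr_advances[OF assms(1), where p = 0 and t = "snd (counter 0)"])
        (auto simp: counter_def)
qed (use assms in auto)

end

section \<open>Full-rank lattices and tile sets\<close>

text \<open>A repetition in \<open>b\<close> is itself a nontrivial relation, with coefficients 1
  and -1. So the coordinatewise hypothesis yields distinctness as well as independence of the
  set.\<close>

lemma lin_indep_familyI:
  fixes b :: "real vec list"
  assumes b: "set b \<subseteq> carrier_vec n" "length b = n"
    and ind: "\<And>\<nu>. (\<And>s. s < n \<Longrightarrow> (\<Sum>r<n. \<nu> r * (b ! r) $ s) = 0) \<Longrightarrow> \<forall>r<n. \<nu> r = 0"
  shows "lin_indep_family n b"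
proof -
  interpret V: vec_module "TYPE(real)" n .
  have dist: "distinct b"
  proof (rule ccontr)
    assume "\<not> distinct b"
    then obtain i j where ij: "i < n" "j < n" "i \<noteq> j" "b ! i = b ! j"
      using b(2) by (auto simp: distinct_conv_nth)
    define \<nu> :: "nat \<Rightarrow> real" where "\<nu> = (\<lambda>_. 0)(i := 1, j := - 1)"
    have "(\<Sum>r<n. \<nu> r * (b ! r) $ s) = 0" for s
    proof -
      have "(\<Sum>r<n. \<nu> r * (b ! r) $ s) = (\<Sum>r\<in>{i, j}. \<nu> r * (b ! r) $ s)"
        using ij by (intro sum.mono_neutral_right) (auto simp: \<nu>_def)
      then show ?thesis using ij by (simp add: \<nu>_def)
    qed
    then have "\<nu> i = 0" using ind ij(1) by blast
    then show False using ij by (simp add: \<nu>_def)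
  qed
  have "\<not> V.lin_dep (set b)"
  proof
    assume "V.lin_dep (set b)"
    then obtain A a v where A: "finite A" "A \<subseteq> set b" "V.lincomb a A = 0\<^sub>v n" "v \<in> A" "a v \<noteq> 0"
      unfolding V.lin_dep_def module_vec_simps class_ring_simps by blast
    define \<nu> where "\<nu> r = (if b ! r \<in> A then a (b ! r) else 0)" for r
    have "(\<Sum>r<n. \<nu> r * (b ! r) $ s) = 0" if s: "s < n" for s
    proof -
      let ?g = "\<lambda>x. (if x \<in> A then a x else 0) * x $ s"
      have "bij_betw ((!) b) {..<n} (set b)"
        using bij_betw_nth[OF dist] b(2) by blast
      then have "(\<Sum>r<n. ?g (b ! r)) = (\<Sum>x\<in>set b. ?g x)"
        by (rule sum.reindex_bij_betw)
      then have "(\<Sum>r<n. \<nu> r * (b ! r) $ s) = (\<Sum>x\<in>set b. ?g x)"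
        by (simp add: \<nu>_def)
      also have "\<dots> = (\<Sum>x\<in>A. a x * x $ s)"
        using A by (intro sum.mono_neutral_cong_right) auto
      also have "\<dots> = V.lincomb a A $ s"
      proof -
        have "A \<subseteq> carrier_vec n" using A b by blast
        from vec_space.lincomb_index[OF s this, of a] show ?thesis by (rule sym)
      qed
      finally show ?thesis using A s by simp
    qed
    then have "\<forall>r<n. \<nu> r = 0" by (rule ind)
    moreover have "v \<in> set b" using A by blast
    then obtain r where "r < n" "b ! r = v" using b(2) by (auto simp: in_set_conv_nth)
    ultimately have "\<nu> r = 0" by blast
    with A \<open>b ! r = v\<close> show False by (simp add: \<nu>_def)
  qed
  then show ?thesis
    unfolding lin_indep_family_def using b dist by simp
qed

lemma mitr_instances_fullI:
  fixes E :: "nat \<Rightarrow> nat \<Rightarrow> rat"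
  assumes "\<And>\<nu> :: nat \<Rightarrow> real.
    (\<And>s. s < n \<Longrightarrow> (\<Sum>r<n. \<nu> r * of_rat (E r s)) = 0) \<Longrightarrow> \<forall>r<n. \<nu> r = 0"
  shows "(n, map (\<lambda>r. vec n (E r)) [0..<n], vec n d) \<in> mitr_instances"
proof -
  have "lin_indep_family n (map real_vec (map (\<lambda>r. vec n (E r)) [0..<n]))"
    using assms by (intro lin_indep_familyI) auto
  then show ?thesis by (simp add: mitr_instances_def)
qed

lemma mitr_nonempty_full_iff:
  fixes E :: "nat \<Rightarrow> nat \<Rightarrow> rat"
  shows "(n, map (\<lambda>r. vec n (E r)) [0..<n], vec n d) \<in> mitr_nonempty \<longleftrightarrow>
    (\<exists>\<mu> :: nat \<Rightarrow> int. (\<Sum>s<n. ((\<Sum>r<n. real_of_int (\<mu> r) * of_rat (E r s)) + of_rat (d s))\<^sup>2) \<le> 1)"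
proof -
  let ?b = "map real_vec (map (\<lambda>r. vec n (E r)) [0..<n])"
  let ?c = "real_vec (vec n d)"
  let ?x = "\<lambda>\<mu> :: nat \<Rightarrow> real. finsum_vec TYPE(real) n (\<lambda>i. \<mu> i \<cdot>\<^sub>v ?b ! i) {0..<n} + ?c"
  have carr: "?x \<mu> \<in> carrier_vec n" for \<mu>
    by (intro add_carrier_vec finsum_vec_closed) auto
  have idx: "?x \<mu> $ s = (\<Sum>r<n. \<mu> r * of_rat (E r s)) + of_rat (d s)" if "s < n" for \<mu> s
    using that by (subst index_add_vec, simp, subst index_finsum_vec)
      (auto intro!: sum.cong simp: atLeast0LessThan)
  have norm: "?x \<mu> \<bullet> ?x \<mu> = (\<Sum>s<n. ((\<Sum>r<n. \<mu> r * of_rat (E r s)) + of_rat (d s))\<^sup>2)" for \<mu>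
  proof -
    have "?x \<mu> \<bullet> ?x \<mu> = (\<Sum>s\<in>{0..<n}. ?x \<mu> $ s * ?x \<mu> $ s)"
      unfolding scalar_prod_def carrier_vecD[OF carr] ..
    also have "\<dots> = (\<Sum>s\<in>{0..<n}. ((\<Sum>r<n. \<mu> r * of_rat (E r s)) + of_rat (d s))\<^sup>2)"
      by (intro sum.cong refl) (simp only: idx atLeastLessThan_iff power2_eq_square)
    finally show ?thesis by (simp only: atLeast0LessThan)
  qed
  have "(n, map (\<lambda>r. vec n (E r)) [0..<n], vec n d) \<in> mitr_nonempty \<longleftrightarrow>
      (\<exists>\<mu>. (\<forall>i<n. \<mu> i \<in> \<int>) \<and> ?x \<mu> \<bullet> ?x \<mu> \<le> 1)"
  proof -
    have "feasible_region n n ?b ?c = {?x \<mu> | \<mu>. (\<forall>i<n. \<mu> i \<in> \<int>) \<and> ?x \<mu> \<bullet> ?x \<mu> \<le> 1}"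
      unfolding feasible_region_def mixed_integer_lattice_def using carr by blast
    then show ?thesis unfolding mitr_nonempty_def by (simp only: mem_Collect_eq prod.case dim_vec)
        blast
  qed
  also have "\<dots> \<longleftrightarrow> (\<exists>\<mu> :: nat \<Rightarrow> int. ?x (\<lambda>i. of_int (\<mu> i)) \<bullet> ?x (\<lambda>i. of_int (\<mu> i)) \<le> 1)"
  proof
    assume "\<exists>\<mu>. (\<forall>i<n. \<mu> i \<in> \<int>) \<and> ?x \<mu> \<bullet> ?x \<mu> \<le> 1"
    then obtain \<mu> where \<mu>: "\<forall>i<n. \<mu> i \<in> \<int>" and le: "?x \<mu> \<bullet> ?x \<mu> \<le> 1" by blast
    \<comment> \<open>\<open>\<mu>\<close> is known to be integral only at the indices below
      \<open>n\<close>; the floor agrees with it there and is an integer everywhere.\<close>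
    have fl: "of_int \<lfloor>\<mu> i\<rfloor> = \<mu> i" if "i < n" for i
      using \<mu> that by simp
    have "(\<Sum>r<n. of_int \<lfloor>\<mu> r\<rfloor> * of_rat (E r s)) = (\<Sum>r<n. \<mu> r * of_rat (E r s))" for s
      by (rule sum.cong) (simp_all only: fl lessThan_iff)
    then have "?x (\<lambda>i. of_int \<lfloor>\<mu> i\<rfloor>) \<bullet> ?x (\<lambda>i. of_int \<lfloor>\<mu> i\<rfloor>) = ?x \<mu> \<bullet> ?x \<mu>"
      by (simp only: norm[of "\<lambda>i. of_int \<lfloor>\<mu> i\<rfloor>"] norm[of \<mu>])
    then have "?x (\<lambda>i. of_int \<lfloor>\<mu> i\<rfloor>) \<bullet> ?x (\<lambda>i. of_int \<lfloor>\<mu> i\<rfloor>) \<le> 1"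
      using le by (rule ord_eq_le_trans)
    then show "\<exists>\<mu> :: nat \<Rightarrow> int. ?x (\<lambda>i. of_int (\<mu> i)) \<bullet> ?x (\<lambda>i. of_int (\<mu> i)) \<le> 1"
      by (rule exI[of _ "\<lambda>i. \<lfloor>\<mu> i\<rfloor>"])
  next
    assume "\<exists>\<mu> :: nat \<Rightarrow> int. ?x (\<lambda>i. of_int (\<mu> i)) \<bullet> ?x (\<lambda>i. of_int (\<mu> i)) \<le> 1"
    then obtain \<mu> :: "nat \<Rightarrow> int" where "?x (\<lambda>i. of_int (\<mu> i)) \<bullet> ?x (\<lambda>i. of_int (\<mu> i)) \<le> 1" ..
    then show "\<exists>\<mu>. (\<forall>i<n. \<mu> i \<in> \<int>) \<and> ?x \<mu> \<bullet> ?x \<mu> \<le> 1"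
      by (intro exI[of _ "\<lambda>i. of_int (\<mu> i)"] conjI) auto
  qed
  finally show ?thesis by (simp only: norm)
qed

section \<open>The lattice of a tile set\<close>

lemma sum_lessThan_mult:
  fixes F :: "nat \<Rightarrow> 'a :: comm_monoid_add"
  shows "(\<Sum>s<N * B. F s) = (\<Sum>m<N. \<Sum>\<kappa><B. F (m * B + \<kappa>))"
proof -
  have "(\<Sum>\<kappa><B. F (m * B + \<kappa>)) = sum F {m * B..<m * B + B}" for m
    using sum.shift_bounds_nat_ivl[of F 0 "m * B" B] by (simp add: atLeast0LessThan add.commute)
  then show ?thesis by (simp add: sum.nat_group)
qed

text \<open>Meant for a coordinate of cell \<open>m'\<close>: nonzero entries come only from the
  basis vectors of this cell, of the next one, and of the one \<open>W\<close> earlier.\<close>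

lemma sum_three:
  fixes a b c :: "nat \<Rightarrow> 'a :: comm_monoid_add"
  assumes "W > 0" "m' < N"
  shows "(\<Sum>m<N. if m' = m then a m else if m' + 1 = m then b m else if m' = m + W then c m else 0) =
    a m' + (if m' + 1 < N then b (m' + 1) else 0) + (if W \<le> m' then c (m' - W) else 0)"
proof -
  have "(\<Sum>m<N. if m' = m then a m else if m' + 1 = m then b m else if m' = m + W then c m else 0) =
    (\<Sum>m<N. (if m' = m then a m else 0) + (if m' + 1 = m then b m else 0) +
       (if m' - W = m then (if W \<le> m' then c m else 0) else 0))"
    using assms(1) by (intro sum.cong) auto
  also have "\<dots> = a m' + (if m' + 1 < N then b (m' + 1) else 0) + (if W \<le> m' then c (m' - W) else 0)"
    using assms less_imp_diff_less[of m' N W] by (simp add: sum.distrib)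
  finally show ?thesis .
qed

lemma sum_quarter_pow: "(\<Sum>l<L. 3 / 4 ^ Suc l :: real) = 1 - 1 / 4 ^ L"
  by (induction L) (auto simp: field_simps)

locale tile_set =
  fixes K' q :: nat and left right lower upper :: "nat \<Rightarrow> nat"
begin

text \<open>The indices \<kappa>, \<kappa> + K', \<kappa> + 2 K' share an exponent, see
  \<open>wexp\<close>; in the application they are copies of the same tile.\<close>

definition nt :: nat where "nt = 3 * K'"
definition nb :: nat where "nb = nt + 3"

text \<open>The coordinates \<open>nt\<close>, \<open>nt + 1\<close>, \<open>nt + 2\<close> of a
  cell stand for the choice of a tile, the edge to the next cell and the edge to the cell
  \<open>W\<close> before. Each edge belongs to one cell; \<open>prv\<close> and \<open>nxt\<close>
  are the contributions from its other side.\<close>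

definition own :: "nat \<Rightarrow> nat \<Rightarrow> int" where
  "own \<kappa> \<kappa>' = (if \<kappa> < nt then (if \<kappa>' = nt then 1 else if \<kappa>' = nt + 1 then int (right \<kappa>)
       else if \<kappa>' = nt + 2 then int (lower \<kappa>) else 0)
     else if \<kappa>' = \<kappa> then int q else 0)"

definition prv :: "nat \<Rightarrow> nat \<Rightarrow> int" where
  "prv \<kappa> \<kappa>' = (if \<kappa> < nt \<and> \<kappa>' = nt + 1 then - int (left \<kappa>) else 0)"

definition nxt :: "nat \<Rightarrow> nat \<Rightarrow> int" where
  "nxt \<kappa> \<kappa>' = (if \<kappa> < nt \<and> \<kappa>' = nt + 2 then - int (upper \<kappa>) else 0)"

text \<open>The basis entry \<open>1 / 2 ^ wexp m \<kappa>\<close> is twice the size of the offset,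
  so the exponent of the tile coordinate is \<open>Suc (wexp m \<kappa>)\<close>. For m < N the
  values of \<open>wexp\<close> are exactly the numbers below \<open>N * K'\<close>, each for three
  indices.\<close>

definition wexp :: "nat \<Rightarrow> nat \<Rightarrow> nat" where
  "wexp m \<kappa> = K' * m + \<kappa> mod K'"

definition entry :: "nat \<Rightarrow> nat \<Rightarrow> nat \<Rightarrow> nat \<Rightarrow> nat \<Rightarrow> rat" where
  "entry W m \<kappa> m' \<kappa>' =
     (if m' = m then (if \<kappa>' = \<kappa> \<and> \<kappa> < nt then 1 / 2 ^ wexp m \<kappa> else of_int (own \<kappa> \<kappa>'))
      else if m' + 1 = m then of_int (prv \<kappa> \<kappa>')
      else if m' = m + W then of_int (nxt \<kappa> \<kappa>') else 0)"

definition offset :: "nat \<Rightarrow> (nat \<Rightarrow> nat) \<Rightarrow> nat \<Rightarrow> nat \<Rightarrow> rat" where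
  "offset W u m \<kappa> =
     (if \<kappa> < nt then - 1 / 2 ^ Suc (wexp m \<kappa>) else if \<kappa> = nt then - 1
      else if \<kappa> = nt + 2 \<and> m < W then - of_nat (u m) else 0)"

definition mitr_of :: "nat \<Rightarrow> nat \<Rightarrow> (nat \<Rightarrow> nat) \<Rightarrow> mitr_input" where
  "mitr_of N W u = (N * nb,
     map (\<lambda>r. vec (N * nb) (\<lambda>s. entry W (r div nb) (r mod nb) (s div nb) (s mod nb))) [0..<N * nb],
     vec (N * nb) (\<lambda>s. offset W u (s div nb) (s mod nb)))"

text \<open>The cells form one sequence, so the end of a row is also matched with the start of the
  next row; colour 0 closes the last cell. \<open>u\<close> prescribes the colours below the first
  row.\<close>

definition tiling :: "nat \<Rightarrow> nat \<Rightarrow> (nat \<Rightarrow> nat) \<Rightarrow> (nat \<Rightarrow> nat) \<Rightarrow> bool" where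
  "tiling N W u f \<longleftrightarrow> (\<forall>m<N. f m < nt) \<and>
     (\<forall>m<N. right (f m) = (if m + 1 < N then left (f (m + 1)) else 0)) \<and>
     (\<forall>m<N. lower (f m) = (if W \<le> m then upper (f (m - W)) else u m))"

lemma nb_gt: "nt < nb" "nt + 1 < nb" "nt + 2 < nb"
  by (auto simp: nb_def)

lemma sum_nb: "(\<Sum>\<kappa><nb. F \<kappa>) = (\<Sum>\<kappa><nt. F \<kappa>) + F nt + F (nt + 1) + F (nt + 2)"
  for F :: "nat \<Rightarrow> 'a :: comm_monoid_add"
  by (simp add: nb_def eval_nat_numeral)

definition coord :: "nat \<Rightarrow> nat \<Rightarrow> (nat \<Rightarrow> nat \<Rightarrow> real) \<Rightarrow> nat \<Rightarrow> nat \<Rightarrow> real" where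
  "coord N W \<nu> m' \<kappa>' = (\<Sum>m<N. \<Sum>\<kappa><nb. \<nu> m \<kappa> * of_rat (entry W m \<kappa> m' \<kappa>'))"

lemma coord_three:
  assumes "0 < W" "m' < N"
  shows "coord N W \<nu> m' \<kappa>' =
    (\<Sum>\<kappa><nb. \<nu> m' \<kappa> * (if \<kappa>' = \<kappa> \<and> \<kappa> < nt then 1 / 2 ^ wexp m' \<kappa> else of_int (own \<kappa> \<kappa>'))) +
    (if m' + 1 < N then \<Sum>\<kappa><nb. \<nu> (m' + 1) \<kappa> * of_int (prv \<kappa> \<kappa>') else 0) +
    (if W \<le> m' then \<Sum>\<kappa><nb. \<nu> (m' - W) \<kappa> * of_int (nxt \<kappa> \<kappa>') else 0)"
proof -
  have "coord N W \<nu> m' \<kappa>' = (\<Sum>m<N.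
      if m' = m then \<Sum>\<kappa><nb. \<nu> m \<kappa> * (if \<kappa>' = \<kappa> \<and> \<kappa> < nt then 1 / 2 ^ wexp m \<kappa> else of_int (own \<kappa>
          \<kappa>'))
      else if m' + 1 = m then \<Sum>\<kappa><nb. \<nu> m \<kappa> * of_int (prv \<kappa> \<kappa>')
      else if m' = m + W then \<Sum>\<kappa><nb. \<nu> m \<kappa> * of_int (nxt \<kappa> \<kappa>')
      else 0)"
    unfolding coord_def
    by (intro sum.cong refl)
      (auto simp: entry_def of_rat_divide of_rat_power intro!: sum.cong)
  then show ?thesis unfolding sum_three[OF assms] .
qed

lemma coord_tile:
  assumes "0 < W" "m' < N" "\<kappa>' < nt"
  shows "coord N W \<nu> m' \<kappa>' = \<nu> m' \<kappa>' / 2 ^ wexp m' \<kappa>'"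
proof -
  have "(\<Sum>\<kappa><nt. \<nu> m' \<kappa> * (if \<kappa>' = \<kappa> then 1 / 2 ^ wexp m' \<kappa> else of_int (own \<kappa> \<kappa>'))) =
      (\<Sum>\<kappa><nt. if \<kappa>' = \<kappa> then \<nu> m' \<kappa> / 2 ^ wexp m' \<kappa> else 0)"
    using assms(3) by (intro sum.cong) (auto simp: own_def)
  then show ?thesis
    using assms unfolding coord_three[OF assms(1,2)] sum_nb
    by (simp add: own_def prv_def nxt_def)
qed

lemma coord_one:
  assumes "0 < W" "m' < N"
  shows "coord N W \<nu> m' nt = (\<Sum>\<kappa><nt. \<nu> m' \<kappa>) + of_nat q * \<nu> m' nt"
  using assms unfolding coord_three[OF assms] sum_nb
  by (auto simp: own_def prv_def nxt_def intro!: sum.cong)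

lemma coord_horizontal:
  assumes "0 < W" "m' < N"
  shows "coord N W \<nu> m' (nt + 1) = (\<Sum>\<kappa><nt. of_nat (right \<kappa>) * \<nu> m' \<kappa>)
     - (if m' + 1 < N then \<Sum>\<kappa><nt. of_nat (left \<kappa>) * \<nu> (m' + 1) \<kappa> else 0) + of_nat q * \<nu> m' (nt + 1)"
  using assms unfolding coord_three[OF assms] sum_nb
  by (auto simp: own_def prv_def nxt_def sum_negf mult.commute intro!: sum.cong)

lemma coord_vertical:
  assumes "0 < W" "m' < N"
  shows "coord N W \<nu> m' (nt + 2) = (\<Sum>\<kappa><nt. of_nat (lower \<kappa>) * \<nu> m' \<kappa>)
     - (if W \<le> m' then \<Sum>\<kappa><nt. of_nat (upper \<kappa>) * \<nu> (m' - W) \<kappa> else 0) + of_nat q * \<nu> m' (nt + 2)"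
  using assms unfolding coord_three[OF assms] sum_nb
  by (auto simp: own_def prv_def nxt_def sum_negf mult.commute intro!: sum.cong)

lemma cell_index: "\<kappa> < nb \<Longrightarrow> (m * nb + \<kappa>) div nb = m" "\<kappa> < nb \<Longrightarrow> (m * nb + \<kappa>) mod nb = \<kappa>"
  by auto

lemma cell_index_less: "m < N \<Longrightarrow> \<kappa> < nb \<Longrightarrow> m * nb + \<kappa> < N * nb"
proof -
  assume "m < N" "\<kappa> < nb"
  then have "m * nb + \<kappa> < Suc m * nb" by simp
  also have "\<dots> \<le> N * nb" using \<open>m < N\<close> by (intro mult_le_mono1) simp
  finally show ?thesis .
qed

lemma nb_pos: "0 < nb" by (simp add: nb_def)

lemma index_cell: "s < N * nb \<Longrightarrow> s div nb < N \<and> s mod nb < nb"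
  using nb_pos by (simp add: less_mult_imp_div_less)

lemma coord_eq_sum:
  "(\<Sum>r<N * nb. \<mu> r * of_rat (entry W (r div nb) (r mod nb) m' \<kappa>')) =
     coord N W (\<lambda>m \<kappa>. \<mu> (m * nb + \<kappa>)) m' \<kappa>'"
  unfolding sum_lessThan_mult coord_def
  by (intro sum.cong refl) (simp add: cell_index)

text \<open>The basis matrix is block triangular: the tile coordinates make the tile coefficients
  vanish, after which each constraint coordinate is \<open>q\<close> times a single
  coefficient.\<close>

lemma mitr_of_instance:
  assumes "0 < W" "0 < q"
  shows "mitr_of N W u \<in> {(p, b, c) \<in> mitr_instances. p = dim_vec c}"
proof -
  have "\<forall>r<N * nb. \<mu> r = 0"
    if "\<And>s. s < N * nb \<Longrightarrow> (\<Sum>r<N * nb. \<mu> r * of_rat (entry W (r div nb) (r mod nb) (s div nb)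
        (s mod nb))) = 0"
    for \<mu> :: "nat \<Rightarrow> real"
  proof -
    define \<nu> where "\<nu> = (\<lambda>m \<kappa>. \<mu> (m * nb + \<kappa>))"
    have z: "coord N W \<nu> m \<kappa> = 0" if "m < N" "\<kappa> < nb" for m \<kappa>
      using \<open>\<And>s. s < N * nb \<Longrightarrow> _\<close>[OF cell_index_less[OF that]] that(2)
      unfolding coord_eq_sum by (simp add: cell_index \<nu>_def)
    have tile: "\<nu> m \<kappa> = 0" if "m < N" "\<kappa> < nt" for m \<kappa>
      using z[OF that(1), of \<kappa>] coord_tile[OF assms(1) that, of \<nu>] that nb_gt by simp
    have "\<nu> m nt = 0" "\<nu> m (nt + 1) = 0" "\<nu> m (nt + 2) = 0" if "m < N" for m
      using z[OF that nb_gt(1)] z[OF that nb_gt(2)] z[OF that nb_gt(3)] assms(2) that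
      unfolding coord_one[OF assms(1) that] coord_horizontal[OF assms(1) that]
        coord_vertical[OF assms(1) that] by (auto simp: tile split: if_splits)
    with tile have "\<nu> m \<kappa> = 0" if "m < N" "\<kappa> < nb" for m \<kappa>
    proof -
      have "\<kappa> < nt \<or> \<kappa> = nt \<or> \<kappa> = nt + 1 \<or> \<kappa> = nt + 2" using that(2) by (auto simp: nb_def)
      with tile that(1) \<open>\<And>m. m < N \<Longrightarrow> \<nu> m nt = 0\<close> \<open>\<And>m. m < N \<Longrightarrow> \<nu> m (nt + 1) = 0\<close>
        \<open>\<And>m. m < N \<Longrightarrow> \<nu> m (nt + 2) = 0\<close> show ?thesis by blast
    qed
    then have "\<nu> (r div nb) (r mod nb) = 0" if "r < N * nb" for r
      using index_cell[OF that] by blast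
    then show ?thesis by (simp add: \<nu>_def)
  qed
  from mitr_instances_fullI[of "N * nb", OF this]
  show ?thesis by (simp add: mitr_of_def)
qed

section \<open>Lattice points in the unit ball and tilings\<close>

definition resid :: "nat \<Rightarrow> nat \<Rightarrow> (nat \<Rightarrow> nat) \<Rightarrow> (nat \<Rightarrow> nat \<Rightarrow> int) \<Rightarrow> nat \<Rightarrow> nat \<Rightarrow> real" where
  "resid N W u \<nu> m \<kappa> = coord N W (\<lambda>m \<kappa>. of_int (\<nu> m \<kappa>)) m \<kappa> + of_rat (offset W u m \<kappa>)"

lemma mitr_of_nonempty_iff_resid:
  "mitr_of N W u \<in> mitr_nonempty \<longleftrightarrow>
     (\<exists>\<nu>. (\<Sum>m<N. \<Sum>\<kappa><nb. (resid N W u \<nu> m \<kappa>)\<^sup>2) \<le> 1)"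
proof -
  have "mitr_of N W u \<in> mitr_nonempty \<longleftrightarrow>
      (\<exists>\<mu> :: nat \<Rightarrow> int. (\<Sum>m<N. \<Sum>\<kappa><nb. (resid N W u (\<lambda>m \<kappa>. \<mu> (m * nb + \<kappa>)) m \<kappa>)\<^sup>2) \<le> 1)"
    unfolding mitr_of_def mitr_nonempty_full_iff
    by (subst sum_lessThan_mult, subst coord_eq_sum) (simp add: cell_index resid_def)
  also have "\<dots> \<longleftrightarrow> (\<exists>\<nu>. (\<Sum>m<N. \<Sum>\<kappa><nb. (resid N W u \<nu> m \<kappa>)\<^sup>2) \<le> 1)"
  proof
    assume "\<exists>\<nu>. (\<Sum>m<N. \<Sum>\<kappa><nb. (resid N W u \<nu> m \<kappa>)\<^sup>2) \<le> 1"
    then obtain \<nu> where le: "(\<Sum>m<N. \<Sum>\<kappa><nb. (resid N W u \<nu> m \<kappa>)\<^sup>2) \<le> 1" ..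
    define \<mu> where "\<mu> r = \<nu> (r div nb) (r mod nb)" for r
    have "coord N W (\<lambda>m \<kappa>. of_int (\<mu> (m * nb + \<kappa>))) = coord N W (\<lambda>m \<kappa>. of_int (\<nu> m \<kappa>))"
      unfolding coord_def by (intro ext sum.cong refl) (simp add: \<mu>_def cell_index)
    with le show "\<exists>\<mu> :: nat \<Rightarrow> int. (\<Sum>m<N. \<Sum>\<kappa><nb. (resid N W u (\<lambda>m \<kappa>. \<mu> (m * nb + \<kappa>)) m \<kappa>)\<^sup>2) \<le> 1"
      by (intro exI[of _ \<mu>]) (simp add: resid_def)
  qed blast
  finally show ?thesis .
qed

lemma nt_pos: "0 < K' \<Longrightarrow> 0 < nt" by (simp add: nt_def)

text \<open>The three indices with equal exponent add up to \<open>3 / 4 ^ Suc l\<close>, a term of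
  a geometric series.\<close>

lemma weight_sum:
  "(\<Sum>m<N. \<Sum>\<kappa><nt. 1 / 4 ^ Suc (wexp m \<kappa>) :: real) = 1 - 1 / 4 ^ (N * K')"
proof -
  have "(\<Sum>\<kappa><nt. 1 / 4 ^ Suc (wexp m \<kappa>) :: real) = (\<Sum>\<kappa><K'. 3 / 4 ^ Suc (m * K' + \<kappa>))" for m
    unfolding nt_def sum_lessThan_mult
    by (simp add: eval_nat_numeral wexp_def mult.commute sum_distrib_left)
  then have "(\<Sum>m<N. \<Sum>\<kappa><nt. 1 / 4 ^ Suc (wexp m \<kappa>) :: real) = (\<Sum>l<N * K'. 3 / 4 ^ Suc l)"
    unfolding sum_lessThan_mult by (rule sum.cong[OF refl])
  then show ?thesis by (simp only: sum_quarter_pow)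
qed

lemma wexp_less: "m < N \<Longrightarrow> 0 < K' \<Longrightarrow> Suc (wexp m \<kappa>) \<le> N * K'"
proof -
  assume "m < N" "0 < K'"
  then have "Suc (wexp m \<kappa>) \<le> Suc m * K'" by (simp add: wexp_def Suc_le_eq)
  also have "\<dots> \<le> N * K'" using \<open>m < N\<close> by (intro mult_le_mono1) simp
  finally show ?thesis .
qed

lemma resid_tile:
  assumes "0 < W" "m < N" "\<kappa> < nt"
  shows "(resid N W u \<nu> m \<kappa>)\<^sup>2 = (of_int (2 * \<nu> m \<kappa> - 1))\<^sup>2 / 4 ^ Suc (wexp m \<kappa>)"
proof -
  have "resid N W u \<nu> m \<kappa> = of_int (2 * \<nu> m \<kappa> - 1) / 2 ^ Suc (wexp m \<kappa>)"
    unfolding resid_def coord_tile[OF assms] using assms(3)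
    by (simp add: offset_def of_rat_divide of_rat_power of_rat_minus of_rat_mult field_simps)
  moreover have "(2 ^ Suc (wexp m \<kappa>))\<^sup>2 = (4 ^ Suc (wexp m \<kappa>) :: real)"
  proof -
    have "(2 ^ Suc (wexp m \<kappa>))\<^sup>2 = ((2\<^sup>2) ^ Suc (wexp m \<kappa>) :: real)"
      by (simp only: power_mult[symmetric] mult.commute)
    then show ?thesis by simp
  qed
  ultimately show ?thesis by (simp add: power_divide)
qed

lemma resid_constraint:
  assumes "0 < W" "m < N"
  shows "resid N W u \<nu> m nt = of_int ((\<Sum>\<kappa><nt. \<nu> m \<kappa>) - 1 + int q * \<nu> m nt)"
    "resid N W u \<nu> m (nt + 1) = of_int ((\<Sum>\<kappa><nt. int (right \<kappa>) * \<nu> m \<kappa>)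
       - (if m + 1 < N then \<Sum>\<kappa><nt. int (left \<kappa>) * \<nu> (m + 1) \<kappa> else 0) + int q * \<nu> m (nt + 1))"
    "resid N W u \<nu> m (nt + 2) = of_int ((\<Sum>\<kappa><nt. int (lower \<kappa>) * \<nu> m \<kappa>)
       - (if W \<le> m then \<Sum>\<kappa><nt. int (upper \<kappa>) * \<nu> (m - W) \<kappa> else int (u m)) + int q * \<nu> m (nt + 2))"
  unfolding resid_def coord_one[OF assms] coord_horizontal[OF assms] coord_vertical[OF assms]
  by (auto simp: offset_def of_rat_minus)

text \<open>From right to left the coordinates attain their least squares. For the converse let
  \<open>ex\<close> be the excess of a square over its least value. The excesses are nonnegative and
  add up to at most the gap \<open>1 / 4 ^ (N * K')\<close>, which rules out non-Boolean tile
  variables and nonzero constraints. With Boolean variables, the part of a constraint without its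
  multiple of \<open>q\<close> lies strictly between \<open>- int q\<close> and
  \<open>int q\<close>, so both vanish.\<close>

theorem mitr_of_nonempty_iff:
  assumes K: "0 < K'" and W: "0 < W" and q: "nt < q"
    and col: "\<And>\<kappa>. \<kappa> < nt \<Longrightarrow> left \<kappa> < q \<and> right \<kappa> < q \<and> lower \<kappa> < q \<and> upper \<kappa> < q"
    and u: "\<And>m. m < W \<Longrightarrow> u m < q"
  shows "mitr_of N W u \<in> mitr_nonempty \<longleftrightarrow> (\<exists>f. tiling N W u f)"
proof
  assume "\<exists>f. tiling N W u f"
  then obtain f where f: "tiling N W u f" ..
  define \<nu> :: "nat \<Rightarrow> nat \<Rightarrow> int" where "\<nu> = (\<lambda>m \<kappa>. if \<kappa> = f m then 1 else 0)"
  have fm: "f m < nt" if "m < N" for m using f that by (simp add: tiling_def)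
  have sum_col: "(\<Sum>\<kappa><nt. int (g \<kappa>) * \<nu> m \<kappa>) = int (g (f m))" if "m < N" for g :: "nat \<Rightarrow> nat" and m
    using fm[OF that] by (simp add: \<nu>_def if_distrib cong: if_cong)
  have "resid N W u \<nu> m nt = 0" "resid N W u \<nu> m (nt + 1) = 0" "resid N W u \<nu> m (nt + 2) = 0"
    if m: "m < N" for m
  proof -
    have slack: "\<nu> m nt = 0" "\<nu> m (nt + 1) = 0" "\<nu> m (nt + 2) = 0"
      using fm[OF m] by (auto simp: \<nu>_def)
    show "resid N W u \<nu> m nt = 0" "resid N W u \<nu> m (nt + 1) = 0" "resid N W u \<nu> m (nt + 2) = 0"
      unfolding resid_constraint[OF W m] of_int_eq_0_iff slack
      using f m sum_col[OF m, of "\<lambda>_. 1"] by (auto simp: sum_col tiling_def less_imp_diff_less)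
  qed
  moreover have "(resid N W u \<nu> m \<kappa>)\<^sup>2 = 1 / 4 ^ Suc (wexp m \<kappa>)" if "m < N" "\<kappa> < nt" for m \<kappa>
    unfolding resid_tile[OF W that] by (simp add: \<nu>_def)
  ultimately have "(\<Sum>m<N. \<Sum>\<kappa><nb. (resid N W u \<nu> m \<kappa>)\<^sup>2) = (\<Sum>m<N. \<Sum>\<kappa><nt. 1 / 4 ^ Suc (wexp m \<kappa>))"
    unfolding sum_nb by (intro sum.cong refl) simp
  also have "\<dots> \<le> 1" unfolding weight_sum by simp
  finally show "mitr_of N W u \<in> mitr_nonempty" unfolding mitr_of_nonempty_iff_resid by blast
next
  assume "mitr_of N W u \<in> mitr_nonempty"
  then obtain \<nu> where le: "(\<Sum>m<N. \<Sum>\<kappa><nb. (resid N W u \<nu> m \<kappa>)\<^sup>2) \<le> 1"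
    unfolding mitr_of_nonempty_iff_resid by blast
  define base :: "nat \<Rightarrow> nat \<Rightarrow> real" where "base m \<kappa> = (if \<kappa> < nt then 1 / 4 ^ Suc (wexp m \<kappa>)
      else 0)" for m \<kappa>
  define ex where "ex m \<kappa> = (resid N W u \<nu> m \<kappa>)\<^sup>2 - base m \<kappa>" for m \<kappa>
  have odd_sq: "(1 :: int) \<le> (2 * z - 1)\<^sup>2" for z :: int
  proof -
    have "2 * z - 1 \<noteq> 0" by presburger
    then show ?thesis by (simp add: int_one_le_iff_zero_less)
  qed
  have ex_nonneg: "0 \<le> ex m \<kappa>" if "m < N" for m \<kappa>
  proof (cases "\<kappa> < nt")
    case True
    have "(1 :: real) \<le> (of_int (2 * \<nu> m \<kappa> - 1))\<^sup>2"
      using odd_sq[of "\<nu> m \<kappa>"] by (metis of_int_1_le_iff of_int_power)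
    then show ?thesis
      using True unfolding ex_def base_def resid_tile[OF W that True]
      by (simp add: divide_right_mono)
  qed (simp add: ex_def base_def)
  have "(\<Sum>m<N. \<Sum>\<kappa><nb. base m \<kappa>) = 1 - 1 / 4 ^ (N * K')"
    unfolding weight_sum[symmetric] sum_nb by (simp add: base_def)
  with le have "(\<Sum>m<N. \<Sum>\<kappa><nb. ex m \<kappa>) \<le> 1 / 4 ^ (N * K')"
    unfolding ex_def sum_subtractf by simp
  moreover have "ex m \<kappa> \<le> (\<Sum>m<N. \<Sum>\<kappa><nb. ex m \<kappa>)" if "m < N" "\<kappa> < nb" for m \<kappa>
  proof -
    have "ex m \<kappa> \<le> (\<Sum>\<kappa><nb. ex m \<kappa>)"
      using that ex_nonneg by (intro member_le_sum) auto
    also have "\<dots> \<le> (\<Sum>m<N. \<Sum>\<kappa><nb. ex m \<kappa>)"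
      using that ex_nonneg by (intro member_le_sum[of m "{..<N}" "\<lambda>m. \<Sum>\<kappa><nb. ex m \<kappa>"] sum_nonneg)
          auto
    finally show ?thesis .
  qed
  ultimately have ex_le: "ex m \<kappa> \<le> 1 / 4 ^ (N * K')" if "m < N" "\<kappa> < nb" for m \<kappa>
    using that by (meson order_trans)
  have bool: "\<nu> m \<kappa> \<in> {0, 1}" if "m < N" "\<kappa> < nt" for m \<kappa>
  proof (rule ccontr)
    assume "\<nu> m \<kappa> \<notin> {0, 1}"
    then have "\<nu> m \<kappa> \<ge> 2 \<or> \<nu> m \<kappa> \<le> -1" by auto
    then have "3 \<le> \<bar>2 * \<nu> m \<kappa> - 1\<bar>" by linarith
    then have "3\<^sup>2 \<le> \<bar>2 * \<nu> m \<kappa> - 1\<bar>\<^sup>2" by (intro power_mono) auto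
    then have "(9 :: real) \<le> (of_int (2 * \<nu> m \<kappa> - 1))\<^sup>2"
    proof -
      assume "3\<^sup>2 \<le> \<bar>2 * \<nu> m \<kappa> - 1\<bar>\<^sup>2"
      then have "9 \<le> (2 * \<nu> m \<kappa> - 1)\<^sup>2" by simp
      then have "of_int 9 \<le> (of_int ((2 * \<nu> m \<kappa> - 1)\<^sup>2) :: real)" by (simp only: of_int_le_iff)
      then show ?thesis by (simp only: of_int_power of_int_numeral)
    qed
    then have "8 / 4 ^ Suc (wexp m \<kappa>) \<le> ex m \<kappa>"
      unfolding ex_def base_def resid_tile[OF W that] using that(2)
      by (simp add: divide_simps)
    moreover have "ex m \<kappa> \<le> 1 / 4 ^ (N * K')" using ex_le that nb_gt(1) by simp
    \<comment> \<open>The gap is no larger than the smallest weight, whose exponent is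
      \<open>N * K'\<close>.\<close>
    moreover have "1 / 4 ^ (N * K') \<le> (1 :: real) / 4 ^ Suc (wexp m \<kappa>)"
      using wexp_less[OF that(1) K] by (intro divide_left_mono power_increasing) auto
    ultimately have "8 / 4 ^ Suc (wexp m \<kappa>) \<le> (1 :: real) / 4 ^ Suc (wexp m \<kappa>)" by linarith
    then show False by (simp add: divide_simps)
  qed
  have int_zero: "z = 0" if "m < N" "\<kappa> < nb" "\<not> \<kappa> < nt" "resid N W u \<nu> m \<kappa> = of_int z" for m \<kappa> z
  proof (rule ccontr)
    assume "z \<noteq> 0"
    then have "(1 :: int) \<le> z\<^sup>2" by (simp add: int_one_le_iff_zero_less)
    then have "(1 :: real) \<le> (of_int z)\<^sup>2" by (metis of_int_1_le_iff of_int_power)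
    then have "1 \<le> ex m \<kappa>" using that by (simp add: ex_def base_def)
    moreover have "(1 :: real) / 4 ^ (N * K') < 1"
      using K that(1) by (simp add: one_less_power)
    ultimately show False using ex_le[OF that(1,2)] by linarith
  qed
  have slack: "z = 0" if "z + int q * s = 0" "\<bar>z\<bar> < int q" for z s
  proof -
    have "int q dvd z" using that(1) by (metis add_eq_0_iff2 dvd_minus_iff dvd_triv_left)
    then show ?thesis using that(2) by (metis abs_dvd_iff dvd_imp_le_int abs_of_nat
        linorder_not_less)
  qed
  have one: "\<exists>!\<kappa>. \<kappa> < nt \<and> \<nu> m \<kappa> = 1" if m: "m < N" for m
  proof -
    have sum_card: "(\<Sum>\<kappa><nt. \<nu> m \<kappa>) = int (card {\<kappa>. \<kappa> < nt \<and> \<nu> m \<kappa> = 1})"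
    proof -
      have "(\<Sum>\<kappa><nt. \<nu> m \<kappa>) = (\<Sum>\<kappa><nt. if \<nu> m \<kappa> = 1 then 1 else 0)"
        using bool[OF m] by (intro sum.cong) auto
      also have "\<dots> = int (card ({..<nt} \<inter> {\<kappa>. \<nu> m \<kappa> = 1}))" by (simp add: sum.If_cases)
      also have "{..<nt} \<inter> {\<kappa>. \<nu> m \<kappa> = 1} = {\<kappa>. \<kappa> < nt \<and> \<nu> m \<kappa> = 1}" by auto
      finally show ?thesis .
    qed
    have "card {\<kappa>. \<kappa> < nt \<and> \<nu> m \<kappa> = 1} \<le> card {..<nt}" by (intro card_mono) auto
    \<comment> \<open>The sum is between 0 and \<open>nt\<close>. An empty choice gives -1, which is
      excluded because \<open>nt_pos\<close> and \<open>nt < q\<close> yield 1 < q.\<close>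
    then have "\<bar>(\<Sum>\<kappa><nt. \<nu> m \<kappa>) - 1\<bar> < int q" unfolding sum_card using q nt_pos[OF K] by simp
    with int_zero[OF m nb_gt(1) _ resid_constraint(1)[OF W m]] slack
    have "(\<Sum>\<kappa><nt. \<nu> m \<kappa>) - 1 = 0" by blast
    then have "card {\<kappa>. \<kappa> < nt \<and> \<nu> m \<kappa> = 1} = 1" unfolding sum_card by simp
    then obtain \<kappa> where "{\<kappa>. \<kappa> < nt \<and> \<nu> m \<kappa> = 1} = {\<kappa>}" by (auto simp: card_1_singleton_iff)
    then show ?thesis by (intro ex1I[of _ \<kappa>]) blast+
  qed
  define f where "f m = (THE \<kappa>. \<kappa> < nt \<and> \<nu> m \<kappa> = 1)" for m
  have f: "f m < nt" "\<nu> m (f m) = 1" if "m < N" for m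
    using theI'[OF one[OF that]] by (auto simp: f_def)
  have sum_col: "(\<Sum>\<kappa><nt. int (g \<kappa>) * \<nu> m \<kappa>) = int (g (f m))" if "m < N" for g :: "nat \<Rightarrow> nat" and m
  proof -
    have "\<nu> m \<kappa> = 0" if "\<kappa> < nt" "\<kappa> \<noteq> f m" for \<kappa>
      using one[OF \<open>m < N\<close>] f[OF \<open>m < N\<close>] bool[OF \<open>m < N\<close>] that by blast
    then have "(\<Sum>\<kappa><nt. int (g \<kappa>) * \<nu> m \<kappa>) = (\<Sum>\<kappa>\<in>{f m}. int (g \<kappa>) * \<nu> m \<kappa>)"
      using f[OF that] by (intro sum.mono_neutral_right) auto
    then show ?thesis using f[OF that] by simp
  qed
  have "right (f m) = (if m + 1 < N then left (f (m + 1)) else 0)" if m: "m < N" for m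
  proof -
    let ?r = "if m + 1 < N then left (f (m + 1)) else 0"
    have "int (right (f m)) - int ?r + int q * \<nu> m (nt + 1) = 0"
      using int_zero[OF m nb_gt(2) _ resid_constraint(2)[OF W m]]
          m by (auto simp: sum_col split: if_splits)
    moreover have "\<bar>int (right (f m)) - int ?r\<bar> < int q"
      using col[OF f(1)[OF m]] col[OF f(1)[of "m + 1"]] q by auto
    ultimately have "int (right (f m)) - int ?r = 0" by (rule slack)
    then show ?thesis by simp
  qed
  moreover have "lower (f m) = (if W \<le> m then upper (f (m - W)) else u m)" if m: "m < N" for m
  proof -
    let ?r = "if W \<le> m then upper (f (m - W)) else u m"
    have "int (lower (f m)) - int ?r + int q * \<nu> m (nt + 2) = 0"
      using int_zero[OF m nb_gt(3) _ resid_constraint(3)[OF W m]] m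
      by (auto simp: sum_col less_imp_diff_less split: if_splits)
    moreover have "\<bar>int (lower (f m)) - int ?r\<bar> < int q"
      using col[OF f(1)[OF m]] col[OF f(1)[OF less_imp_diff_less[OF m, of W]]] q u[of m] m by auto
    ultimately have "int (lower (f m)) - int ?r = 0" by (rule slack)
    then show ?thesis by simp
  qed
  ultimately show "\<exists>f. tiling N W u f" using f(1) unfolding tiling_def by blast
qed

end

section \<open>Computing the reduction\<close>

lemma nat_bits_pow2: "nat_bits (2 ^ e) = replicate e False @ [True]"
  by (induction e) (simp_all add: nat_bits.simps)

lemma quotient_of_int_pow2: "odd z \<Longrightarrow> quotient_of (of_int z / 2 ^ e) = (z, 2 ^ e)"
proof -
  assume "odd z"
  have "(of_int z / 2 ^ e :: rat) = Rat.Fract z (2 ^ e)"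
    by (simp add: Fract_of_int_quotient)
  then show ?thesis
    using \<open>odd z\<close> by (simp add: quotient_of_Fract Rat.normalize_stable coprime_commute)
qed

text \<open>The \<open>e\<close> zero digits of \<open>2 ^ e\<close> as \<open>enc_nat\<close>
  writes them, each announced by \<open>True\<close>. Adding exponents means concatenation, so a
  loop can write the digits without computing the exponent.\<close>

definition pow2_bits :: "nat \<Rightarrow> bool list" where
  "pow2_bits e = concat (replicate e [True, False])"

lemma pow2_bits_add: "pow2_bits (a + b) = pow2_bits a @ pow2_bits b"
  by (simp add: pow2_bits_def replicate_add)

text \<open>Oddness keeps the fraction in lowest terms, so the denominator is \<open>2 ^ e\<close>
  itself. The bits around \<open>pow2_bits e\<close> are its sign, its leading digit and the end
  mark.\<close>

lemma enc_rat_int_pow2: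
  "odd z \<Longrightarrow> enc_rat (of_int z / 2 ^ e) = enc_int z @ False # pow2_bits e @ [True, True, False]"
  by (simp add: enc_rat_def quotient_of_int_pow2 enc_int_def enc_nat_def nat_power_eq nat_bits_pow2
      enc_list_def pow2_bits_def map_replicate)

definition rat_bits :: "rat \<Rightarrow> bool list" where
  "rat_bits r = True # enc_rat r"

lemma concat_map_upt_mult:
  "concat (map f [0..<N * B]) = concat (map (\<lambda>m. concat (map (\<lambda>\<kappa>. f (m * B + \<kappa>)) [0..<B])) [0..<N])"
proof (induction N)
  case (Suc N)
  have "[0..<Suc N * B] = [0..<N * B] @ map (\<lambda>\<kappa>. N * B + \<kappa>) [0..<B]"
    using upt_add_eq_append[of 0 "N * B" B] map_add_upt[of "N * B" B] by (simp add: add.commute)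
  with Suc show ?case by (simp add: o_def)
qed simp

lemma enc_vec_vec: "enc_vec (vec n g) = concat (map (\<lambda>s. rat_bits (g s)) [0..<n]) @ [False]"
proof -
  have "list_of_vec (vec n g) = map g [0..<n]" by (rule nth_equalityI)
      (auto simp: list_of_vec_index)
  then show ?thesis by (simp add: enc_vec_def enc_list_def rat_bits_def o_def)
qed

locale reduction = tile_set K' q left right lower upper + program V out
  for K' q left right lower upper V out +
  fixes c d :: nat and icol :: "nat \<Rightarrow> nat"
begin

definition block :: "nat \<Rightarrow> nat \<Rightarrow> nat \<Rightarrow> nat \<Rightarrow> bool list" where
  "block W m \<kappa> m' = concat (map (\<lambda>\<kappa>'. rat_bits (entry W m \<kappa> m' \<kappa>')) [0..<nb])"

definition row :: "nat \<Rightarrow> nat \<Rightarrow> nat \<Rightarrow> nat \<Rightarrow> bool list" where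
  "row N W m \<kappa> = True # concat (map (block W m \<kappa>) [0..<N]) @ [False]"

lemma enc_mitr_of:
  "enc_mitr (mitr_of N W u) = enc_nat (N * nb) @
     concat (map (\<lambda>m. concat (map (row N W m) [0..<nb])) [0..<N]) @ [False] @
     concat (map (\<lambda>m. concat (map (\<lambda>\<kappa>. rat_bits (offset W u m \<kappa>)) [0..<nb])) [0..<N]) @ [False]"
proof -
  have "enc_vec (vec (N * nb) (\<lambda>s. entry W m \<kappa> (s div nb) (s mod nb))) =
      concat (map (block W m \<kappa>) [0..<N]) @ [False]" for m \<kappa>
    unfolding enc_vec_vec concat_map_upt_mult block_def
    by (auto intro!: arg_cong[of _ _ concat] simp: cell_index)
  then have "True # enc_vec (vec (N * nb) (\<lambda>s. entry W ((m * nb + \<kappa>) div nb) ((m * nb + \<kappa>) mod nb)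
      (s div nb) (s mod nb))) =
      row N W m \<kappa>" if "\<kappa> < nb" for m \<kappa>
    using that by (simp add: cell_index row_def)
  then have "enc_list enc_vec (map (\<lambda>r. vec (N * nb) (\<lambda>s. entry W (r div nb) (r mod nb) (s div nb)
      (s mod nb))) [0..<N * nb]) =
      concat (map (\<lambda>m. concat (map (row N W m) [0..<nb])) [0..<N]) @ [False]"
    unfolding enc_list_def map_map o_def concat_map_upt_mult
    by (auto intro!: arg_cong[of _ _ concat])
  moreover have "enc_vec (vec (N * nb) (\<lambda>s. offset W u (s div nb) (s mod nb))) =
      concat (map (\<lambda>m. concat (map (\<lambda>\<kappa>. rat_bits (offset W u m \<kappa>)) [0..<nb])) [0..<N]) @ [False]"
    unfolding enc_vec_vec concat_map_upt_mult
    by (auto intro!: arg_cong[of _ _ concat] simp: cell_index)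
  ultimately show ?thesis by (simp add: mitr_of_def)
qed

text \<open>
  Use of the tapes, where \<open>n\<close> is the input length, \<open>S = (n + c) ^ d\<close> and \<open>N\<close> the number of cells:
  0 the input; 1 and 2 rulers of length \<open>n + c\<close> and \<open>S\<close>; 3 and 4 rulers of length \<open>N\<close>, whose heads
  are at the cells that give the row and the column of the current block; 5 the marks of the nonzero
  blocks; 6 the initial row of the tiling; 7 an auxiliary counter; 8 the dimension, which is halved
  repeatedly for its binary expansion, with the parity on tape 9; \<open>10 + i\<close> a ruler of length
  \<open>(n + c) ^ i\<close>.
\<close>

definition pow_prog :: com where
  "pow_prog = Loop 3 1 (Mv 3 Move_Left ;; emits (pow2_bits K') ;; Mv 7 Move_Right) ;;
     Loop 7 1 (Mv 7 Move_Left ;; Mv 3 Move_Right)"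

definition weight_prog :: "int \<Rightarrow> nat \<Rightarrow> com" where
  "weight_prog z e = emits (True # enc_int z @ [False]) ;; pow_prog ;; emits (pow2_bits e @ [True,
      True, False])"

definition ints_prog :: "(nat \<Rightarrow> int) \<Rightarrow> com" where
  "ints_prog g = emits (concat (map (\<lambda>\<kappa>'. rat_bits (of_int (g \<kappa>'))) [0..<nb]))"

definition own_prog :: "nat \<Rightarrow> com" where
  "own_prog \<kappa> = seqs (map (\<lambda>\<kappa>'. if \<kappa>' = \<kappa> \<and> \<kappa> < nt then weight_prog 1 (\<kappa> mod K')
      else emits (rat_bits (of_int (own \<kappa> \<kappa>')))) [0..<nb])"

definition block_prog :: "nat \<Rightarrow> com" where
  "block_prog \<kappa> = Cond 5 1 (own_prog \<kappa>) (Cond 5 2 (ints_prog (prv \<kappa>)) (Cond 5 3 (ints_prog (nxt \<kappa>))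
     (ints_prog (\<lambda>_. 0))))"

definition row_prog :: "nat \<Rightarrow> com" where
  "row_prog \<kappa> = emits [True] ;; For 4 (block_prog \<kappa> ;; Mv 5 Move_Right) ;; For 4 (Mv 5 Move_Left)
      ;; emits [False]"

definition basis_prog :: com where
  "basis_prog = For 3 (seqs (map row_prog [0..<nb]) ;; Mv 5 Move_Left) ;; emits [False]"

text \<open>\<open>icol s\<close> is a constant of the program, so there is one case for each class
  1 to 8; the blank beyond the first row yields 0.\<close>

definition init_prog :: com where
  "init_prog = foldr (\<lambda>s. Cond 6 s (emits (rat_bits (- of_nat (icol s))))) [1..<9]
      (emits (rat_bits 0))"

definition offset_prog :: "nat \<Rightarrow> com" where
  "offset_prog \<kappa> = (if \<kappa> < nt then weight_prog (- 1) (Suc (\<kappa> mod K')) else if \<kappa> =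
      nt then emits (rat_bits (- 1))
     else if \<kappa> = nt + 2 then init_prog else emits (rat_bits 0))"

definition target_prog :: com where
  "target_prog = For 3 (seqs (map offset_prog [0..<nb]) ;; Mv 6 Move_Right) ;; emits [False]"

text \<open>Repeated halving gives the digits in the order of \<open>nat_bits\<close>. Every two
  steps down on tape 8 count as one step up on tape 7; reaching the origin after the first of the
  two reveals an odd number.\<close>

definition bits_prog :: com where
  "bits_prog =
     Loop 8 1 (Put 9 0 ;; Loop 8 1 (Mv 8 Move_Left ;; Cond 8 1 (Put 9 1) (Mv 8 Move_Left ;;
         Mv 7 Move_Right)) ;;
       Cond 9 1 (emits [True, True]) (emits [True, False]) ;;
       Loop 7 1 (Mv 7 Move_Left ;; Mv 8 Move_Right)) ;;
     emits [False]"

end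

text \<open>In the basis vectors of cell \<open>m\<close> only the blocks of the cells \<open>m\<close>, \<open>m - 1\<close> and
  \<open>m + W\<close> are nonzero. These marks, read from position \<open>- m\<close> on, announce them.\<close>

definition diag_cells :: "nat \<Rightarrow> int \<Rightarrow> nat" where
  "diag_cells W i = (if i = 0 then 1 else if i = - 1 then 2 else if i = int W then 3 else 0)"

section \<open>Correctness of the programs that write the instance\<close>

locale reduction_run = reduction K' q left right lower upper V out c d icol
  for K' q left right lower upper V out c d icol +
  fixes N W :: nat
  assumes out: "out \<ge> 11" and K': "0 < K'" and N: "0 < N" and W: "0 < W" and V: "N * nb \<le> V"
begin

lemma N_le_V: "N \<le> V"
proof -
  have "N * 1 \<le> N * nb" using nb_pos by (intro mult_le_mono2) simp
  with V show ?thesis unfolding mult_1_right by (rule order_trans[rotated])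
qed

text \<open>The index \<open>m\<close> exists only as head position on tape 3. Walking back to the
  origin writes K' zero digits per step; tape 7 records the steps, so that the head can
  return.\<close>

lemma tr_pow_prog:
  assumes "\<sigma> 3 = ruler N (int m)" "\<sigma> 7 = counter 0" "m < N"
  shows "tr pow_prog \<sigma> \<sigma> (pow2_bits (K' * m))"
proof -
  define \<tau> where "\<tau> i = \<sigma>(3 := ruler N (int m - int i), 7 := counter (int i))" for i
  have \<tau>: "\<tau> i 3 = ruler N (int m - int i)" "\<tau> i 7 = counter (int i)" for i
    by (simp_all add: \<tau>_def)
  have \<tau>0: "\<tau> 0 = \<sigma>" using assms by (auto simp: \<tau>_def fun_eq_iff)
  have "tr (Mv 3 Move_Left ;; emits (pow2_bits K') ;; Mv 7 Move_Right) (\<tau> i) (\<tau> (Suc i))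
      (pow2_bits K')" for i
  proof -
    have "tr (Mv 3 Move_Left) (\<tau> i) ((\<tau> i)(3 := ruler N (int m - int (Suc i)))) []"
      by (rule trD[OF tr_Mv]) (use out in \<open>auto simp: \<tau>_def ruler_def fun_eq_iff\<close>)
    moreover have "tr (emits (pow2_bits K') ;; Mv 7 Move_Right) ((\<tau> i)(3 :=
        ruler N (int m - int (Suc i))))
        (\<tau> (Suc i)) (pow2_bits K' @ [])"
      by (intro tr_Seq[OF tr_emits] trD[OF tr_Mv]) (use out in \<open>auto simp: \<tau>_def counter_def
          fun_eq_iff\<close>)
    ultimately show ?thesis using tr_Seq_silent by simp
  qed
  then have 1: "tr (Loop 3 1 (Mv 3 Move_Left ;; emits (pow2_bits K') ;; Mv 7 Move_Right)) (\<tau> 0)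
      (\<tau> m)
      (concat (map (\<lambda>_. pow2_bits K') [0..<m]))"
    by (intro tr_Loop) (use out assms(3) N_le_V in \<open>auto simp: \<tau> head_symbol_ruler\<close>)
  have "tr (Mv 7 Move_Left ;; Mv 3 Move_Right) (\<tau> (m - i)) (\<tau> (m - Suc i)) []" if "i < m" for i
  proof -
    have "tr (Mv 7 Move_Left) (\<tau> (m - i)) ((\<tau> (m - i))(7 := counter (int (m - Suc i)))) []"
      by (rule trD[OF tr_Mv]) (use out that in \<open>auto simp: \<tau>_def counter_def fun_eq_iff\<close>)
    moreover have "tr (Mv 3 Move_Right) ((\<tau> (m - i))(7 := counter (int (m - Suc i))))
        (\<tau> (m - Suc i)) []"
      by (rule trD[OF tr_Mv]) (use out that in \<open>auto simp: \<tau>_def ruler_def fun_eq_iff\<close>)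
    ultimately show ?thesis by (rule tr_Seq_silent)
  qed
  then have "tr (Loop 7 1 (Mv 7 Move_Left ;; Mv 3 Move_Right)) (\<tau> (m - 0)) (\<tau> (m - m)) []"
    by (intro tr_Loop_silent[where \<sigma> = "\<lambda>i. \<tau> (m - i)"])
      (use out assms(3) N_le_V in \<open>auto simp: \<tau> head_symbol_counter\<close>)
  moreover have "concat (map (\<lambda>_. pow2_bits K') [0..<m]) = pow2_bits (K' * m)"
    by (induction m) (auto simp: pow2_bits_def[of 0] simp: add.commute simp flip: pow2_bits_add)
  ultimately show ?thesis using tr_Seq[OF 1, of _ _ "[]"] by (simp add: pow_prog_def \<tau>0)
qed

lemma tr_weight_prog:
  assumes "\<sigma> 3 = ruler N (int m)" "\<sigma> 7 = counter 0" "m < N" "odd z"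
  shows "tr (weight_prog z e) \<sigma> \<sigma> (rat_bits (of_int z / 2 ^ (K' * m + e)))"
proof -
  have "rat_bits (of_int z / 2 ^ (K' * m + e)) =
      (True # enc_int z @ [False]) @ pow2_bits (K' * m) @ (pow2_bits e @ [True, True, False])"
    unfolding rat_bits_def enc_rat_int_pow2[OF assms(4)] by (simp add: pow2_bits_add)
  then show ?thesis
    unfolding weight_prog_def by (simp only: tr_Seq[OF tr_emits tr_Seq[OF tr_pow_prog[OF
        assms(1-3)] tr_emits]])
qed

lemma tr_ints_prog:
  assumes "\<And>\<kappa>'. \<kappa>' < nb \<Longrightarrow> of_int (g \<kappa>') = entry W m \<kappa> m' \<kappa>'"
  shows "tr (ints_prog g) \<sigma> \<sigma> (block W m \<kappa> m')"
proof -
  have "map (\<lambda>\<kappa>'. rat_bits (of_int (g \<kappa>'))) [0..<nb] = map (\<lambda>\<kappa>'. rat_bits (entry W m \<kappa> m' \<kappa>'))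
      [0..<nb]"
    using assms by simp
  then show ?thesis unfolding ints_prog_def block_def using tr_emits by metis
qed

lemma tr_seqs_map:
  assumes "\<And>i. i < n \<Longrightarrow> tr (g i) \<sigma> \<sigma> (ys i)"
  shows "tr (seqs (map g [0..<n])) \<sigma> \<sigma> (concat (map ys [0..<n]))"
  using tr_seqs[of "map g [0..<n]" "\<lambda>_. \<sigma>" ys] assms by simp

lemma tr_own_prog:
  assumes "\<sigma> 3 = ruler N (int m)" "\<sigma> 7 = counter 0" "m < N"
  shows "tr (own_prog \<kappa>) \<sigma> \<sigma> (block W m \<kappa> m)"
  unfolding own_prog_def block_def
proof (rule tr_seqs_map)
  fix \<kappa>'
  show "tr (if \<kappa>' = \<kappa> \<and> \<kappa> < nt then weight_prog 1 (\<kappa> mod K') else emits (rat_bits (of_int (own \<kappa>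
      \<kappa>'))))
      \<sigma> \<sigma> (rat_bits (entry W m \<kappa> m \<kappa>'))"
    using tr_weight_prog[OF assms, of 1 "\<kappa> mod K'"] by (simp add: entry_def wexp_def tr_emits)
qed

lemma tr_block_prog:
  assumes "\<sigma> 3 = ruler N (int m)" "\<sigma> 7 = counter 0" "m < N" "\<sigma> 5 = (int m' - int m, diag_cells W)"
  shows "tr (block_prog \<kappa>) \<sigma> \<sigma> (block W m \<kappa> m')"
proof -
  have sym5: "sym \<sigma> 5 = diag_cells W (int m' - int m)" using assms(4) by simp
  consider "m' = m" | "m' + 1 = m" | "m' = m + W" | "m' \<noteq> m" "m' + 1 \<noteq> m" "m' \<noteq> m + W" by blast
  then have "tr (if sym \<sigma> 5 = 1 then own_prog \<kappa> else if sym \<sigma> 5 = 2 then ints_prog (prv \<kappa>)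
      else if sym \<sigma> 5 = 3 then ints_prog (nxt \<kappa>) else ints_prog (\<lambda>_. 0)) \<sigma> \<sigma> (block W m \<kappa> m')"
  proof cases
    case 1
    then show ?thesis using tr_own_prog[OF assms(1-3)] sym5 by (simp add: diag_cells_def)
  next
    case 2
    then have "sym \<sigma> 5 = 2" unfolding sym5 by (auto simp: diag_cells_def)
    with 2 show ?thesis by (simp add: tr_ints_prog entry_def)
  next
    case 3
    then have "sym \<sigma> 5 = 3" using W unfolding sym5 by (auto simp: diag_cells_def)
    with 3 W show ?thesis by (simp add: tr_ints_prog entry_def)
  next
    case 4
    then have "sym \<sigma> 5 = 0" unfolding sym5 by (auto simp: diag_cells_def)
    with 4 show ?thesis by (simp add: tr_ints_prog entry_def)
  qed
  then show ?thesis
    unfolding block_prog_def using out by (auto intro!: tr_Cond split: if_splits)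
qed

lemma tr_row_prog:
  assumes "\<sigma> 3 = ruler N (int m)" "\<sigma> 7 = counter 0" "m < N" "\<sigma> 5 = (- int m, diag_cells W)" "\<sigma> 4 =
      ruler N 0"
  shows "tr (row_prog \<kappa>) \<sigma> \<sigma> (row N W m \<kappa>)"
proof -
  define h where "h i = \<sigma>(5 := (int i - int m, diag_cells W))" for i
  have h: "(h 0)(4 := ruler N 0) = \<sigma>" using assms(4,5) by (auto simp: h_def fun_eq_iff)
  have "tr (For 4 (block_prog \<kappa> ;; Mv 5 Move_Right)) ((h 0)(4 := ruler N 0)) ((h N)(4 := ruler N 0))
      (concat (map (block W m \<kappa>) [0..<N]))"
  proof (rule tr_For)
    fix i assume "i < N"
    have "tr (block_prog \<kappa>) ((h i)(4 := ruler N (int i))) ((h i)(4 := ruler N (int i)))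
        (block W m \<kappa> i)"
      by (rule tr_block_prog) (use assms in \<open>auto simp: h_def\<close>)
    moreover have "tr (Mv 5 Move_Right) ((h i)(4 := ruler N (int i))) ((h (Suc i))(4 :=
        ruler N (int i))) []"
      by (rule trD[OF tr_Mv]) (use out in \<open>auto simp: h_def fun_eq_iff\<close>)
    ultimately show "tr (block_prog \<kappa> ;; Mv 5 Move_Right) ((h i)(4 := ruler N (int i)))
        ((h (Suc i))(4 := ruler N (int i))) (block W m \<kappa> i)" using tr_Seq by fastforce
  qed (use out N N_le_V in auto)
  \<comment> \<open>A second pass over the column ruler takes tape 5 back to \<open>- int m\<close>,
    where the next row of the same cell expects it.\<close>
  moreover have "tr (For 4 (Mv 5 Move_Left)) ((h N)(4 := ruler N 0)) \<sigma> []"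
  proof (rule tr_advances)
    show "advances (For 4 (Mv 5 Move_Left)) 5 (- int N) {(4, N)}"
      by (rule advances_For[where Rs = "{}" and a = "- 1" and L = N], rule advances_Mv)
        (use out N N_le_V in auto)
  qed (use assms(4,5) in \<open>auto simp: h_def fun_eq_iff\<close>)
  ultimately have "tr (For 4 (block_prog \<kappa> ;; Mv 5 Move_Right) ;; For 4 (Mv 5 Move_Left) ;;
      emits [False]) \<sigma> \<sigma>
      (concat (map (block W m \<kappa>) [0..<N]) @ [] @ [False])"
    unfolding h by (meson tr_Seq tr_emits)
  from tr_Seq[OF tr_emits[of "[True]"] this] show ?thesis unfolding row_prog_def row_def by (simp
      del: One_nat_def)
qed

lemma tr_basis_prog:
  assumes "\<sigma> 3 = ruler N 0" "\<sigma> 7 = counter 0" "\<sigma> 5 = (0, diag_cells W)" "\<sigma> 4 = ruler N 0"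
  shows "tr basis_prog \<sigma> (\<sigma>(5 := (- int N, diag_cells W)))
    (concat (map (\<lambda>m. concat (map (row N W m) [0..<nb])) [0..<N]) @ [False])"
proof -
  define h where "h m = \<sigma>(5 := (- int m, diag_cells W))" for m
  have "tr (For 3 (seqs (map row_prog [0..<nb]) ;; Mv 5 Move_Left)) ((h 0)(3 := ruler N 0))
      ((h N)(3 := ruler N 0))
      (concat (map (\<lambda>m. concat (map (row N W m) [0..<nb])) [0..<N]))"
  proof (rule tr_For)
    fix m assume "m < N"
    have "tr (seqs (map row_prog [0..<nb])) ((h m)(3 := ruler N (int m))) ((h m)(3 :=
        ruler N (int m)))
        (concat (map (row N W m) [0..<nb]))"
      by (rule tr_seqs_map, rule tr_row_prog) (use assms \<open>m < N\<close> in \<open>auto simp: h_def\<close>)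
    moreover have "tr (Mv 5 Move_Left) ((h m)(3 := ruler N (int m))) ((h (Suc m))(3 :=
        ruler N (int m))) []"
      by (rule trD[OF tr_Mv]) (use out in \<open>auto simp: h_def fun_eq_iff\<close>)
    ultimately show "tr (seqs (map row_prog [0..<nb]) ;; Mv 5 Move_Left) ((h m)(3 :=
        ruler N (int m)))
        ((h (Suc m))(3 := ruler N (int m))) (concat (map (row N W m)
            [0..<nb]))" using tr_Seq by fastforce
  qed (use out N N_le_V in auto)
  moreover have "(h 0)(3 := ruler N 0) = \<sigma>" "(h N)(3 := ruler N 0) = \<sigma>(5 := (- int N,
      diag_cells W))"
    using assms by (auto simp: h_def fun_eq_iff)
  ultimately show ?thesis unfolding basis_prog_def by (simp add: tr_Seq tr_emits)
qed

lemma tr_init_prog: "tr init_prog \<sigma> \<sigma> (rat_bits (if sym \<sigma> 6 \<in> {1..<9} then - of_nat (icol (sym \<sigma>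
    6)) else 0))"
proof -
  have "tr (foldr (\<lambda>s. Cond 6 s (emits (rat_bits (- of_nat (icol s))))) ss (emits (rat_bits 0))) \<sigma> \<sigma>
      (rat_bits (if sym \<sigma> 6 \<in> set ss then - of_nat (icol (sym \<sigma> 6)) else 0))" for ss
    by (induction ss) (use out in \<open>auto intro!: tr_Cond simp: tr_emits\<close>)
  from this[of "[1..<9]"] show ?thesis
    unfolding init_prog_def set_upt .
qed

lemma tr_target_prog:
  assumes "\<sigma> 3 = ruler N 0" "\<sigma> 7 = counter 0" "\<sigma> 6 = (0, t)"
    and t: "\<And>m. m < N \<Longrightarrow> t (int m) = (if m < W then cl m else 0)" "\<And>m. m < W \<Longrightarrow> cl m \<in> {1..<9}"
  shows "tr target_prog \<sigma> (\<sigma>(6 := (int N, t)))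
    (concat (map (\<lambda>m. concat (map (\<lambda>\<kappa>. rat_bits (offset W (\<lambda>m. icol (cl m)) m \<kappa>)) [0..<nb]))
        [0..<N]) @ [False])"
proof -
  define h where "h m = \<sigma>(6 := (int m, t))" for m
  have "tr (For 3 (seqs (map offset_prog [0..<nb]) ;; Mv 6 Move_Right)) ((h 0)(3 := ruler N 0))
      ((h N)(3 := ruler N 0))
      (concat (map (\<lambda>m. concat (map (\<lambda>\<kappa>. rat_bits (offset W (\<lambda>m. icol (cl m)) m \<kappa>)) [0..<nb]))
          [0..<N]))"
  proof (rule tr_For)
    fix m assume m: "m < N"
    let ?\<tau> = "(h m)(3 := ruler N (int m))"
    have "tr (offset_prog \<kappa>) ?\<tau> ?\<tau> (rat_bits (offset W (\<lambda>m. icol (cl m)) m \<kappa>))" for \<kappa>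
    proof -
      have "tr (weight_prog (- 1) (Suc (\<kappa> mod K'))) ?\<tau> ?\<tau> (rat_bits (of_int (- 1) / 2 ^ (K' * m +
          Suc (\<kappa> mod K'))))"
        using assms m by (intro tr_weight_prog) (auto simp: h_def)
      moreover have "sym ?\<tau> 6 = (if m < W then cl m else 0)" using t(1)[OF m] by (simp add: h_def)
      then have "tr init_prog ?\<tau> ?\<tau> (rat_bits (if m < W then - of_nat (icol (cl m)) else 0))"
        using tr_init_prog[of ?\<tau>] t(2)[of m] by (auto split: if_splits)
      ultimately show ?thesis by (simp add: offset_prog_def offset_def wexp_def tr_emits)
    qed
    then have "tr (seqs (map offset_prog [0..<nb])) ?\<tau> ?\<tau>
        (concat (map (\<lambda>\<kappa>. rat_bits (offset W (\<lambda>m. icol (cl m)) m \<kappa>)) [0..<nb]))"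
      by (intro tr_seqs_map)
    moreover have "tr (Mv 6 Move_Right) ?\<tau> ((h (Suc m))(3 := ruler N (int m))) []"
      by (rule trD[OF tr_Mv]) (use out in \<open>auto simp: h_def fun_eq_iff\<close>)
    ultimately show "tr (seqs (map offset_prog [0..<nb]) ;; Mv 6 Move_Right) ?\<tau>
        ((h (Suc m))(3 := ruler N (int m)))
        (concat (map (\<lambda>\<kappa>. rat_bits (offset W (\<lambda>m. icol (cl m)) m \<kappa>))
            [0..<nb]))" using tr_Seq by fastforce
  qed (use out N N_le_V in auto)
  moreover have "(h 0)(3 := ruler N 0) = \<sigma>" "(h N)(3 := ruler N 0) = \<sigma>(6 := (int N, t))"
    using assms by (auto simp: h_def fun_eq_iff)
  ultimately show ?thesis unfolding target_prog_def by (simp add: tr_Seq tr_emits)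
qed

definition parity_tape :: "nat \<Rightarrow> tape" where
  "parity_tape p = (0, (\<lambda>_. 0)(0 := p))"

lemma head_symbol_parity_tape: "head_symbol (parity_tape p) = p"
  by (simp add: parity_tape_def)

lemma tr_halve:
  assumes v: "0 < v" "v \<le> V" and 8: "\<sigma> 8 = counter (int v)" "\<sigma> 9 = parity_tape p" "\<sigma> 7 = counter 0"
  shows "tr (Put 9 0 ;; Loop 8 1 (Mv 8 Move_Left ;; Cond 8 1 (Put 9 1) (Mv 8 Move_Left ;;
      Mv 7 Move_Right)) ;;
       Cond 9 1 (emits [True, True]) (emits [True, False]) ;; Loop 7 1 (Mv 7 Move_Left ;;
           Mv 8 Move_Right))
     \<sigma> (\<sigma>(8 := counter (int (v div 2)), 9 := parity_tape (v mod 2))) [True, odd v]"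
proof -
  \<comment> \<open>The tapes after \<open>i\<close> rounds. Truncated subtraction lets an odd
    \<open>v\<close> reach 0 in round \<open>(v + 1) div 2\<close>; this round only records the
    parity, so tape 7 stops at \<open>v div 2\<close>.\<close>
  define \<tau> where "\<tau> i = \<sigma>(8 := counter (int (v - 2 * i)), 9 :=
      parity_tape (if v < 2 * i then 1 else 0),
      7 := counter (int (min i (v div 2))))" for i
  have \<tau>: "\<tau> i 8 = counter (int (v - 2 * i))" "\<tau> i 9 = parity_tape (if v < 2 * i then 1 else 0)"
      for i
    by (simp_all add: \<tau>_def)
  have 1: "tr (Put 9 0) \<sigma> (\<tau> 0) []"
    by (rule trD[OF tr_Put]) (use out assms in \<open>auto simp: \<tau>_def parity_tape_def fun_eq_iff\<close>)
  have "tr (Mv 8 Move_Left ;; Cond 8 1 (Put 9 1) (Mv 8 Move_Left ;; Mv 7 Move_Right)) (\<tau> i)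
      (\<tau> (Suc i)) []"
    if i: "i < (v + 1) div 2" for i
  proof (rule tr_Seq_silent)
    let ?\<tau> = "(\<tau> i)(8 := counter (int (v - 2 * i) - 1))"
    show "tr (Mv 8 Move_Left) (\<tau> i) ?\<tau> []"
      by (rule trD[OF tr_Mv]) (use out in \<open>auto simp: \<tau>_def counter_def fun_eq_iff\<close>)
    have s: "sym ?\<tau> 8 = 1 \<longleftrightarrow> v = 2 * i + 1" using i by (auto simp: head_symbol_counter)
    show "tr (Cond 8 1 (Put 9 1) (Mv 8 Move_Left ;; Mv 7 Move_Right)) ?\<tau> (\<tau> (Suc i)) []"
    proof (rule tr_Cond)
      show "tr (if sym ?\<tau> 8 = 1 then Put 9 1 else (Mv 8 Move_Left ;; Mv 7 Move_Right))
          ?\<tau> (\<tau> (Suc i)) []"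
      proof (cases "v = 2 * i + 1")
        case True
        have "tr (Put 9 1) ?\<tau> (\<tau> (Suc i)) []"
          by (rule trD[OF tr_Put]) (use out True in \<open>auto simp: \<tau>_def parity_tape_def fun_eq_iff\<close>)
        with True s show ?thesis by simp
      next
        case False
        with i have v2: "2 * i + 2 \<le> v" by linarith
        have "tr (Mv 8 Move_Left) ?\<tau> ((\<tau> i)(8 := counter (int (v - 2 * Suc i)))) []"
          by (rule trD[OF tr_Mv]) (use out v2 in \<open>auto simp: \<tau>_def counter_def fun_eq_iff\<close>)
        moreover have "tr (Mv 7 Move_Right) ((\<tau> i)(8 := counter (int (v - 2 * Suc i))))
            (\<tau> (Suc i)) []"
          by (rule trD[OF tr_Mv]) (use out v2 in \<open>auto simp: \<tau>_def counter_def fun_eq_iff\<close>)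
        ultimately show ?thesis using s False by (simp add: tr_Seq_silent)
      qed
    qed (use out in simp)
  qed
  then have 2: "tr (Loop 8 1 (Mv 8 Move_Left ;; Cond 8 1 (Put 9 1) (Mv 8 Move_Left ;;
      Mv 7 Move_Right)))
      (\<tau> 0) (\<tau> ((v + 1) div 2)) []"
    by (intro tr_Loop_silent) (use out v in \<open>auto simp: \<tau> head_symbol_counter\<close>)
  have par: "\<tau> ((v + 1) div 2) 9 = parity_tape (v mod 2)"
  proof -
    have "v < 2 * ((v + 1) div 2) \<longleftrightarrow> odd v" by presburger
    then show ?thesis by (simp add: \<tau> mod_2_eq_odd)
  qed
  have 3: "tr (Cond 9 1 (emits [True, True]) (emits [True, False])) (\<tau> ((v + 1) div 2)) (\<tau> ((v +
      1) div 2)) [True, odd v]"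
  proof -
    have "sym (\<tau> ((v + 1) div 2)) 9 = v mod 2" unfolding par head_symbol_parity_tape ..
    then show ?thesis by (intro tr_Cond) (use out in \<open>auto simp: tr_emits mod_2_eq_odd\<close>)
  qed
  define \<rho> where "\<rho> i = \<sigma>(8 := counter (int i), 9 := parity_tape (v mod 2), 7 :=
      counter (int (v div 2) - int i))" for i
  have \<rho>: "\<rho> i 7 = counter (int (v div 2) - int i)" for i by (simp add: \<rho>_def)
  have "\<tau> ((v + 1) div 2) = \<rho> 0"
    using par by (auto simp: \<tau>_def \<rho>_def fun_eq_iff)
  moreover have "tr (Mv 7 Move_Left ;; Mv 8 Move_Right) (\<rho> i) (\<rho> (Suc i)) []" for i
  proof -
    have "tr (Mv 7 Move_Left) (\<rho> i) ((\<rho> i)(7 := counter (int (v div 2) - int (Suc i)))) []"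
      by (rule trD[OF tr_Mv]) (use out in \<open>auto simp: \<rho>_def counter_def fun_eq_iff\<close>)
    moreover have "tr (Mv 8 Move_Right) ((\<rho> i)(7 := counter (int (v div 2) - int (Suc i))))
        (\<rho> (Suc i)) []"
      by (rule trD[OF tr_Mv]) (use out in \<open>auto simp: \<rho>_def counter_def fun_eq_iff\<close>)
    ultimately show ?thesis by (rule tr_Seq_silent)
  qed
  then have "tr (Loop 7 1 (Mv 7 Move_Left ;; Mv 8 Move_Right)) (\<rho> 0) (\<rho> (v div 2)) []"
    by (intro tr_Loop_silent) (use out v in \<open>auto simp: \<rho> head_symbol_counter\<close>)
  moreover have "\<rho> (v div 2) = \<sigma>(8 := counter (int (v div 2)), 9 := parity_tape (v mod 2))"
    using 8 by (auto simp: \<rho>_def fun_eq_iff)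
  ultimately have 4: "tr (Loop 7 1 (Mv 7 Move_Left ;; Mv 8 Move_Right)) (\<tau> ((v + 1) div 2))
      (\<sigma>(8 := counter (int (v div 2)), 9 := parity_tape (v mod 2))) []" by (simp only:)
  show ?thesis
    using tr_Seq_silent[OF 1 tr_Seq_silent[OF 2 tr_Seq[OF 3 4]]] by (simp only: append_Nil2)
qed

text \<open>The number of digits is the number of halvings until 0 is reached, hence the number of
  rounds of \<open>bits_prog\<close>.\<close>

lemma nat_bits_less: "i < length (nat_bits v) \<longleftrightarrow> 0 < v div 2 ^ i"
proof (induction v arbitrary: i rule: nat_bits.induct)
  case (1 v)
  then show ?case
    by (cases i) (auto simp: nat_bits.simps[of v] div_mult2_eq)
qed

lemma nat_bits_nth: "i < length (nat_bits v) \<Longrightarrow> nat_bits v ! i = odd (v div 2 ^ i)"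
proof (induction v arbitrary: i rule: nat_bits.induct)
  case (1 v)
  then show ?case
    by (cases i) (auto simp: nat_bits.simps[of v] div_mult2_eq split: if_splits)
qed

lemma length_nat_bits: "length (nat_bits v) \<le> v"
proof (rule ccontr)
  assume "\<not> length (nat_bits v) \<le> v"
  then have "v < length (nat_bits v)" by simp
  then have "0 < v div 2 ^ v" by (simp add: nat_bits_less)
  then show False using less_exp[of v] by simp
qed

lemma tr_bits_prog:
  assumes v: "v \<le> V" and 8: "\<sigma> 8 = counter (int v)" "\<sigma> 9 = blank_tape" "\<sigma> 7 = counter 0"
  shows "\<exists>\<sigma>'. tr bits_prog \<sigma> \<sigma>' (enc_nat v) \<and> (\<forall>j. j \<noteq> 8 \<longrightarrow> j \<noteq> 9 \<longrightarrow> \<sigma>' j = \<sigma> j)"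
proof -
  let ?r = "length (nat_bits v)"
  \<comment> \<open>Tape 9 keeps the parity of the preceding round; the initial value 0 agrees with
    the blank tape.\<close>
  define \<tau> where "\<tau> i = \<sigma>(8 := counter (int (v div 2 ^ i)),
      9 := parity_tape (if i = 0 then 0 else (v div 2 ^ (i - 1)) mod 2))" for i
  have \<tau>: "\<tau> i 8 = counter (int (v div 2 ^ i))" for i by (simp add: \<tau>_def)
  have "tr (Put 9 0 ;; Loop 8 1 (Mv 8 Move_Left ;; Cond 8 1 (Put 9 1) (Mv 8 Move_Left ;;
      Mv 7 Move_Right)) ;;
       Cond 9 1 (emits [True, True]) (emits [True, False]) ;;
       Loop 7 1 (Mv 7 Move_Left ;; Mv 8 Move_Right)) (\<tau> i) (\<tau> (Suc i)) [True, odd (v div 2 ^ i)]"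
    if "i < ?r" for i
  proof -
    have v': "0 < v div 2 ^ i" "v div 2 ^ i \<le> V"
      using that v div_le_dividend[of v "2 ^ i"] by (simp add: nat_bits_less, linarith)
    have e: "\<tau> (Suc i) = (\<tau> i)(8 := counter (int (v div 2 ^ i div 2)), 9 :=
        parity_tape (v div 2 ^ i mod 2))"
      by (simp add: \<tau>_def fun_eq_iff div_mult2_eq[symmetric] mult.commute)
    show ?thesis unfolding e
      by (rule tr_halve[OF v']) (use 8 in \<open>auto simp: \<tau>_def\<close>)
  qed
  then have A: "tr (Loop 8 1 (Put 9 0 ;; Loop 8 1 (Mv 8 Move_Left ;; Cond 8 1 (Put 9 1)
      (Mv 8 Move_Left ;; Mv 7 Move_Right)) ;;
       Cond 9 1 (emits [True, True]) (emits [True, False]) ;;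
       Loop 7 1 (Mv 7 Move_Left ;; Mv 8 Move_Right))) (\<tau> 0) (\<tau> ?r) (concat (map (\<lambda>i. [True,
           odd (v div 2 ^ i)]) [0..<?r]))"
    using out v nat_bits_less[of ?r v] length_nat_bits[of v]
    by (intro tr_Loop) (auto simp: \<tau> head_symbol_counter nat_bits_less)
  have B: "map (\<lambda>i. [True, odd (v div 2 ^ i)]) [0..<?r] = map (\<lambda>b. [True, b]) (nat_bits v)"
    by (rule nth_equalityI) (auto simp: nat_bits_nth)
  have C: "\<tau> 0 = \<sigma>" using 8 by (auto simp: \<tau>_def parity_tape_def blank_tape_def fun_eq_iff)
  have "tr bits_prog \<sigma> (\<tau> ?r) (enc_nat v)"
    unfolding bits_prog_def enc_nat_def enc_list_def
    using tr_Seq[OF A tr_emits[of "[False]"]] unfolding B C .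
  then show ?thesis by (intro exI[of _ "\<tau> ?r"]) (simp add: \<tau>_def)
qed

end

section \<open>Rulers and first row\<close>

lemma word_cells_le: "word_cells w i \<le> 2"
  by (simp add: word_cells_def)

text \<open>Cell \<open>m\<close> of the initial row stands for tape position \<open>m - S - 1\<close>; 7 and 8 mark the ends of the
  row, and 3 is added at the head.\<close>

definition cell_class :: "bool list \<Rightarrow> nat \<Rightarrow> nat \<Rightarrow> nat" where
  "cell_class w S m = (if m = 0 then 7 else if m = 2 * S + 2 then 8
     else 1 + word_cells w (int m - int S - 1) + (if m = S + 1 then 3 else 0))"

context reduction
begin

text \<open>The input tape has no mark at its origin, so rewinding runs to the blank at position -1
  and takes one step back. The constant \<open>c\<close> is positive later on, which keeps the ruler
  nonempty for the empty input.\<close>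

definition base_prog :: com where
  "base_prog = make_ruler 1 (mvs 1 c ;; Loop 0 0 (Mv 0 Move_Right ;; Mv 1 Move_Right) ;;
     Mv 0 Move_Left ;; Loop 0 0 (Mv 0 Move_Left) ;; Mv 0 Move_Right)"

definition powers_prog :: com where
  "powers_prog = make_ruler 10 (Mv 10 Move_Right) ;;
     seqs (map (\<lambda>i. make_ruler (11 + i) (For (10 + i) (For 1 (Mv (11 + i) Move_Right)))) [0..<d])"

text \<open>The length is \<open>S * (2 * S + 3)\<close>. Nested loops cannot share a ruler, which
  explains the second ruler of length S on tape 2.\<close>

definition cells_ruler_prog :: "nat \<Rightarrow> com" where
  "cells_ruler_prog y = make_ruler y (For (10 + d) (For 2 (mvs y 2) ;; mvs y 3))"

definition diag_prog :: com where
  "diag_prog = Put 5 1 ;; Mv 5 Move_Left ;; Put 5 2 ;; Mv 5 Move_Right ;;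
     (For (10 + d) (mvs 5 2) ;; mvs 5 3) ;; Put 5 3 ;; Loop 5 1 (Mv 5 Move_Left)"

text \<open>Computes the middle case of \<open>cell_class\<close>: the input symbols 0, 1, 2 are
  raised by \<open>Suc a\<close>, where \<open>a\<close> is 3 at the head cell and 0
  elsewhere.\<close>

definition copy_prog :: "nat \<Rightarrow> com" where
  "copy_prog a = Cond 0 1 (Put 6 (Suc (Suc a))) (Cond 0 2 (Put 6 (Suc (Suc (Suc a))))
      (Put 6 (Suc a))) ;;
     Mv 0 Move_Right ;; Mv 6 Move_Right"

text \<open>Starting S cells to the left of the input, the positions from -S to S are copied; the
  run is interrupted at 0, where the head cell needs the other shift.\<close>

definition first_row_prog :: com where
  "first_row_prog = For (10 + d) (Mv 0 Move_Left) ;; Put 6 7 ;; Mv 6 Move_Right ;;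
     For (10 + d) (copy_prog 0) ;; copy_prog 3 ;; For (10 + d) (copy_prog 0) ;;
     Put 6 8 ;; Loop 6 7 (Mv 6 Move_Left)"

definition main_prog :: com where
  "main_prog = base_prog ;; powers_prog ;; make_ruler 2 (For (10 + d) (Mv 2 Move_Right)) ;;
     cells_ruler_prog 3 ;; cells_ruler_prog 4 ;; diag_prog ;; first_row_prog ;; Put 7 1 ;;
     Put 8 1 ;; For 3 (mvs 8 nb) ;; bits_prog ;; basis_prog ;; target_prog"

end

locale setup_run = reduction K' q left right lower upper V out c d icol
  for K' q left right lower upper V out c d icol +
  fixes w :: "bool list"
  assumes out: "out = 11 + d" and K': "0 < K'" and c: "0 < c" and V1: "length w + c + 1 \<le> V"
    and V2: "(length w + c) ^ d * (2 * (length w + c) ^ d + 3) * nb \<le> V"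
begin

definition S :: nat where "S = (length w + c) ^ d"
definition W :: nat where "W = 2 * S + 3"
definition N :: nat where "N = S * W"

lemma S_pos: "0 < S" using c by (simp add: S_def)

lemma bounds: "N * nb \<le> V" "N \<le> V" "W \<le> V" "S \<le> V" "0 < N" "0 < W"
proof -
  show 1: "N * nb \<le> V" using V2 by (simp add: N_def W_def S_def)
  have "N * 1 \<le> N * nb" using nb_pos by (intro mult_le_mono2) simp
  with 1 show 2: "N \<le> V" unfolding mult_1_right by (rule order_trans[rotated])
  have "1 * W \<le> N" unfolding N_def using S_pos by (intro mult_le_mono1) simp
  with 2 show "W \<le> V" by simp
  then show "S \<le> V" by (simp add: W_def)
  show "0 < N" "0 < W" using S_pos by (simp_all add: N_def W_def)
qed

lemma out_gt: "10 + d < out" using out by simp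

lemma run: "reduction_run K' V out N W"
  by unfold_locales (use out K' bounds in auto)

lemma tr_base_prog:
  assumes "\<sigma> 0 = (0, word_cells w)" "\<sigma> 1 = blank_tape"
  shows "tr base_prog \<sigma> (\<sigma>(1 := ruler (length w + c) 0)) []"
  unfolding base_prog_def
proof (rule tr_make_ruler)
  let ?n = "length w"
  define \<tau> where "\<tau> i = \<sigma>(0 := (int i, word_cells w), 1 := counter (int c + int i))" for i
  have \<tau>: "\<tau> i 0 = (int i, word_cells w)" for i by (simp add: \<tau>_def)
  have "tr (mvs 1 c) (\<sigma>(1 := counter 0)) (\<tau> 0) []"
    by (rule tr_advances[OF advances_mvs[of 1 "{}"], where p = 0 and t = "snd (counter 0)"])
      (use out_gt assms in \<open>auto simp: \<tau>_def counter_def fun_eq_iff\<close>)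
  moreover have "tr (Mv 0 Move_Right ;; Mv 1 Move_Right) (\<tau> i) (\<tau> (Suc i)) []" for i
  proof -
    have "tr (Mv 0 Move_Right) (\<tau> i) ((\<tau> i)(0 := (int (Suc i), word_cells w))) []"
      by (rule trD[OF tr_Mv]) (use out_gt in \<open>auto simp: \<tau>_def fun_eq_iff\<close>)
    moreover have "tr (Mv 1 Move_Right) ((\<tau> i)(0 := (int (Suc i), word_cells w))) (\<tau> (Suc i)) []"
      by (rule trD[OF tr_Mv]) (use out_gt in \<open>auto simp: \<tau>_def counter_def fun_eq_iff\<close>)
    ultimately show ?thesis by (rule tr_Seq_silent)
  qed
  then have "tr (Loop 0 0 (Mv 0 Move_Right ;; Mv 1 Move_Right)) (\<tau> 0) (\<tau> ?n) []"
    by (intro tr_Loop_silent) (use out_gt V1 in \<open>auto simp: \<tau> word_cells_def\<close>)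
  moreover have "tr (Mv 0 Move_Left) (\<tau> ?n) ((\<tau> ?n)(0 := (int ?n - 1, word_cells w))) []"
    by (rule trD[OF tr_Mv]) (use out_gt in \<open>auto simp: \<tau>_def fun_eq_iff\<close>)
  moreover have "tr (Loop 0 0 (Mv 0 Move_Left)) ((\<tau> ?n)(0 := (int ?n - 1, word_cells w)))
      ((\<tau> ?n)(0 := (- 1, word_cells w))) []"
    using tr_rewind_to[of "(\<tau> ?n)(0 := (int ?n - 1, word_cells w))" 0 "- 1" ?n "word_cells w" 0]
        out_gt V1
    by (auto simp: word_cells_def)
  moreover have "tr (Mv 0 Move_Right) ((\<tau> ?n)(0 := (- 1, word_cells w))) (\<sigma>(1 :=
      counter (int (?n + c)))) []"
    by (rule trD[OF tr_Mv]) (use out_gt assms in \<open>auto simp: \<tau>_def add.commute fun_eq_iff\<close>)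
  ultimately show "tr (mvs 1 c ;; Loop 0 0 (Mv 0 Move_Right ;; Mv 1 Move_Right) ;;
     Mv 0 Move_Left ;; Loop 0 0 (Mv 0 Move_Left) ;; Mv 0 Move_Right) (\<sigma>(1 := counter 0))
     (\<sigma>(1 := counter (int (?n + c)))) []"
    by (blast intro: tr_Seq_silent)
qed (use assms out_gt c V1 in auto)

lemma power_le_V: "i \<le> d \<Longrightarrow> (length w + c) ^ i \<le> V"
  using power_increasing[of i d "length w + c"] c bounds(4) by (simp add: S_def)

lemma tr_powers_prog:
  assumes "\<sigma> 1 = ruler (length w + c) 0" "\<And>j. 10 \<le> j \<Longrightarrow> j \<noteq> out \<Longrightarrow> \<sigma> j = blank_tape"
  shows "\<exists>\<sigma>'. tr powers_prog \<sigma> \<sigma>' [] \<and> \<sigma>' (10 + d) = ruler S 0 \<and> (\<forall>j<10. \<sigma>' j = \<sigma> j)"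
proof -
  let ?B = "length w + c"
  define \<tau> where "\<tau> i = (\<lambda>j. if 10 \<le> j \<and> j \<le> 10 + i then ruler (?B ^ (j - 10)) 0 else \<sigma> j)" for i
  have "tr (make_ruler 10 (Mv 10 Move_Right)) \<sigma> (\<sigma>(10 := ruler 1 0)) []"
    by (rule tr_make_ruler_advances[OF advances_Mv[where Rs = "{}"]]) (use assms(2)[of 10]
        out_gt V1 in auto)
  moreover have "\<sigma>(10 := ruler 1 0) = \<tau> 0" by (auto simp: \<tau>_def fun_eq_iff)
  moreover have "tr (make_ruler (11 + i) (For (10 + i) (For 1 (Mv (11 + i) Move_Right)))) (\<tau> i)
      (\<tau> (Suc i)) []"
    if "i < d" for i
  proof -
    have "advances (For (10 + i) (For 1 (Mv (11 + i) Move_Right))) (11 + i) (int (?B ^ Suc i))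
        {(10 + i, ?B ^ i), (1, ?B)}"
      by (rule advances_For[where Rs = "{(1, ?B)}" and a = "int ?B" and L = "?B ^ i"],
          rule advances_For[where Rs = "{}" and a = 1 and L = ?B], rule advances_Mv)
        (use that out_gt c V1 power_le_V[of i] in auto)
    then have "tr (make_ruler (11 + i) (For (10 + i) (For 1 (Mv (11 + i) Move_Right)))) (\<tau> i)
        ((\<tau> i)(11 + i := ruler (?B ^ Suc i) 0)) []"
      by (rule tr_make_ruler_advances)
        (use that assms out_gt c V1 power_le_V[of "Suc i"] in \<open>auto simp: \<tau>_def simp del:
            power_Suc\<close>)
    moreover have "(\<tau> i)(11 + i := ruler (?B ^ Suc i) 0) = \<tau> (Suc i)"
      by (auto simp: \<tau>_def fun_eq_iff le_Suc_eq simp del: power_Suc)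
    ultimately show ?thesis by simp
  qed
  then have "tr (seqs (map (\<lambda>i. make_ruler (11 + i) (For (10 + i) (For 1 (Mv (11 + i)
      Move_Right)))) [0..<d])) (\<tau> 0) (\<tau> d) []"
    using tr_seqs[of "map (\<lambda>i. make_ruler (11 + i) (For (10 + i) (For 1 (Mv (11 + i)
        Move_Right)))) [0..<d]" \<tau> "\<lambda>_. []"]
    by (simp add: concat_map_Nil)
  ultimately have "tr powers_prog \<sigma> (\<tau> d) []" unfolding powers_prog_def by (simp add: tr_Seq_silent)
  then show ?thesis by (intro exI[of _ "\<tau> d"]) (auto simp: \<tau>_def S_def)
qed

lemma tr_cells_ruler_prog:
  assumes "\<sigma> (10 + d) = ruler S 0" "\<sigma> 2 = ruler S 0" "\<sigma> y = blank_tape" "2 < y" "y < 10"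
  shows "tr (cells_ruler_prog y) \<sigma> (\<sigma>(y := ruler N 0)) []"
proof -
  have "advances (For 2 (mvs y 2) ;; mvs y 3) y (int W) {(2, S)}"
    by (rule advances_Seq[where a = "int S * 2" and b = 3],
        rule advances_For[where Rs = "{}" and a = 2 and L = S], rule advances_mvs)
      (use assms out_gt S_pos bounds in \<open>auto simp: W_def intro!: advances_mvs\<close>)
  then have "advances (For (10 + d) (For 2 (mvs y 2) ;; mvs y 3)) y (int N) {(2, S), (10 + d, S)}"
    by (rule advances_For[where L = S]) (use assms out_gt S_pos bounds in \<open>auto simp: N_def\<close>)
  then show ?thesis
    unfolding cells_ruler_prog_def
    by (rule tr_make_ruler_advances) (use assms out_gt bounds in auto)
qed

lemma tr_diag_prog:
  assumes "\<sigma> (10 + d) = ruler S 0" "\<sigma> 5 = blank_tape"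
  shows "tr diag_prog \<sigma> (\<sigma>(5 := (0, diag_cells W))) []"
proof -
  let ?t1 = "(\<lambda>_. 0)(0 := 1) :: int \<Rightarrow> nat"
  let ?t2 = "?t1(- 1 := 2)"
  have W: "0 < W" by (rule bounds)
  have "tr (Put 5 1) \<sigma> (\<sigma>(5 := (0, ?t1))) []"
    by (rule trD[OF tr_Put]) (use out_gt assms in \<open>auto simp: blank_tape_def fun_eq_iff\<close>)
  moreover have "tr (Mv 5 Move_Left) (\<sigma>(5 := (0, ?t1))) (\<sigma>(5 := (- 1, ?t1))) []"
    by (rule trD[OF tr_Mv]) (use out_gt in \<open>auto simp: fun_eq_iff\<close>)
  moreover have "tr (Put 5 2) (\<sigma>(5 := (- 1, ?t1))) (\<sigma>(5 := (- 1, ?t2))) []"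
    by (rule trD[OF tr_Put]) (use out_gt in \<open>auto simp: fun_eq_iff\<close>)
  moreover have "tr (Mv 5 Move_Right) (\<sigma>(5 := (- 1, ?t2))) (\<sigma>(5 := (0, ?t2))) []"
    by (rule trD[OF tr_Mv]) (use out_gt in \<open>auto simp: fun_eq_iff\<close>)
  moreover have "tr (For (10 + d) (mvs 5 2) ;; mvs 5 3) (\<sigma>(5 := (0, ?t2))) (\<sigma>(5 := (int W, ?t2)))
      []"
  proof (rule tr_advances[where p = 0 and t = ?t2])
    show "advances (For (10 + d) (mvs 5 2) ;; mvs 5 3) 5 (int W) {(10 + d, S)}"
      by (rule advances_Seq[where a = "int S * 2" and b = 3],
          rule advances_For[where Rs = "{}" and a = 2 and L = S], rule advances_mvs)
        (use assms out_gt S_pos bounds in \<open>auto simp: W_def intro!: advances_mvs\<close>)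
  qed (use assms in \<open>auto simp: fun_eq_iff\<close>)
  moreover have "tr (Put 5 3) (\<sigma>(5 := (int W, ?t2))) (\<sigma>(5 := (int W, diag_cells W))) []"
    by (rule trD[OF tr_Put]) (use out_gt W in \<open>auto simp: diag_cells_def fun_eq_iff\<close>)
  moreover have "tr (Loop 5 1 (Mv 5 Move_Left)) (\<sigma>(5 := (int W, diag_cells W))) (\<sigma>(5 := (0,
      diag_cells W))) []"
    using tr_rewind[of "\<sigma>(5 := (int W, diag_cells W))" 5 W "diag_cells W" 1] out_gt bounds
    by (auto simp: diag_cells_def)
  ultimately show ?thesis unfolding diag_prog_def by (blast intro: tr_Seq_silent)
qed

definition first_cells :: "nat \<Rightarrow> int \<Rightarrow> nat" where
  "first_cells k i = (if 0 \<le> i \<and> i < int k then cell_class w S (nat i) else 0)"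

lemma first_cells_upd: "z = cell_class w S k \<Longrightarrow> (first_cells k)(int k := z) = first_cells (Suc k)"
  by (auto simp: first_cells_def fun_eq_iff)

lemma tr_copy_prog:
  assumes "\<sigma> 0 = (p, word_cells w)" "\<sigma> 6 = (int k, first_cells k)" "cell_class w S k = 1 +
      word_cells w p + a"
  shows "tr (copy_prog a) \<sigma> (\<sigma>(0 := (p + 1, word_cells w), 6 := (int (Suc k),
      first_cells (Suc k)))) []"
proof -
  let ?\<sigma> = "\<sigma>(6 := (int k, first_cells (Suc k)))"
  have "tr (Put 6 (cell_class w S k)) \<sigma> ?\<sigma> []"
    by (rule trD[OF tr_Put]) (use out_gt assms(2) in \<open>auto simp: first_cells_upd fun_eq_iff\<close>)
  moreover have "word_cells w p = 0 \<or> word_cells w p = 1 \<or> word_cells w p = 2"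
    by (simp add: word_cells_def)
  ultimately have "tr (Cond 0 1 (Put 6 (Suc (Suc a))) (Cond 0 2 (Put 6 (Suc (Suc (Suc a))))
      (Put 6 (Suc a)))) \<sigma> ?\<sigma> []"
    using assms out_gt by (intro tr_Cond) (auto intro!: tr_Cond)
  moreover have "tr (Mv 0 Move_Right) ?\<sigma> (?\<sigma>(0 := (p + 1, word_cells w))) []"
    by (rule trD[OF tr_Mv]) (use out_gt assms in \<open>auto simp: fun_eq_iff\<close>)
  moreover have "tr (Mv 6 Move_Right) (?\<sigma>(0 := (p + 1, word_cells w)))
      (\<sigma>(0 := (p + 1, word_cells w), 6 := (int (Suc k), first_cells (Suc k)))) []"
    by (rule trD[OF tr_Mv]) (use out_gt in \<open>auto simp: fun_eq_iff\<close>)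
  ultimately show ?thesis unfolding copy_prog_def by (blast intro: tr_Seq_silent)
qed

lemma tr_copy_loop:
  assumes "\<sigma> 0 = (p, word_cells w)" "\<sigma> 6 = (int k, first_cells k)" "\<sigma> (10 + d) = ruler S 0"
    and "\<And>i. i < S \<Longrightarrow> cell_class w S (k + i) = 1 + word_cells w (p + int i)"
  shows "tr (For (10 + d) (copy_prog 0)) \<sigma>
    (\<sigma>(0 := (p + int S, word_cells w), 6 := (int (k + S), first_cells (k + S)))) []"
proof -
  define h where "h i = \<sigma>(0 := (p + int i, word_cells w), 6 := (int (k + i), first_cells (k +
      i)))" for i
  have "tr (For (10 + d) (copy_prog 0)) ((h 0)(10 + d := ruler S 0)) ((h S)(10 + d := ruler S 0))
      []"
  proof (rule tr_For_silent)
    fix i assume "i < S"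
    have "tr (copy_prog 0) ((h i)(10 + d := ruler S (int i)))
      (((h i)(10 + d := ruler S (int i)))(0 := (p + int i + 1, word_cells w), 6 := (int (Suc (k +
          i)), first_cells (Suc (k + i))))) []"
      by (rule tr_copy_prog) (use assms(4)[OF \<open>i < S\<close>] in \<open>auto simp: h_def\<close>)
    then show "tr (copy_prog 0) ((h i)(10 + d := ruler S (int i))) ((h (Suc i))(10 + d :=
        ruler S (int i))) []"
      by (rule trD) (auto simp: h_def fun_eq_iff)
  qed (use out_gt S_pos bounds in auto)
  moreover have "(h 0)(10 + d := ruler S 0) = \<sigma>" using assms by (auto simp: h_def fun_eq_iff)
  moreover have "(h S)(10 + d := ruler S 0) = h S" using assms(3) by (auto simp: h_def fun_eq_iff)
  ultimately show ?thesis by (simp add: h_def)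
qed

lemma cell_class_mid:
  assumes "0 < m" "m < 2 * S + 2" "p = int m - int S - 1" "p \<noteq> 0"
  shows "cell_class w S m = 1 + word_cells w p"
proof -
  have "m \<noteq> S + 1" using assms(3,4) by auto
  then show ?thesis using assms(1,2) by (simp add: cell_class_def assms(3))
qed

lemma tr_first_row_prog:
  assumes "\<sigma> 0 = (0, word_cells w)" "\<sigma> 6 = blank_tape" "\<sigma> (10 + d) = ruler S 0"
  shows "tr first_row_prog \<sigma> (\<sigma>(0 := (int S + 1, word_cells w), 6 := (0, first_cells W))) []"
proof -
  \<comment> \<open>\<open>p\<close> and \<open>h\<close> are the head positions on tapes 0 and 6,
    \<open>k\<close> is the number of cells of the row written so far.\<close>
  let ?s = "\<lambda>p h k. \<sigma>(0 := (p, word_cells w), 6 := (h, first_cells k))"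
  have upd: "(?s p h k)(0 := (p', word_cells w), 6 := (h', first_cells k')) =
      ?s p' h' k'" for p h k p' h' k'
    by (simp add: fun_eq_iff)
  have 0: "\<sigma> = ?s 0 0 0" using assms by (auto simp: first_cells_def blank_tape_def fun_eq_iff)
  have "tr (For (10 + d) (Mv 0 Move_Left)) (?s 0 0 0) (?s (- int S) 0 0) []"
  proof (rule tr_advances[where p = 0 and t = "word_cells w"])
    show "advances (For (10 + d) (Mv 0 Move_Left)) 0 (- int S) {(10 + d, S)}"
      by (rule advances_For[where Rs = "{}" and a = "- 1" and L = S], rule advances_Mv)
        (use out_gt S_pos bounds in auto)
  qed (use assms in \<open>auto simp: fun_eq_iff\<close>)
  moreover have "tr (Put 6 7) (?s (- int S) 0 0) (?s (- int S) 0 1) []"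
    by (rule trD[OF tr_Put]) (use out_gt in \<open>auto simp: first_cells_def cell_class_def fun_eq_iff\<close>)
  moreover have "tr (Mv 6 Move_Right) (?s (- int S) 0 1) (?s (- int S) 1 1) []"
    by (rule trD[OF tr_Mv]) (use out_gt in \<open>auto simp: fun_eq_iff\<close>)
  moreover have "tr (For (10 + d) (copy_prog 0)) (?s (- int S) 1 1) (?s 0 (int (1 + S)) (1 + S)) []"
  proof (rule trD[OF tr_copy_loop[where p = "- int S" and k = 1]])
    fix i assume "i < S"
    then show "cell_class w S (1 + i) = 1 + word_cells w (- int S + int i)"
      by (intro cell_class_mid) auto
  qed (use assms(3) in \<open>simp_all add: upd\<close>)
  moreover have "tr (copy_prog 3) (?s 0 (int (1 + S)) (1 + S)) (?s 1 (int (2 + S)) (2 + S)) []"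
    by (rule trD[OF tr_copy_prog[where p = 0 and k = "1 + S"]]) (simp_all add: upd cell_class_def)
  moreover have "tr (For (10 + d) (copy_prog 0)) (?s 1 (int (2 + S)) (2 + S)) (?s (int S + 1)
      (int (2 * S + 2)) (2 * S + 2)) []"
  proof (rule trD[OF tr_copy_loop[where p = 1 and k = "2 + S"]])
    fix i assume "i < S"
    then show "cell_class w S (2 + S + i) = 1 + word_cells w (1 + int i)"
      by (intro cell_class_mid) auto
  next
    have "2 + S + S = 2 * S + 2" "int S + 1 = 1 + int S" by simp_all
    then show "?s (int S + 1) (int (2 * S + 2)) (2 * S + 2) = (?s 1 (int (2 + S)) (2 + S))
        (0 := (1 + int S, word_cells w), 6 := (int (2 + S + S), first_cells (2 + S + S)))"
      by (simp only: upd)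
  qed (use assms(3) in \<open>simp_all\<close>)
  moreover have "tr (Put 6 8) (?s (int S + 1) (int (2 * S + 2)) (2 * S + 2)) (?s (int S + 1)
      (int (2 * S + 2)) W) []"
  proof (rule trD[OF tr_Put])
    have "first_cells W = (first_cells (2 * S + 2))(int (2 * S + 2) := 8)"
      using first_cells_upd[of 8 "2 * S + 2"] by (simp add: cell_class_def W_def numeral_3_eq_3)
    then show "?s (int S + 1) (int (2 * S + 2)) W = (?s (int S + 1) (int (2 * S + 2)) (2 * S + 2))
      (6 := (fst ((?s (int S + 1) (int (2 * S + 2)) (2 * S + 2)) 6),
        (snd ((?s (int S + 1) (int (2 * S + 2)) (2 * S + 2)) 6))(fst ((?s (int S + 1)
            (int (2 * S + 2)) (2 * S + 2)) 6) := 8)))"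
      by (simp add: fun_eq_iff)
  qed (use out_gt in simp)
  moreover have "tr (Loop 6 7 (Mv 6 Move_Left)) (?s (int S + 1) (int (2 * S + 2)) W)
    ((?s (int S + 1) (int (2 * S + 2)) W)(6 := (0, first_cells W))) []"
  proof (rule tr_rewind)
    fix i assume "0 < i" "i \<le> int (2 * S + 2)"
    then show "first_cells W i \<noteq> 7"
      using word_cells_le[of w "i - int S - 1"] by (auto simp: first_cells_def cell_class_def)
  qed (use out_gt bounds in \<open>auto simp: first_cells_def cell_class_def W_def\<close>)
  ultimately have "tr first_row_prog (?s 0 0 0) ((?s (int S + 1) (int (2 * S + 2)) W)(6 := (0,
      first_cells W))) []"
    unfolding first_row_prog_def by (blast intro: tr_Seq_silent)
  then show ?thesis unfolding 0[symmetric] by simp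
qed

lemma exec_main_prog:
  "\<exists>\<sigma>'. exec V main_prog (init_store w) \<sigma>' \<and>
     snd (\<sigma>' out) = word_cells (enc_mitr (mitr_of N W (\<lambda>m. icol (cell_class w S m))))"
proof -
  interpret R: reduction_run K' q left right lower upper V out c d icol N W
    by (rule run)
  let ?\<sigma>0 = "init_store w"
  have i0: "?\<sigma>0 0 = (0, word_cells w)" by (simp add: init_store_def)
  have i: "?\<sigma>0 j = blank_tape" if "0 < j" for j
    using that by (auto simp: init_store_def)
  let ?\<sigma>1 = "?\<sigma>0(1 := ruler (length w + c) 0)"
  have 1: "tr base_prog ?\<sigma>0 ?\<sigma>1 []" by (rule tr_base_prog) (simp_all add: i0 i)
  obtain \<sigma>2 where 2: "tr powers_prog ?\<sigma>1 \<sigma>2 []" and \<sigma>2: "\<sigma>2 (10 + d) = ruler S 0" "\<And>j. j < 10 \<Longrightarrow>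
      \<sigma>2 j = ?\<sigma>1 j"
    using tr_powers_prog[of ?\<sigma>1] by (auto simp: i)
  have \<sigma>2b: "\<sigma>2 0 = (0, word_cells w)" "\<And>j. 2 \<le> j \<Longrightarrow> j < 10 \<Longrightarrow> \<sigma>2 j = blank_tape"
    using \<sigma>2(2) by (auto simp: i0 i)
  let ?\<sigma>3 = "\<sigma>2(2 := ruler S 0)"
  have 3: "tr (make_ruler 2 (For (10 + d) (Mv 2 Move_Right))) \<sigma>2 ?\<sigma>3 []"
  proof (rule tr_make_ruler_advances)
    show "advances (For (10 + d) (Mv 2 Move_Right)) 2 (int S) {(10 + d, S)}"
      by (rule advances_For[where Rs = "{}" and a = 1 and L = S], rule advances_Mv)
        (use out_gt S_pos bounds in auto)
  qed (use out_gt S_pos bounds \<sigma>2 \<sigma>2b in auto)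
  let ?\<sigma>4 = "?\<sigma>3(3 := ruler N 0)"
  have 4: "tr (cells_ruler_prog 3) ?\<sigma>3 ?\<sigma>4 []" by (rule tr_cells_ruler_prog) (use \<sigma>2 \<sigma>2b in auto)
  let ?\<sigma>5 = "?\<sigma>4(4 := ruler N 0)"
  have 5: "tr (cells_ruler_prog 4) ?\<sigma>4 ?\<sigma>5 []" by (rule tr_cells_ruler_prog) (use \<sigma>2 \<sigma>2b in auto)
  let ?\<sigma>6 = "?\<sigma>5(5 := (0, diag_cells W))"
  have 6: "tr diag_prog ?\<sigma>5 ?\<sigma>6 []" by (rule tr_diag_prog) (use \<sigma>2 \<sigma>2b in auto)
  let ?\<sigma>7 = "?\<sigma>6(0 := (int S + 1, word_cells w), 6 := (0, first_cells W))"
  have 7: "tr first_row_prog ?\<sigma>6 ?\<sigma>7 []" by (rule tr_first_row_prog) (use \<sigma>2 \<sigma>2b in auto)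
  let ?\<sigma>8 = "?\<sigma>7(7 := counter 0)"
  have 8: "tr (Put 7 1) ?\<sigma>7 ?\<sigma>8 []"
    by (rule trD[OF tr_Put]) (use out_gt \<sigma>2b in \<open>auto simp: blank_tape_def counter_def fun_eq_iff\<close>)
  let ?\<sigma>9 = "?\<sigma>8(8 := counter 0)"
  have 9: "tr (Put 8 1) ?\<sigma>8 ?\<sigma>9 []"
    by (rule trD[OF tr_Put]) (use out_gt \<sigma>2b in \<open>auto simp: blank_tape_def counter_def fun_eq_iff\<close>)
  let ?\<sigma>10 = "?\<sigma>8(8 := counter (int (N * nb)))"
  have 10: "tr (For 3 (mvs 8 nb)) ?\<sigma>9 ?\<sigma>10 []"
  proof (rule tr_advances[where p = 0 and t = "snd (counter 0)"])
    show "advances (For 3 (mvs 8 nb)) 8 (int (N * nb)) {(3, N)}"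
      by (rule advances_For[where Rs = "{}" and a = "int nb" and L = N], rule advances_mvs)
        (use out_gt bounds in auto)
  qed (auto simp: counter_def fun_eq_iff)
  obtain \<sigma>11 where 11: "tr bits_prog ?\<sigma>10 \<sigma>11 (enc_nat (N * nb))"
    and \<sigma>11: "\<And>j. j \<noteq> 8 \<Longrightarrow> j \<noteq> 9 \<Longrightarrow> \<sigma>11 j = ?\<sigma>10 j"
    using R.tr_bits_prog[of "N * nb" ?\<sigma>10] \<sigma>2b bounds by auto
  let ?\<sigma>12 = "\<sigma>11(5 := (- int N, diag_cells W))"
  have 12: "tr basis_prog \<sigma>11 ?\<sigma>12 (concat (map (\<lambda>m. concat (map (row N W m) [0..<nb])) [0..<N]) @
      [False])"
    by (rule R.tr_basis_prog) (simp_all add: \<sigma>11)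
  let ?\<sigma>13 = "?\<sigma>12(6 := (int N, first_cells W))"
  have 13: "tr target_prog ?\<sigma>12 ?\<sigma>13 (concat (map (\<lambda>m. concat (map (\<lambda>\<kappa>. rat_bits (offset W (\<lambda>m.
      icol (cell_class w S m)) m \<kappa>)) [0..<nb])) [0..<N]) @ [False])"
  proof (rule R.tr_target_prog)
    show "cell_class w S m \<in> {1..<9}" for m
      using word_cells_le[of w "int m - int S - 1"] by (auto simp: cell_class_def)
  qed (auto simp: \<sigma>11 first_cells_def)
  have "tr main_prog ?\<sigma>0 ?\<sigma>13 (enc_mitr (mitr_of N W (\<lambda>m. icol (cell_class w S m))))"
    unfolding main_prog_def enc_mitr_of
    using tr_Seq_silent[OF 1 tr_Seq_silent[OF 2 tr_Seq_silent[OF 3 tr_Seq_silent[OF 4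
        tr_Seq_silent[OF 5
      tr_Seq_silent[OF 6 tr_Seq_silent[OF 7 tr_Seq_silent[OF 8 tr_Seq_silent[OF 9 tr_Seq_silent[OF
          10
      tr_Seq[OF 11 tr_Seq[OF 12 13]]]]]]]]]]]]
    unfolding append_assoc .
  then have "exec V main_prog (?\<sigma>0(out := out_tape [])) (?\<sigma>13(out := out_tape ([] @
      enc_mitr (mitr_of N W (\<lambda>m. icol (cell_class w S m))))))"
    unfolding tr_def by blast
  moreover have "?\<sigma>0(out := out_tape []) = ?\<sigma>0"
    using i[of out] out_gt by (auto simp: out_tape_def blank_tape_def word_cells_def fun_eq_iff)
  ultimately show ?thesis
    by (intro exI[of _ "?\<sigma>13(out := out_tape ([] @ enc_mitr (mitr_of N W (\<lambda>m. icol (cell_class w S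
        m)))))"])
      (simp add: out_tape_def)
qed

end

section \<open>The reduction runs in polynomial time\<close>

lemma com_ok_seqs: "com_ok k A (seqs cs) \<longleftrightarrow> (\<forall>c \<in> set cs. com_ok k A c)"
  by (induction cs) (auto simp: seqs_def)

lemma com_ok_For: "com_ok k A (For x c) \<longleftrightarrow> x < k \<and> com_ok k A c"
  by (auto simp: For_def)

lemma (in program) com_ok_emits: "out < k \<Longrightarrow> 2 < A \<Longrightarrow> com_ok k A (emits bs)"
  by (auto simp: emits_def emit_def com_ok_seqs)

lemma com_ok_foldr: "com_ok k A c0 \<Longrightarrow> (\<And>s c. com_ok k A c \<Longrightarrow> com_ok k A (f s c)) \<Longrightarrow>
    com_ok k A (foldr f ss c0)"
  by (induction ss) auto

lemma (in reduction) com_ok_main_prog: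
  assumes "10 + d < k" "out < k" "9 \<le> A"
  shows "com_ok k A main_prog"
proof -
  have [simp]: "com_ok k A (emits bs)" for bs
    using assms com_ok_emits by auto
  have [simp]: "com_ok k A (mvs y n) \<longleftrightarrow> n = 0 \<or> y < k" for y n
    by (auto simp: mvs_def com_ok_seqs)
  have [simp]: "com_ok k A init_prog"
    unfolding init_prog_def by (rule com_ok_foldr) (use assms in auto)
  have [simp]: "com_ok k A (weight_prog z e)" for z e
    using assms by (simp add: weight_prog_def pow_prog_def)
  show ?thesis
    using assms
    by (auto simp: main_prog_def base_prog_def powers_prog_def make_ruler_def
        program.make_ruler_def cells_ruler_prog_def
        diag_prog_def first_row_prog_def copy_prog_def bits_prog_def basis_prog_def target_prog_def
        row_prog_def block_prog_def own_prog_def ints_prog_def offset_prog_def com_ok_seqs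
            com_ok_For)
qed

text \<open>As \<open>d\<close> is fixed, \<open>12 + d\<close> tapes suffice, the last one for
  output. The largest symbol written is the class 8, hence the alphabet size 9.\<close>

theorem polytime_computable_mitr_of:
  fixes left right lower upper icol :: "nat \<Rightarrow> nat"
  assumes "0 < K'" "0 < c"
  shows "polytime_computable (\<lambda>w. let S = (length w + c) ^ d in
    enc_mitr (tile_set.mitr_of K' q left right lower upper (S * (2 * S + 3)) (2 * S + 3)
        (\<lambda>m. icol (cell_class w S m))))"
    (is "polytime_computable ?f")
proof (rule polytime_computable_exec)
  let ?nb = "tile_set.nb K'"
  let ?main = "reduction.main_prog K' q left right lower upper (11 + d) c d icol"
  let ?B = "[:c, 1:] :: nat poly"
  \<comment> \<open>The sum dominates both bounds required by \<open>setup_run\<close>: the one for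
    scanning the input and the dimension \<open>N * nb\<close>.\<close>
  let ?v = "?B + 1 + ?B ^ d * ([:2:] * ?B ^ d + [:3:]) * [:?nb:]"
  show "com_ok (12 + d) 9 ?main" by (rule reduction.com_ok_main_prog) auto
  show "\<exists>\<sigma>'. exec (poly ?v (length w)) ?main (init_store w) \<sigma>' \<and> snd (\<sigma>' (12 + d - 1)) =
      word_cells (?f w)" for w
  proof -
    interpret setup_run K' q left right lower upper "poly ?v (length w)" "11 + d" c d icol w
      by unfold_locales (use assms in \<open>auto simp: algebra_simps\<close>)
    show ?thesis using exec_main_prog by (simp add: Let_def S_def W_def N_def)
  qed
qed auto

section \<open>Tilings and runs of a nondeterministic machine\<close>

type_synonym column = "(nat \<times> bool) list"
type_synonym tile = "nat \<times> transition \<times> column \<times> bool list \<times> bool list"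

text \<open>\<Gamma> contains all symbols that can occur on the tapes of a run, so that there are
  only finitely many columns and tiles.\<close>

locale machine =
  fixes M :: tm and \<Gamma> :: "nat set"
  assumes finite_trans: "finite (transitions M)" and finite_syms: "finite \<Gamma>"
    and tapes: "0 < num_tapes M"
    and trans_len: "(q, rs, q', as) \<in> transitions M \<Longrightarrow> length rs = num_tapes M \<and> length as =
        num_tapes M"
    and syms_0: "{0, 1, 2} \<subseteq> \<Gamma>"
    and syms_as: "(q, rs, q', as) \<in> transitions M \<Longrightarrow> fst ` set as \<subseteq> \<Gamma>"
begin

abbreviation k :: nat where "k \<equiv> num_tapes M"

text \<open>A tile \<open>(e, \<tau>, cs, ri, li)\<close> stands for one cell of all tapes during one step: \<open>e\<close> is 1 at
  the left end and 2 at the right end of the row, \<open>\<tau>\<close> is the transition used in this row, \<open>cs\<close>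
  holds for every tape the symbol and whether the head is here, and \<open>ri\<close>, \<open>li\<close> tell which heads
  enter the cell from the left moving right, and from the right moving left.\<close>

definition tiles :: "tile set" where
  "tiles = {(e, (q, rs, q', as), cs, ri, li) | e q rs q' as cs ri li.
     e < 3 \<and> (q, rs, q', as) \<in> transitions M \<and> set cs \<subseteq> \<Gamma> \<times> UNIV \<and>
     length cs = k \<and> length ri = k \<and> length li = k \<and>
     (\<forall>j<k. snd (cs ! j) \<longrightarrow> fst (cs ! j) = rs ! j) \<and>
     (e = 1 \<longrightarrow> (\<forall>j<k. \<not> ri ! j)) \<and> (e = 2 \<longrightarrow> (\<forall>j<k. \<not> li ! j))}"

fun side :: "tile \<Rightarrow> nat" where
  "side (e, \<tau>, cs, ri, li) = e"

text \<open>The end mark is part of the vertical colours, so the ends prescribed in the first row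
  persist in all rows. The state before or after the step links the transitions of consecutive
  rows.\<close>

fun lower_color :: "tile \<Rightarrow> nat \<times> nat \<times> column" where
  "lower_color (e, (q, rs, q', as), cs, ri, li) = (e, q, cs)"

fun upper_color :: "tile \<Rightarrow> nat \<times> nat \<times> column" where
  "upper_color (e, (q, rs, q', as), cs, ri, li) = (e, q',
     map (\<lambda>j. (if snd (cs ! j) then fst (as ! j) else fst (cs ! j),
       snd (cs ! j) \<and> snd (as ! j) = Stay \<or> ri ! j \<or> li ! j)) [0..<k])"

text \<open>Passing the transition along the row makes all its tiles agree on one nondeterministic
  choice. The two vectors are the heads crossing the edge to the right and to the left: a head that
  leaves a cell must be announced as entering by the neighbour.\<close>

fun left_color :: "tile \<Rightarrow> transition \<times> bool list \<times> bool list" where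
  "left_color (e, (q, rs, q', as), cs, ri, li) =
     ((q, rs, q', as), ri, map (\<lambda>j. snd (cs ! j) \<and> snd (as ! j) = Move_Left) [0..<k])"

fun right_color :: "tile \<Rightarrow> transition \<times> bool list \<times> bool list" where
  "right_color (e, (q, rs, q', as), cs, ri, li) =
     ((q, rs, q', as), map (\<lambda>j. snd (cs ! j) \<and> snd (as ! j) = Move_Right) [0..<k], li)"

text \<open>Undoes the numbering of \<open>cell_class\<close>: 1 to 3 are the symbols of the input
  tape, 4 to 6 the same symbols with all heads present, 7 and 8 the ends.\<close>

definition class_color :: "nat \<Rightarrow> nat \<times> nat \<times> column" where
  "class_color s = (if s = 7 then 1 else if s = 8 then 2 else 0, start_state M,
     (if 1 \<le> s \<and> s \<le> 6 then (s - 1) mod 3 else 0, 4 \<le> s \<and> s \<le> 6) #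
       replicate (k - 1) (0, 4 \<le> s \<and> s \<le> 6))"

lemma finite_tiles: "finite tiles"
proof (rule finite_subset)
  show "tiles \<subseteq> {..<3} \<times> transitions M \<times> {cs. set cs \<subseteq> \<Gamma> \<times> UNIV \<and> length cs = k} \<times>
      {ri. set ri \<subseteq> UNIV \<and> length ri = k} \<times> {li. set li \<subseteq> UNIV \<and> length li = k}"
    unfolding tiles_def by auto
  show "finite ({..<3 :: nat} \<times> transitions M \<times> {cs. set cs \<subseteq> \<Gamma> \<times> (UNIV :: bool set) \<and> length cs =
      k} \<times>
      {ri :: bool list. set ri \<subseteq> UNIV \<and> length ri = k} \<times> {li :: bool list. set li \<subseteq> UNIV \<and>
          length li = k})"
    by (intro finite_cartesian_product finite_lists_length_eq finite_trans finite_syms) auto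
qed

definition side_at :: "nat \<Rightarrow> nat \<Rightarrow> nat" where
  "side_at T m = (if m = 0 then 1 else if m = 2 * T + 2 then 2 else 0)"

text \<open>A row shows the positions from -T - 1 to T + 1. Within T steps no head leaves the range
  from -T to T, so none ever enters across an end.\<close>

definition pos :: "nat \<Rightarrow> nat \<Rightarrow> int" where
  "pos T m = int m - int T - 1"

definition column_at :: "nat \<Rightarrow> tape list \<Rightarrow> nat \<Rightarrow> column" where
  "column_at T ts m = map (\<lambda>(h, t). (t (pos T m), h = pos T m)) ts"

definition tile_at :: "nat \<Rightarrow> transition \<Rightarrow> tape list \<Rightarrow> nat \<Rightarrow> tile" where
  "tile_at T \<tau> ts m = (case \<tau> of (q, rs, q', as) \<Rightarrow> (side_at T m, \<tau>, column_at T ts m,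
     map (\<lambda>j. fst (ts ! j) = pos T m - 1 \<and> snd (as ! j) = Move_Right) [0..<k],
     map (\<lambda>j. fst (ts ! j) = pos T m + 1 \<and> snd (as ! j) = Move_Left) [0..<k]))"

lemma column_at_nth: "j < length ts \<Longrightarrow> column_at T ts m ! j = (snd (ts ! j) (pos T m), fst (ts ! j)
    = pos T m)"
  by (simp add: column_at_def case_prod_unfold)

lemma pos_Suc: "pos T (Suc m) = pos T m + 1"
  by (simp add: pos_def)

lemma lower_color_tile_at: "lower_color (tile_at T (q, rs, q', as) ts m) = (side_at T m, q,
    column_at T ts m)"
  by (simp add: tile_at_def)

lemma right_color_tile_at:
  "length ts = k \<Longrightarrow> right_color (tile_at T (q, rs, q', as) ts m) = left_color (tile_at T (q, rs,
      q', as) ts (Suc m))"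
  by (auto simp: tile_at_def pos_Suc column_at_nth)

lemma upper_color_tile_at:
  assumes "length ts = k" "length as = k"
  shows "upper_color (tile_at T (q, rs, q', as) ts m) = (side_at T m, q',
      column_at T (map2 tape_action as ts) m)"
proof -
  \<comment> \<open>After the step a head is here if it stayed, came from the left or came from the
    right.\<close>
  have eq: "(if fst (ts ! j) = pos T m then fst (as ! j) else snd (ts ! j) (pos T m),
      fst (ts ! j) = pos T m \<and> snd (as ! j) = Stay \<or>
      fst (ts ! j) = pos T m - 1 \<and> snd (as ! j) = Move_Right \<or>
      fst (ts ! j) = pos T m + 1 \<and> snd (as ! j) = Move_Left) =
    (snd (tape_action (as ! j) (ts ! j)) (pos T m), fst (tape_action (as ! j) (ts ! j)) =
        pos T m)" for j
    by (cases "as ! j"; cases "ts ! j"; cases "snd (as ! j)") auto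
  have "map (\<lambda>j. (if snd (column_at T ts m ! j) then fst (as ! j) else fst (column_at T ts m ! j),
      snd (column_at T ts m ! j) \<and> snd (as ! j) = Stay \<or>
      map (\<lambda>j. fst (ts ! j) = pos T m - 1 \<and> snd (as ! j) = Move_Right) [0..<k] ! j \<or>
      map (\<lambda>j. fst (ts ! j) = pos T m + 1 \<and> snd (as ! j) = Move_Left) [0..<k] ! j)) [0..<k] =
    column_at T (map2 tape_action as ts) m"
  proof (rule nth_equalityI)
    show "length (map f [0..<k]) = length (column_at T (map2 tape_action as ts)
        m)" for f :: "nat \<Rightarrow> nat \<times> bool"
      using assms by (simp add: column_at_def)
  next
    fix j assume "j < length (map (\<lambda>j. (if snd (column_at T ts m ! j) then fst (as ! j)
        else fst (column_at T ts m ! j),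
      snd (column_at T ts m ! j) \<and> snd (as ! j) = Stay \<or>
      map (\<lambda>j. fst (ts ! j) = pos T m - 1 \<and> snd (as ! j) = Move_Right) [0..<k] ! j \<or>
      map (\<lambda>j. fst (ts ! j) = pos T m + 1 \<and> snd (as ! j) = Move_Left) [0..<k] ! j)) [0..<k])"
    then have "j < k" by simp
    then show "map (\<lambda>j. (if snd (column_at T ts m ! j) then fst (as ! j)
        else fst (column_at T ts m ! j),
      snd (column_at T ts m ! j) \<and> snd (as ! j) = Stay \<or>
      map (\<lambda>j. fst (ts ! j) = pos T m - 1 \<and> snd (as ! j) = Move_Right) [0..<k] ! j \<or>
      map (\<lambda>j. fst (ts ! j) = pos T m + 1 \<and> snd (as ! j) = Move_Left) [0..<k] ! j)) [0..<k] ! j =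
      column_at T (map2 tape_action as ts) m ! j"
      using assms eq[of j] by (auto simp: column_at_nth split: if_splits)
  qed
  then show ?thesis by (simp add: tile_at_def)
qed

lemma tile_at_in_tiles:
  assumes \<tau>: "(q, map head_symbol ts, q', as) \<in> transitions M"
    and heads: "\<forall>T' \<in> set ts. \<bar>fst T'\<bar> \<le> int T" and syms: "\<forall>T' \<in> set ts. range (snd T') \<subseteq> \<Gamma>"
  shows "tile_at T (q, map head_symbol ts, q', as) ts m \<in> tiles"
proof -
  have len: "length ts = k" "length as = k" using trans_len[OF \<tau>] by auto
  have h: "fst (ts ! j) \<noteq> pos T 0 - 1" "fst (ts ! j) \<noteq> pos T (2 * T + 2) + 1" if "j < k" for j
  proof -
    have "\<bar>fst (ts ! j)\<bar> \<le> int T" using heads len(1) that by simp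
    then show "fst (ts ! j) \<noteq> pos T 0 - 1" "fst (ts ! j) \<noteq> pos T (2 * T + 2) +
        1" by (auto simp: pos_def)
  qed
  have "set (column_at T ts m) \<subseteq> \<Gamma> \<times> UNIV" using syms by (fastforce simp: column_at_def)
  moreover have "side_at T m = 1 \<longrightarrow> m = 0" "side_at T m = 2 \<longrightarrow> m = 2 * T + 2" "side_at T m < 3"
    by (auto simp: side_at_def)
  moreover have "length (column_at T ts m) = k" using len by (simp add: column_at_def)
  ultimately show ?thesis
    using \<tau> len h unfolding tiles_def tile_at_def
    by (auto simp: column_at_nth head_symbol_snd)
qed

text \<open>The meaning of \<open>tiling\<close> before colours become numbers. The number 0 will be
  the outer edge of both ends: a right end is followed by a left end or by nothing, and the sequence
  cannot stop elsewhere.\<close>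

definition tiled :: "nat \<Rightarrow> bool list \<Rightarrow> (nat \<Rightarrow> tile) \<Rightarrow> bool" where
  "tiled T w g \<longleftrightarrow> (let W = 2 * T + 3; N = T * W in
     (\<forall>m<N. g m \<in> tiles) \<and>
     (\<forall>m<N. if side (g m) = 2 then m + 1 < N \<longrightarrow> side (g (m + 1)) = 1
        else m + 1 < N \<and> side (g (m + 1)) \<noteq> 1 \<and> right_color (g m) = left_color (g (m + 1))) \<and>
     (\<forall>m<N. lower_color (g m) = (if W \<le> m then upper_color (g (m - W))
         else class_color (cell_class w T m))))"

lemma class_color_cell_class:
  assumes "length w \<le> T"
  shows "class_color (cell_class w T m) = (side_at T m, start_state M,
      column_at T (snd (init_config M w)) m)"
proof -
  have wc: "word_cells w (pos T m) = 0" if "m = 0 \<or> m = 2 * T + 2"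
    using that assms by (auto simp: pos_def word_cells_def)
  have blank: "word_cells [] = (\<lambda>_. 0)" by (simp add: word_cells_def fun_eq_iff)
  have p0: "pos T m = 0 \<longleftrightarrow> m = T + 1" "pos T (Suc T) = 0" by (auto simp: pos_def)
  show ?thesis
    using wc word_cells_le[of w "pos T m"]
    by (auto simp: class_color_def cell_class_def side_at_def column_at_def init_config_def blank p0
        pos_def[symmetric] map_replicate_const)
qed

definition config_ok :: "nat \<Rightarrow> tm_config \<Rightarrow> bool" where
  "config_ok t C \<longleftrightarrow> length (snd C) = k \<and> (\<forall>T' \<in> set (snd C). \<bar>fst T'\<bar> \<le> int t \<and> range (snd T') \<subseteq> \<Gamma>)"

lemma config_ok_init: "config_ok 0 (init_config M w)"
  using syms_0 tapes by (auto simp: config_ok_def init_config_def word_cells_def)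

lemma config_ok_step:
  assumes "config_ok t C" "(q, map head_symbol (snd C), q', as) \<in> transitions M"
  shows "config_ok (Suc t) (q', map2 tape_action as (snd C))"
proof -
  have "\<bar>fst (tape_action a T')\<bar> \<le> 1 + int t \<and> range (snd (tape_action a T')) \<subseteq> \<Gamma>"
    if "(a, T') \<in> set (zip as (snd C))" for a T'
  proof -
    have "T' \<in> set (snd C)" "a \<in> set as" using that by (auto dest: set_zip_leftD set_zip_rightD)
    then have "\<bar>fst T'\<bar> \<le> int t" "range (snd T') \<subseteq> \<Gamma>" "fst a \<in> \<Gamma>"
      using assms(1) syms_as[OF assms(2)] by (auto simp: config_ok_def)
    moreover have "\<bar>move_offset (snd a)\<bar> \<le> 1" by (cases "snd a") auto
    ultimately show ?thesis by (cases a; cases T') auto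
  qed
  then show ?thesis
    using assms(1) trans_len[OF assms(2)] by (force simp: config_ok_def)
qed

lemma tiled_if_run:
  assumes "length w \<le> T" "(tm_step M ^^ T) (init_config M w) C"
  shows "\<exists>g. tiled T w g"
proof -
  let ?W = "2 * T + 3"
  obtain D where D: "D 0 = init_config M w" "\<And>i. i < T \<Longrightarrow> tm_step M (D i) (D (Suc i))"
    using assms(2) unfolding relpowp_fun_conv by blast
  \<comment> \<open>\<open>tm_step\<close> hides the transition that was used, but the tiles must
    name it.\<close>
  have "\<exists>\<tau>. i < T \<longrightarrow> \<tau> \<in> transitions M \<and> (\<exists>q' as. \<tau> = (fst (D i), map head_symbol (snd (D i)), q',
      as) \<and>
      D (Suc i) = (q', map2 tape_action as (snd (D i))))" for i
    using D(2)[of i] by (force elim: tm_step.cases)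
  then have "\<exists>\<tau>. \<forall>i. i < T \<longrightarrow> \<tau> i \<in> transitions M \<and> (\<exists>q' as. \<tau> i = (fst (D i),
      map head_symbol (snd (D i)), q', as) \<and>
      D (Suc i) = (q', map2 tape_action as (snd (D i))))" by (intro choice) blast
  then obtain \<tau> where \<tau>: "\<And>i. i < T \<Longrightarrow> \<tau> i \<in> transitions M \<and>
      (\<exists>q' as. \<tau> i = (fst (D i), map head_symbol (snd (D i)), q', as) \<and>
      D (Suc i) = (q', map2 tape_action as (snd (D i))))" by blast
  have ok: "config_ok i (D i)" if "i \<le> T" for i
    using that
  proof (induction i)
    case (Suc i)
    with \<tau>[of i] config_ok_step[of i "D i"] show ?case by auto
  qed (simp add: D config_ok_init)
  define g where "g m = tile_at T (\<tau> (m div ?W)) (snd (D (m div ?W))) (m mod ?W)" for m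
  have row: "m div ?W < T" if "m < T * ?W" for m
    using that by (simp add: less_mult_imp_div_less)
  have tile: "g m \<in> tiles \<and> lower_color (g m) = (side_at T (m mod ?W), fst (D (m div ?W)),
      column_at T (snd (D (m div ?W))) (m mod ?W))
      \<and> upper_color (g m) = (side_at T (m mod ?W), fst (D (Suc (m div ?W))),
          column_at T (snd (D (Suc (m div ?W)))) (m mod ?W))
      \<and> right_color (g m) = left_color (tile_at T (\<tau> (m div ?W)) (snd (D (m div ?W)))
          (Suc (m mod ?W)))
      \<and> side (g m) = side_at T (m mod ?W)" if m: "m < T * ?W" for m
  proof -
    let ?i = "m div ?W"
    obtain q' as where t: "\<tau> ?i = (fst (D ?i), map head_symbol (snd (D ?i)), q', as)"
      "D (Suc ?i) = (q', map2 tape_action as (snd (D ?i)))" "\<tau> ?i \<in> transitions M"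
      using \<tau>[OF row[OF m]] by blast
    have ok: "config_ok ?i (D ?i)" and i: "?i < T" using ok[of ?i] row[OF m] by auto
    have len: "length (snd (D ?i)) = k" "length as = k"
      using ok trans_len t by (auto simp: config_ok_def)
    have "g m \<in> tiles"
      unfolding g_def t(1) using t(1,3) ok i by (intro tile_at_in_tiles) (auto simp: config_ok_def)
    moreover have "side (g m) = side_at T (m mod ?W)" by (simp add: g_def t(1) tile_at_def)
    ultimately show ?thesis
      using lower_color_tile_at upper_color_tile_at[OF len] right_color_tile_at[OF len(1)]
      by (simp add: g_def t(1,2))
  qed
  have "tiled T w g"
    unfolding tiled_def Let_def
  proof (intro conjI allI impI)
    fix m assume m: "m < T * ?W"
    show "g m \<in> tiles" using tile[OF m] by blast
    show "if side (g m) = 2 then m + 1 < T * ?W \<longrightarrow> side (g (m + 1)) = 1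
        else m + 1 < T * ?W \<and> side (g (m + 1)) \<noteq> 1 \<and> right_color (g m) = left_color (g (m + 1))"
    proof (cases "Suc (m mod ?W) = ?W")
      case True
      then have "Suc m mod ?W = 0" by (simp add: mod_Suc)
      moreover have "side (g m) = 2" using tile[OF m] True by (simp add: side_at_def)
      ultimately show ?thesis using tile[of "Suc m"] by (simp add: side_at_def)
    next
      case False
      then have s: "Suc m mod ?W = Suc (m mod ?W)" "Suc m div ?W = m div ?W"
        by (auto simp: mod_Suc div_Suc)
      have "m mod ?W < ?W" by simp
      with False have "Suc (m mod ?W) < ?W" by linarith
      moreover have "m = (m div ?W) * ?W + m mod ?W" by (rule div_mult_mod_eq[symmetric])
      moreover have "(m div ?W) * ?W + ?W \<le> T * ?W"
        using row[OF m] mult_le_mono1[of "Suc (m div ?W)" T ?W] by simp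
      ultimately have m1: "m + 1 < T * ?W" by linarith
      have "side (g m) \<noteq> 2" using tile[OF m] \<open>Suc (m mod ?W) < ?W\<close> by (simp add: side_at_def)
      moreover have "side (g (m + 1)) \<noteq> 1" using tile[OF m1] s by (simp add: side_at_def)
      moreover have "right_color (g m) = left_color (g (m + 1))"
        using tile[OF m] s by (simp add: g_def)
      ultimately show ?thesis using m1 by simp
    qed
    show "lower_color (g m) = (if ?W \<le> m then upper_color (g (m - ?W))
        else class_color (cell_class w T m))"
    proof (cases "?W \<le> m")
      case True
      then have "(m - ?W) mod ?W = m mod ?W" "Suc ((m - ?W) div ?W) = m div ?W"
        by (simp_all add: le_mod_geq le_div_geq)
      then show ?thesis using tile[OF m] tile[of "m - ?W"] m True by simp
    next
      case False
      then show ?thesis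
        using tile[OF m] D(1) class_color_cell_class[OF assms(1)] by (simp add: init_config_def)
    qed
  qed
  then show ?thesis by blast
qed

text \<open>Induction over the rows: the lower colours of row \<open>t\<close> spell out a
  configuration reached in \<open>t\<close> steps. Matching makes the transition common to the row
  and determines all entering heads, so the tiles are those of \<open>tile_at\<close> and their
  upper colours spell out a successor.\<close>

lemma run_if_tiled:
  assumes "length w \<le> T" "tiled T w g"
  shows "\<exists>C. (tm_step M ^^ T) (init_config M w) C"
proof -
  let ?W = "2 * T + 3"
  let ?N = "T * ?W"
  have g: "g m \<in> tiles"
    and hor: "if side (g m) = 2 then m + 1 < ?N \<longrightarrow> side (g (m + 1)) = 1
        else m + 1 < ?N \<and> side (g (m + 1)) \<noteq> 1 \<and> right_color (g m) = left_color (g (m + 1))"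
    and ver: "lower_color (g m) = (if ?W \<le> m then upper_color (g (m - ?W))
        else class_color (cell_class w T m))"
    if "m < ?N" for m
    using assms(2) that unfolding tiled_def Let_def by blast+
  \<comment> \<open>There is no row with number T, so only the run is claimed for t = T.\<close>
  have "\<exists>C. (tm_step M ^^ t) (init_config M w) C \<and> config_ok t C \<and>
      (t < T \<longrightarrow> (\<forall>m<?W. lower_color (g (t * ?W + m)) = (side_at T m, fst C, column_at T (snd C) m)))"
    if "t \<le> T" for t
    using that
  proof (induction t)
    case 0
    have "lower_color (g m) = (side_at T m, fst (init_config M w),
        column_at T (snd (init_config M w)) m)"
      if "0 < T" "m < ?W" for m
    proof -
      have "1 * ?W \<le> ?N" using that(1) by (intro mult_le_mono1) simp
      moreover have "m < 1 * ?W" using that(2) by simp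
      ultimately have "m < ?N" by (rule order.strict_trans2[rotated])
      then show ?thesis
        using ver[of m] that class_color_cell_class[OF assms(1)] by (simp add: init_config_def)
    qed
    then show ?case using config_ok_init by auto
  next
    case (Suc t)
    then obtain C where C: "(tm_step M ^^ t) (init_config M w) C" "config_ok t C"
      and low: "\<And>m. m < ?W \<Longrightarrow> lower_color (g (t * ?W + m)) = (side_at T m, fst C,
          column_at T (snd C) m)"
      by auto
    have t: "t < T" using Suc.prems by simp
    have cell: "t * ?W + m < ?N" if "m < ?W" for m
    proof -
      have "t * ?W + m < Suc t * ?W" using that by simp
      also have "\<dots> \<le> ?N" using t by (intro mult_le_mono1) simp
      finally show ?thesis .
    qed
    have len: "length (snd C) = k" and heads: "\<And>j. j < k \<Longrightarrow> \<bar>fst (snd C ! j)\<bar> \<le> int t"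
      using C(2) by (auto simp: config_ok_def)
    define tr where "tr m = fst (snd (g (t * ?W + m)))" for m
    have step: "right_color (g (t * ?W + m)) = left_color (g (t * ?W +
        Suc m))" if "Suc m < ?W" for m
    proof -
      have "side (g (t * ?W + m)) = side_at T m"
        using low[of m] that by (cases "g (t * ?W + m)" rule: lower_color.cases) auto
      then have "side (g (t * ?W + m)) \<noteq> 2" using that by (simp add: side_at_def)
      then show ?thesis using hor[OF cell[of m]] that by simp
    qed
    have tr_Suc: "tr (Suc m) = tr m" if "Suc m < ?W" for m
      using step[OF that] unfolding tr_def
      by (cases "g (t * ?W + m)" rule: lower_color.cases; cases "g (t * ?W +
          Suc m)" rule: lower_color.cases) auto
    obtain q rs q' as where tr0: "tr 0 = (q, rs, q', as)" by (metis prod_cases4)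
    have tr: "tr m = (q, rs, q', as)" if "m < ?W" for m
      using that by (induction m) (auto simp: tr0 tr_Suc)
    have ex: "\<exists>ri li. g (t * ?W + m) = (side_at T m, (q, rs, q', as), column_at T (snd C) m, ri,
        li) \<and> q = fst C"
      if "m < ?W" for m
      using low[OF that] tr[OF that] unfolding tr_def
      by (cases "g (t * ?W + m)" rule: lower_color.cases) auto
    then obtain ri li where gm: "\<And>m. m < ?W \<Longrightarrow>
        g (t * ?W + m) = (side_at T m, (q, rs, q', as), column_at T (snd C) m, ri m, li m)" and
            q: "q = fst C"
      by (metis zero_less_Suc add_Suc_right numeral_3_eq_3)
    have \<tau>: "(q, rs, q', as) \<in> transitions M"
      using g[OF cell[of 0]] gm[of 0] by (auto simp: tiles_def)
    have len': "length rs = k" "length as = k" using trans_len[OF \<tau>] by auto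
    have "rs = map head_symbol (snd C)"
    proof (rule nth_equalityI)
      fix j assume "j < length rs"
      then have j: "j < k" using len' by simp
      \<comment> \<open>The inverse of \<open>pos\<close>. This cell is in the row because the head
        is at most \<open>t < T\<close> away from the origin, and its tile compares the symbol under
        the head with \<open>rs ! j\<close>.\<close>
      define m where "m = nat (fst (snd C ! j) + int T + 1)"
      have m: "m < ?W" "pos T m = fst (snd C ! j)"
        using heads[OF j] t by (auto simp: m_def pos_def)
      have "snd (column_at T (snd C) m ! j) \<longrightarrow> fst (column_at T (snd C) m ! j) = rs ! j"
        using g[OF cell[OF m(1)]] j unfolding gm[OF m(1)] tiles_def by auto
      then show "rs ! j = map head_symbol (snd C) ! j"
        using j len m(2) by (simp add: column_at_nth head_symbol_snd)
    qed (use len len' in simp)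
    then have \<tau>': "(fst C, map head_symbol (snd C), q', as) \<in> transitions M" using \<tau> q by simp
    let ?C' = "(q', map2 tape_action as (snd C))"
    have "tm_step M C ?C'" using tm_step.intros[OF \<tau>'] by simp
    with C(1) have run: "(tm_step M ^^ Suc t) (init_config M w) ?C'" by auto
    have ok: "config_ok (Suc t) ?C'" using config_ok_step[OF C(2) \<tau>'] .
    have step': "ri (Suc m) = map (\<lambda>j. fst (snd C ! j) = pos T m \<and> snd (as ! j) = Move_Right)
        [0..<k] \<and>
        li m = map (\<lambda>j. fst (snd C ! j) = pos T m + 1 \<and> snd (as ! j) = Move_Left)
            [0..<k]" if "Suc m < ?W" for m
    proof -
      have "m < ?W" using that by simp
      have e: "map (\<lambda>j. snd (column_at T (snd C) m' ! j) \<and> P j) [0..<k] =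
          map (\<lambda>j. fst (snd C ! j) = pos T m' \<and> P j) [0..<k]" for m' P
        using len by (simp add: column_at_nth)
      have "map (\<lambda>j. snd (column_at T (snd C) m ! j) \<and> snd (as ! j) = Move_Right) [0..<k] =
          ri (Suc m)"
        "li m = map (\<lambda>j. snd (column_at T (snd C) (Suc m) ! j) \<and> snd (as ! j) = Move_Left) [0..<k]"
        using step[OF that] unfolding gm[OF that] gm[OF \<open>m < ?W\<close>] by simp_all
      then show ?thesis unfolding e by (metis pos_Suc)
    qed
    \<comment> \<open>At the left end the definition of \<open>tiles\<close> forbids entering heads;
      elsewhere the left neighbour determines them.\<close>
    have ri: "ri m = map (\<lambda>j. fst (snd C ! j) = pos T m - 1 \<and> snd (as ! j) = Move_Right)
        [0..<k]" if m: "m < ?W" for m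
    proof (cases m)
      case 0
      have "side_at T m = 1" by (simp add: 0 side_at_def)
      then have "ri m ! j = False" "length (ri m) = k" if "j < k" for j
        using g[OF cell[OF m]] that unfolding gm[OF m] tiles_def by auto
      moreover have "fst (snd C ! j) \<noteq> pos T 0 - 1" if "j < k" for j
        using heads[OF that] t by (auto simp: pos_def)
      ultimately show ?thesis using 0 tapes by (auto intro!: nth_equalityI)
    next
      case (Suc m')
      then show ?thesis using step'[of m'] m by (simp add: pos_Suc)
    qed
    have li: "li m = map (\<lambda>j. fst (snd C ! j) = pos T m + 1 \<and> snd (as ! j) = Move_Left)
        [0..<k]" if m: "m < ?W" for m
    proof (cases "Suc m = ?W")
      case True
      then have "side_at T m = 2" by (simp add: side_at_def)
      have "li m ! j = False" "length (li m) = k" if "j < k" for j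
        using g[OF cell[OF m]] that \<open>side_at T m = 2\<close> unfolding gm[OF m] tiles_def by auto
      moreover have "fst (snd C ! j) \<noteq> pos T m + 1" if "j < k" for j
        using heads[OF that] t True by (auto simp: pos_def)
      ultimately show ?thesis using tapes by (auto intro!: nth_equalityI)
    next
      case False
      then show ?thesis using step'[of m] m by simp
    qed
    have "g (t * ?W + m) = tile_at T (q, rs, q', as) (snd C) m" if "m < ?W" for m
      using gm[OF that] ri[OF that] li[OF that] by (simp add: tile_at_def)
    then have up: "upper_color (g (t * ?W + m)) = (side_at T m, q', column_at T (snd ?C')
        m)" if "m < ?W" for m
      using upper_color_tile_at[OF len len'(2)] that by simp
    have "lower_color (g (Suc t * ?W + m)) = (side_at T m, fst ?C', column_at T (snd ?C') m)"
      if "Suc t < T" "m < ?W" for m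
    proof -
      have "Suc t * ?W + m < Suc (Suc t) * ?W" using that by simp
      also have "\<dots> \<le> ?N" using that by (intro mult_le_mono1) simp
      finally have "Suc t * ?W + m < ?N" .
      then show ?thesis using ver[of "Suc t * ?W + m"] up[OF that(2)] by (simp add: add.assoc)
    qed
    with run ok show ?case by blast
  qed
  from this[of T] show ?thesis by blast
qed

end

section \<open>Numbering tiles and colours\<close>

lemma cell_class_less: "cell_class w T m < 9"
  using word_cells_le[of w "int m - int T - 1"] by (auto simp: cell_class_def)

text \<open>Reading tile indices modulo K' produces the three copies. Colours are numbered
  injectively, the horizontal ones from 1 on, since 0 is reserved for the outer edges of the two
  ends. \<open>q\<close> is taken above \<open>nt\<close> and all these numbers.\<close>

lemma (in machine) ex_tile_set:
  assumes "transitions M \<noteq> {}"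
  obtains K' q left right lower upper icol where "0 < K'" "tile_set.nt K' < q"
    "\<forall>\<kappa>. left \<kappa> < q \<and> right \<kappa> < q \<and> lower \<kappa> < q \<and> upper \<kappa> < q" "\<forall>s<9. icol s < q"
    "\<forall>w T. (\<exists>f. tile_set.tiling K' left right lower upper (T * (2 * T + 3)) (2 * T + 3)
        (\<lambda>m. icol (cell_class w T m)) f) \<longleftrightarrow> (\<exists>g. tiled T w g)"
proof -
  obtain tl where tl: "set tl = tiles" using finite_list[OF finite_tiles] by blast
  define K' where "K' = length tl"
  have K': "0 < K'"
  proof -
    obtain x where "x \<in> transitions M" using assms by blast
    moreover obtain q rs q' as where "x = (q, rs, q', as)" by (rule prod_cases4)
    ultimately have "(q, rs, q', as) \<in> transitions M" by simp
    then have "(0, (q, rs, q', as), replicate k (0, False), replicate k False, replicate k False)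
        \<in> tiles"
      using syms_0 by (auto simp: tiles_def)
    then show ?thesis unfolding K'_def using tl by force
  qed
  define til where "til \<kappa> = tl ! (\<kappa> mod K')" for \<kappa>
  have til: "til \<kappa> \<in> tiles" for \<kappa>
  proof -
    have "\<kappa> mod K' < length tl" using K' unfolding K'_def[symmetric] by simp
    then show ?thesis using nth_mem unfolding til_def tl[symmetric] by blast
  qed
  define H where "H = left_color ` tiles \<union> right_color ` tiles"
  define V where "V = lower_color ` tiles \<union> upper_color ` tiles \<union> class_color ` {..<9}"
  have "finite H" "finite V" using finite_tiles by (auto simp: H_def V_def)
  then obtain ch nh cv nv where ch: "inj_on ch H" "ch ` H = {i. i < (nh :: nat)}"
    and cv: "inj_on cv V" "cv ` V = {i. i < (nv :: nat)}"
    using finite_imp_inj_to_nat_seg[of H] finite_imp_inj_to_nat_seg[of V] by blast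
  have mem: "left_color (til \<kappa>) \<in> H" "right_color (til \<kappa>) \<in> H"
    "lower_color (til \<kappa>) \<in> V" "upper_color (til \<kappa>) \<in> V" for \<kappa>
    using til[of \<kappa>] by (auto simp: H_def V_def)
  have mem_class: "class_color s \<in> V" if "s < 9" for s
    using that by (auto simp: V_def)
  have chb: "ch (left_color (til \<kappa>)) < nh" "ch (right_color (til \<kappa>)) < nh" for \<kappa>
    using ch(2) mem[of \<kappa>] by blast+
  have cvb: "cv (lower_color (til \<kappa>)) < nv" "cv (upper_color (til \<kappa>)) < nv" "s < 9 \<Longrightarrow>
      cv (class_color s) < nv" for \<kappa> s
    using cv(2) mem[of \<kappa>] mem_class[of s] by blast+
  define q where "q = 3 * K' + nh + nv + 1"
  define left where "left \<kappa> = (if side (til \<kappa>) = 1 then 0 else Suc (ch (left_color (til \<kappa>))))" for \<kappa>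
  define right where "right \<kappa> = (if side (til \<kappa>) = 2 then 0 else Suc (ch (right_color (til \<kappa>))))"
      for \<kappa>
  define lower where "lower \<kappa> = cv (lower_color (til \<kappa>))" for \<kappa>
  define upper where "upper \<kappa> = cv (upper_color (til \<kappa>))" for \<kappa>
  define icol where "icol s = cv (class_color s)" for s
  have hor: "right \<kappa> = left \<kappa>' \<longleftrightarrow> (if side (til \<kappa>) = 2 then side (til \<kappa>') = 1
      else side (til \<kappa>') \<noteq> 1 \<and> right_color (til \<kappa>) = left_color (til \<kappa>'))" for \<kappa> \<kappa>'
    using inj_on_eq_iff[OF ch(1), of "right_color (til \<kappa>)" "left_color (til \<kappa>')"] mem
    by (auto simp: left_def right_def)
  have hor0: "right \<kappa> = 0 \<longleftrightarrow> side (til \<kappa>) = 2" for \<kappa>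
    by (simp add: right_def)
  have ver: "lower \<kappa> = upper \<kappa>' \<longleftrightarrow> lower_color (til \<kappa>) = upper_color (til \<kappa>')" for \<kappa> \<kappa>'
    using inj_on_eq_iff[OF cv(1), of "lower_color (til \<kappa>)" "upper_color (til \<kappa>')"] mem
    by (auto simp: lower_def upper_def)
  have ver0: "lower \<kappa> = icol s \<longleftrightarrow> lower_color (til \<kappa>) = class_color s" if "s < 9" for \<kappa> s
    using inj_on_eq_iff[OF cv(1), of "lower_color (til \<kappa>)" "class_color s"] mem mem_class[OF that]
    by (auto simp: lower_def icol_def)
  interpret tile_set K' q left right lower upper .
  have tiling_iff: "tiling (T * (2 * T + 3)) (2 * T + 3) (\<lambda>m. icol (cell_class w T m)) f \<longleftrightarrow>
      (\<forall>m<T * (2 * T + 3). f m < nt) \<and> tiled T w (\<lambda>m. til (f m))" for T w f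
  proof -
    have h: "right (f m) = (if m + 1 < N then left (f (m + 1)) else 0) \<longleftrightarrow>
        (if side (til (f m)) = 2 then m + 1 < N \<longrightarrow> side (til (f (m + 1))) = 1
         else m + 1 < N \<and> side (til (f (m + 1))) \<noteq> 1 \<and> right_color (til (f m)) =
             left_color (til (f (m + 1))))" for m N
      by (auto simp: hor hor0)
    have v: "lower (f m) = (if W \<le> m then upper (f (m - W)) else icol (cell_class w T m)) \<longleftrightarrow>
        lower_color (til (f m)) = (if W \<le> m then upper_color (til (f (m - W)))
            else class_color (cell_class w T m))" for m W
      by (simp add: ver ver0 cell_class_less)
    show ?thesis unfolding tiling_def tiled_def Let_def h v using til by blast
  qed
  have "(\<exists>f. tiling (T * (2 * T + 3)) (2 * T + 3) (\<lambda>m. icol (cell_class w T m)) f) \<longleftrightarrow>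
      (\<exists>g. tiled T w g)" for T w
  proof
    assume "\<exists>g. tiled T w g"
    then obtain g where g: "tiled T w g" ..
    have "\<exists>\<kappa><nt. m < T * (2 * T + 3) \<longrightarrow> til \<kappa> = g m" for m
    proof (cases "m < T * (2 * T + 3)")
      case True
      then have "g m \<in> set tl" using g unfolding tiled_def Let_def tl by blast
      then obtain \<kappa> where "\<kappa> < K'" "tl ! \<kappa> = g m" by (auto simp: in_set_conv_nth K'_def)
      then show ?thesis by (intro exI[of _ \<kappa>]) (simp add: til_def nt_def)
    qed (use nt_pos[OF K'] in auto)
    then obtain f where f: "\<And>m. f m < nt \<and> (m < T * (2 * T + 3) \<longrightarrow> til (f m) = g m)" by metis
    have "tiled T w (\<lambda>m. til (f m))"
      unfolding tiled_def Let_def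
    proof (intro conjI allI impI)
      fix m assume m: "m < T * (2 * T + 3)"
      show "til (f m) \<in> tiles" by (rule til)
      have "if side (g m) = 2 then m + 1 < T * (2 * T + 3) \<longrightarrow> side (g (m + 1)) = 1
          else m + 1 < T * (2 * T + 3) \<and> side (g (m + 1)) \<noteq> 1 \<and> right_color (g m) =
              left_color (g (m + 1))"
        and v: "lower_color (g m) = (if 2 * T + 3 \<le> m then upper_color (g (m - (2 * T + 3)))
            else class_color (cell_class w T m))"
        using g m unfolding tiled_def Let_def by blast+
      then show "if side (til (f m)) = 2 then m + 1 < T * (2 * T + 3) \<longrightarrow> side (til (f (m + 1))) = 1
          else m + 1 < T * (2 * T + 3) \<and> side (til (f (m + 1))) \<noteq> 1 \<and> right_color (til (f m)) =
              left_color (til (f (m + 1)))"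
        using m f[of m] f[of "m + 1"] by (cases "m + 1 < T * (2 * T + 3)") (auto split: if_splits)
      have "til (f m) = g m" "til (f (m - (2 * T + 3))) = g (m - (2 * T + 3))"
        using f m less_imp_diff_less by blast+
      with v show "lower_color (til (f m)) =
          (if 2 * T + 3 \<le> m then upper_color (til (f (m - (2 * T + 3))))
              else class_color (cell_class w T m))"
        by (simp only:)
    qed
    then show "\<exists>f. tiling (T * (2 * T + 3)) (2 * T + 3) (\<lambda>m. icol (cell_class w T m)) f"
      using f tiling_iff by blast
  qed (use tiling_iff in blast)
  moreover have "nt < q" by (simp add: q_def nt_def)
  moreover have "left \<kappa> < q \<and> right \<kappa> < q \<and> lower \<kappa> < q \<and> upper \<kappa> < q" for \<kappa>
    using chb[of \<kappa>] cvb(1,2)[of \<kappa>] by (auto simp: left_def right_def lower_def upper_def q_def)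
  moreover have "icol s < q" if "s < 9" for s
    using cvb(3)[OF that] by (simp add: icol_def q_def)
  ultimately show thesis using K' by (intro that allI impI)
qed

section \<open>Padding with idle steps\<close>

definition idle_transitions :: "nat set \<Rightarrow> tm \<Rightarrow> transition set" where
  "idle_transitions \<Gamma> M = (\<lambda>rs. (accept_state M, rs, accept_state M, map (\<lambda>s. (s, Stay)) rs)) `
     {rs. set rs \<subseteq> \<Gamma> \<and> length rs = num_tapes M}"

definition with_idle :: "nat set \<Rightarrow> tm \<Rightarrow> tm" where
  "with_idle \<Gamma> M = M\<lparr>transitions := transitions M \<union> idle_transitions \<Gamma> M\<rparr>"

lemma tm_step_mono: "transitions M \<subseteq> transitions M' \<Longrightarrow> tm_step M C C' \<Longrightarrow> tm_step M' C C'"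
  by (auto elim!: tm_step.cases intro!: tm_step.intros)

lemma map2_idle: "map2 tape_action (map (\<lambda>s. (s, Stay)) (map head_symbol ts)) ts = ts"
  by (rule nth_equalityI) (auto simp: tape_action_same)

lemma with_idle_stepD: "tm_step (with_idle \<Gamma> M) C C' \<Longrightarrow> tm_step M C C' \<or> fst C = accept_state M"
  by (auto elim!: tm_step.cases intro!: tm_step.intros simp: with_idle_def idle_transitions_def)

lemma (in machine) config_ok_run: "(tm_step M ^^ t) (init_config M w) C \<Longrightarrow> config_ok t C"
proof (induction t arbitrary: C)
  case (Suc t)
  then obtain D where "config_ok t D" "tm_step M D C" by auto
  then show ?case using config_ok_step[of t D] by (auto elim!: tm_step.cases)
qed (simp add: config_ok_init)

text \<open>All runs of \<open>M\<close> have fewer than T steps, so T steps of the padded machine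
  include one that \<open>M\<close> cannot make, and the run of \<open>M\<close> before the first
  such step has reached the accepting state. Conversely, idle steps extend an accepting run to
  length T.\<close>

lemma with_idle_run_iff:
  assumes "machine (with_idle \<Gamma> M) \<Gamma>"
    and bound: "\<And>t C. (tm_step M ^^ t) (init_config M w) C \<Longrightarrow> t < T"
  shows "(\<exists>C. (tm_step (with_idle \<Gamma> M) ^^ T) (init_config (with_idle \<Gamma> M) w) C) \<longleftrightarrow>
    (\<exists>t C. (tm_step M ^^ t) (init_config M w) C \<and> fst C = accept_state M)"
proof -
  let ?M = "with_idle \<Gamma> M"
  interpret machine ?M \<Gamma> by (rule assms(1))
  have init: "init_config ?M w = init_config M w" by (simp add: init_config_def with_idle_def)
  have 1: "\<exists>t C. (tm_step M ^^ t) (init_config M w) C \<and> fst C = accept_state M"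
    if run: "\<exists>C. (tm_step ?M ^^ T) (init_config ?M w) C"
  proof -
    obtain C where "(tm_step ?M ^^ T) (init_config M w) C" using run unfolding init by blast
    moreover have "(tm_step ?M ^^ t) (init_config M w) C \<Longrightarrow> (tm_step M ^^ t) (init_config M w) C \<or>
        (\<exists>t C. (tm_step M ^^ t) (init_config M w) C \<and> fst C = accept_state M)" for t C
    proof (induction t arbitrary: C)
      case (Suc t)
      then obtain D where "(tm_step ?M ^^ t) (init_config M w) D" "tm_step ?M D C" by auto
      then show ?case using Suc.IH[of D] with_idle_stepD[of \<Gamma> M D C] relpowp_Suc_I by metis
    qed simp
    ultimately show ?thesis using bound by blast
  qed
  have 2: "\<exists>C. (tm_step ?M ^^ T) (init_config ?M w) C"
    if accepts: "\<exists>t C. (tm_step M ^^ t) (init_config M w) C \<and> fst C = accept_state M"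
  proof -
    obtain t C where run: "(tm_step M ^^ t) (init_config M w) C" and acc: "fst C = accept_state M"
      using accepts by blast
    have "tm_step M x y \<Longrightarrow> tm_step ?M x y" for x y
      by (rule tm_step_mono) (auto simp: with_idle_def)
    from relpowp_map[of "tm_step M" "tm_step ?M" "\<lambda>x. x", OF this run]
    have run': "(tm_step ?M ^^ t) (init_config ?M w) C" unfolding init .
    from config_ok_run[OF this] have "set (map head_symbol (snd C)) \<subseteq> \<Gamma>" "length (snd C) =
        num_tapes M"
      unfolding config_ok_def by (auto simp: head_symbol_snd) (simp add: with_idle_def)
    then have "(fst C, map head_symbol (snd C), fst C, map (\<lambda>s. (s, Stay))
        (map head_symbol (snd C))) \<in> transitions ?M"
    proof -
      assume "set (map head_symbol (snd C)) \<subseteq> \<Gamma>" "length (snd C) = num_tapes M"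
      then have "(fst C, map head_symbol (snd C), fst C, map (\<lambda>s. (s, Stay))
          (map head_symbol (snd C))) \<in> idle_transitions \<Gamma> M"
        unfolding idle_transitions_def acc by (intro image_eqI[OF refl]) simp
      then show ?thesis by (simp add: with_idle_def)
    qed
    from tm_step.intros[OF this] have "tm_step ?M C C" unfolding map2_idle by simp
    then have "(tm_step ?M ^^ n) C C" for n by (induction n) auto
    from relpowp_trans[OF run' this[of "T - t"]] bound[OF run]
    show ?thesis by (intro exI[of _ C]) simp
  qed
  show ?thesis using 1 2 by blast
qed

text \<open>\<Gamma> collects the blank, the input symbols and what \<open>M\<close> writes. Idle
  steps write back what they read, so adding them for \<Gamma> brings in no further symbol.\<close>

lemma machine_with_idle:
  assumes "wf_tm M"
  shows "\<exists>\<Gamma>. machine (with_idle \<Gamma> M) \<Gamma>"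
proof -
  define \<Gamma> where "\<Gamma> = {0, 1, 2} \<union> (\<Union>(q, rs, q', as) \<in> transitions M. fst ` set as)"
  have wf: "finite (transitions M)" "1 \<le> num_tapes M"
    "\<And>q rs q' as. (q, rs, q', as) \<in> transitions M \<Longrightarrow> length rs = num_tapes M \<and> length as =
        num_tapes M"
    using assms by (auto simp: wf_tm_def)
  have fin: "finite \<Gamma>" using wf(1) by (auto simp: \<Gamma>_def)
  have "machine (with_idle \<Gamma> M) \<Gamma>"
  proof
    show "finite (transitions (with_idle \<Gamma> M))"
      using wf(1) fin by (simp add: with_idle_def idle_transitions_def finite_lists_length_eq)
    show "fst ` set as \<subseteq> \<Gamma>" if "(q, rs, q', as) \<in> transitions (with_idle \<Gamma> M)" for q rs q' as
    proof -
      have "(q, rs, q', as) \<in> transitions M \<or> (q, rs, q', as) \<in> idle_transitions \<Gamma> M"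
        using that by (simp add: with_idle_def)
      then show ?thesis
      proof
        assume "(q, rs, q', as) \<in> transitions M"
        then show ?thesis unfolding \<Gamma>_def by force
      qed (auto simp: idle_transitions_def)
    qed
  qed (use wf fin in \<open>auto simp: with_idle_def idle_transitions_def \<Gamma>_def\<close>)
  then show ?thesis ..
qed

text \<open>Gives the time bound the form that the rulers can compute. The strict inequality is what
  \<open>with_idle_run_iff\<close> asks for; the other one lets the input fit into a row.\<close>

lemma poly_less_power:
  fixes b :: "nat poly"
  shows "\<exists>c d. 0 < c \<and> (\<forall>n. poly b n < (n + c) ^ d \<and> n \<le> (n + c) ^ d)"
proof -
  have "\<exists>c d. \<forall>n. poly b n < (n + c) ^ d"
  proof (induction b)
    case 0
    show ?case by (intro exI[of _ 1] exI[of _ 0]) simp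
  next
    case (pCons a b)
    then obtain c d where cd: "\<And>n. poly b n < (n + c) ^ d" by blast
    \<comment> \<open>Passing from \<open>c\<close> to \<open>a + c + 1\<close> pays for the
      constant coefficient, passing from \<open>d\<close> to \<open>Suc d\<close> for the factor
      \<open>n\<close>.\<close>
    have "poly (pCons a b) n < (n + (a + c + 1)) ^ Suc d" for n
    proof -
      have "poly b n \<le> (n + (a + c + 1)) ^ d"
        using cd[of n] power_mono[of "n + c" "n + (a + c + 1)" d] by simp
      moreover have "1 \<le> (n + (a + c + 1)) ^ d" by simp
      then have "a + 1 \<le> (a + c + 1) * (n + (a + c + 1)) ^ d"
        using mult_le_mono[of "a + 1" "a + c + 1" 1] by simp
      ultimately have "a + n * poly b n + 1 \<le> (a + c + 1) * (n + (a + c + 1)) ^ d + n * (n + (a +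
          c + 1)) ^ d"
        using mult_le_mono2[of "poly b n" "(n + (a + c + 1)) ^ d" n] by linarith
      then show ?thesis by (simp add: algebra_simps)
    qed
    then show ?case by blast
  qed
  then obtain c d where cd: "\<And>n. poly b n < (n + c) ^ d" by blast
  \<comment> \<open>The larger exponent makes the power at least \<open>n\<close> even if
    \<open>d\<close> is 0; the larger constant makes the base positive.\<close>
  have "poly b n < (n + Suc c) ^ Suc d \<and> n \<le> (n + Suc c) ^ Suc d" for n
  proof -
    have "(n + c) ^ d \<le> (n + Suc c) ^ d" by (intro power_mono) auto
    moreover have "1 * (n + Suc c) ^ d \<le> (n + Suc c) * (n + Suc c) ^ d" by (intro mult_le_mono1)
        simp
    moreover have "(n + Suc c) * 1 \<le> (n + Suc c) * (n + Suc c) ^ d" by (intro mult_le_mono2) simp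
    ultimately show ?thesis using cd[of n] unfolding power_Suc mult_1 mult_1_right by linarith
  qed
  then show ?thesis by blast
qed

lemma NP_hard_mono: "NP_hard enc A yes \<Longrightarrow> A \<subseteq> B \<Longrightarrow> NP_hard enc B yes"
  unfolding NP_hard_def by (meson subsetD)

theorem NP_hard_full_rank: "NP_hard enc_mitr {(p, b, c) \<in> mitr_instances. p =
    dim_vec c} mitr_nonempty"
  unfolding NP_hard_def
proof
  fix L assume "L \<in> NP"
  then obtain M b where M: "wf_tm M"
    and bound: "\<And>w t C. (tm_step M ^^ t) (init_config M w) C \<Longrightarrow> t \<le> poly b (length w)"
    and L: "\<And>w. w \<in> L \<longleftrightarrow> (\<exists>t C. (tm_step M ^^ t) (init_config M w) C \<and> fst C = accept_state M)"
    unfolding NP_def by blast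
  obtain \<Gamma> where mach: "machine (with_idle \<Gamma> M) \<Gamma>" using machine_with_idle[OF M] by blast
  interpret machine "with_idle \<Gamma> M" \<Gamma> by (rule mach)
  \<comment> \<open>An idle transition on blanks shows that there is at least one tile.\<close>
  have "(accept_state M, replicate (num_tapes M) 0, accept_state M, map (\<lambda>s. (s, Stay))
      (replicate (num_tapes M) 0))
      \<in> transitions (with_idle \<Gamma> M)"
    using syms_0 by (force simp: with_idle_def idle_transitions_def)
  then have ne: "transitions (with_idle \<Gamma> M) \<noteq> {}" by blast
  obtain K' q left right lower upper icol where K': "0 < K'" "tile_set.nt K' < q"
    and col: "\<forall>\<kappa>. left \<kappa> < q \<and> right \<kappa> < q \<and> lower \<kappa> < q \<and> upper \<kappa> < q" and icol: "\<forall>s<9. icol s < q"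
    and tiling: "\<forall>w T. (\<exists>f. tile_set.tiling K' left right lower upper (T * (2 * T + 3)) (2 * T + 3)
        (\<lambda>m. icol (cell_class w T m)) f) \<longleftrightarrow> (\<exists>g. tiled T w g)"
    by (rule ex_tile_set[OF ne]) (rule that)
  obtain c d where c: "0 < c" and cd: "\<And>n. poly b n < (n + c) ^ d \<and> n \<le> (n + c) ^ d"
    using poly_less_power by blast
  interpret tile_set K' q left right lower upper .
  \<comment> \<open>\<open>S w\<close> is the number of rows, a strict bound on the running time and
    a bound on the input length.\<close>
  define S where "S w = (length w + c) ^ d" for w :: "bool list"
  define g where "g w = mitr_of (S w * (2 * S w + 3)) (2 * S w + 3) (\<lambda>m. icol (cell_class w (S w)
      m))" for w
  have iff: "w \<in> L \<longleftrightarrow> g w \<in> mitr_nonempty" for w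
  proof -
    have less: "t < S w" if "(tm_step M ^^ t) (init_config M w) C" for t C
      using bound[OF that] cd[of "length w"] by (simp add: S_def)
    have len: "length w \<le> S w" using cd[of "length w"] by (simp add: S_def)
    have "w \<in> L \<longleftrightarrow> (\<exists>C. (tm_step (with_idle \<Gamma> M) ^^ S w) (init_config (with_idle \<Gamma> M) w) C)"
      unfolding L by (rule with_idle_run_iff[OF mach less, symmetric])
    also have "\<dots> \<longleftrightarrow> (\<exists>g. tiled (S w) w g)"
      using run_if_tiled[OF len] tiled_if_run[OF len] by blast
    also have "\<dots> \<longleftrightarrow> g w \<in> mitr_nonempty"
      unfolding g_def tiling[rule_format, symmetric]
      by (rule mitr_of_nonempty_iff[symmetric]) (use K' col icol cell_class_less in auto)
    finally show ?thesis .
  qed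
  have inst: "g w \<in> {(p, b, c) \<in> mitr_instances. p = dim_vec c}" for w
    unfolding g_def by (rule mitr_of_instance) (use K' in auto)
  have poly: "polytime_computable (\<lambda>w. enc_mitr (g w))"
    using polytime_computable_mitr_of[OF K'(1) c, of d q left right lower upper icol]
    unfolding g_def S_def Let_def .
  show "\<exists>g. (\<forall>w. g w \<in> {(p, b, c) \<in> mitr_instances. p = dim_vec c} \<and>
      (w \<in> L \<longleftrightarrow> g w \<in> mitr_nonempty)) \<and> polytime_computable (\<lambda>w. enc_mitr (g w))"
    by (rule exI[of _ g], intro conjI allI inst iff poly)
qed

theorem theorem4:
  shows "NP_hard enc_mitr mitr_instances mitr_nonempty \<and>
         NP_hard enc_mitr {(p, b, c) \<in> mitr_instances. p = dim_vec c} mitr_nonempty"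
proof
  show "NP_hard enc_mitr mitr_instances mitr_nonempty"
    by (rule NP_hard_mono[OF NP_hard_full_rank]) auto
qed (rule NP_hard_full_rank)

end
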